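(* Let $\mathbb{K}$ be an arbitrary field and let $n$ be a positive integer. Then every matrix of $\mathrm{M}_n(\mathbb{K})$ is a linear combination, with coefficients in $\mathbb{K}$, of $3$ idempotent matrices of $\mathrm{M}_n(\mathbb{K})$. More precisely, the equality $\ell_n(\mathbb{K})=3$ holds except in the following special cases: (a) if $n=1$, then $\ell_n(\mathbb{K})=1$; (b) if $n=2$ and $\#\mathbb{K}>2$, then $\ell_n(\mathbb{K})=2$; (c) if $n=3$ and every polynomial of degree $3$ in $\mathbb{K}[X]$ has a root in $\mathbb{K}$, then $\ell_n(\mathbb{K})=2$.
   Context: $\mathrm{M}_n(\mathbb{K})$ is the algebra of $n\times n$ matrices over $\mathbb{K}$. A matrix $P\in \mathrm{M}_n(\mathbb{K})$ is idempotent when $P^2=P$. $\#\mathbb{K}$ denotes the cardinality of $\mathbb{K}$ (possibly infinite). $\ell_n(\mathbb{K})$ denotes the smallest integer $\ell$ such that every matrix of $\mathrm{M}_n(\mathbb{K})$ can be written as $\sum_{k=1}^{\ell}\alpha_k P_k$ with $\alpha_1,\dots,\alpha_\ell\in\mathbb{K}$ and $P_1,\dots,P_\ell$ idempotent matrices of $\mathrm{M}_n(\mathbb{K})$ (the zero matrix is an idempotent, so a linear combination of $p$ idempotents is also a linear combination of $k$ idempotents for every $k\geq p$). *)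

theory Defs
  imports "Jordan_Normal_Form.Matrix" "HOL-Computational_Algebra.Polynomial"
begin

definition idempotent_mat :: "nat \<Rightarrow> 'a::field mat \<Rightarrow> bool" where
  "idempotent_mat n P \<longleftrightarrow> P \<in> carrier_mat n n \<and> P * P = P"

definition is_lincomb_of_idempotents :: "nat \<Rightarrow> nat \<Rightarrow> 'a::field mat \<Rightarrow> bool" where
  "is_lincomb_of_idempotents n l A \<longleftrightarrow>
     (\<exists>(\<alpha> :: nat \<Rightarrow> 'a) P. (\<forall>k\<in>{1..l}. idempotent_mat n (P k)) \<and>
        A = finsum (module_mat TYPE('a) n n) (\<lambda>k. \<alpha> k \<cdot>\<^sub>m P k) {1..l})"

(* As a LEAST over nat, this carries information only if some l is admissible,
   i.e. if every n x n matrix is a combination of a bounded number of idempotents. *)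
definition ell :: "'a::field itself \<Rightarrow> nat \<Rightarrow> nat" where
  "ell ty n = (LEAST l. \<forall>A \<in> (carrier_mat n n :: 'a mat set). is_lincomb_of_idempotents n l A)"

(* The disjunct is needed because card of an infinite set is 0. *)
definition more_than_two_elements :: "'a::field itself \<Rightarrow> bool" where
  "more_than_two_elements ty \<longleftrightarrow> infinite (UNIV :: 'a set) \<or> card (UNIV :: 'a set) > 2"

definition every_cubic_has_root :: "'a::field itself \<Rightarrow> bool" where
  "every_cubic_has_root ty \<longleftrightarrow> (\<forall>p :: 'a poly. degree p = 3 \<longrightarrow> (\<exists>x. poly p x = 0))"

end

theory Submission
  imports Defs "Jordan_Normal_Form.Char_Poly"
begin

text \<open>
  Upper bound. Splitting off cyclic subspaces of maximal dimension brings \<open>A\<close> to the form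
  \<open>H \<oplus> x I\<close>, where \<open>H\<close> is upper Hessenberg with subdiagonal entries \<open>0, 1\<close> and no two adjacent
  zeros. If some Krylov space has dimension at least 3, one can subtract \<open>c R\<close> with \<open>R\<close> idempotent
  so that \<open>H - c R\<close> has a subdiagonal of ones and a prescribed characteristic polynomial, subject
  only to the trace. This makes it similar to a lower bidiagonal matrix whose diagonal alternates
  between \<open>a\<close> and \<open>b\<close> (possibly after a first entry 0), which is visibly \<open>a P + b Q\<close>. The trace
  equation is solvable with nonzero \<open>a\<close>, \<open>b\<close> for every nonzero \<open>c\<close>, so \<open>c\<close> can be chosen to absorb
  \<open>x I\<close>. Otherwise \<open>A\<close> is annihilated by a quadratic polynomial and splits into 2 by 2 blocks.

  Lower bound. If \<open>A = a P + b Q\<close> then \<open>A ((a + b) I - A)\<close> commutes with \<open>P\<close> and \<open>Q\<close>. For a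
  diagonal matrix with four generic nonzero eigenvalues this is impossible. If \<open>A\<close> is a 3 by 3
  matrix without eigenvalues padded by zeros, it reduces the question to 3 by 3 idempotents, which
  always have a common eigenvector. A field in which every cubic has a root is infinite, because
  \<open>x^3 - x\<close> is not injective, so one of the two examples is always available when \<open>n\<close> is at least 4.
\<close>

section \<open>Linear combinations with prescribed coefficients\<close>

text \<open>Combinations on two diagonal blocks can be joined only when both blocks use the same
  coefficients. Therefore the list of coefficients is kept explicit, and the scalar block
  \<open>x I\<close> has to be reached with the list chosen for the Hessenberg block. This is
  possible because only the trace of \<open>H - c R\<close> is rigid: the free entries of
  \<open>R\<close> can correct every other coefficient of the characteristic polynomial, provided
  that each superdiagonal offers one of them. On the first superdiagonal the construction uses two
  consecutive ones at the start of the subdiagonal, that is, a Krylov space of dimension 3. If there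
  is none, the coefficients come from the quadratic polynomial instead: all companion blocks share
  its trace, and only its roots occur as scalars.

  For the lower bound, two eigenvalues \<open>u\<close> and \<open>v\<close> of \<open>A\<close>
  give the same eigenvalue of \<open>A ((a + b) I - A)\<close> exactly if \<open>u = v\<close> or
  \<open>u + v = a + b\<close>. Generic means that no two of the four eigenvalues can have the sum
  \<open>a + b\<close>, so that each of them would have to be \<open>a\<close>, \<open>b\<close> or
  \<open>a + b\<close>.\<close>

fun idem_comb :: "nat \<Rightarrow> 'a::field list \<Rightarrow> 'a mat \<Rightarrow> bool" where
  "idem_comb n [] A \<longleftrightarrow> A = 0\<^sub>m n n"
| "idem_comb n (c # cs) A \<longleftrightarrow>
     (\<exists>P B. idempotent_mat n P \<and> idem_comb n cs B \<and> A = B + c \<cdot>\<^sub>m P)"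

lemma idem_comb_carrier: "idem_comb n cs A \<Longrightarrow> A \<in> carrier_mat n n"
  by (induction cs arbitrary: A) (auto simp: idempotent_mat_def)

lemma is_lincomb_0: "is_lincomb_of_idempotents n 0 (A :: 'a::field mat) \<longleftrightarrow> A = 0\<^sub>m n n"
proof -
  interpret abelian_group "module_mat TYPE('a) n n" by (rule abelian_group_mat)
  show ?thesis
    by (simp add: is_lincomb_of_idempotents_def module_mat_simps)
qed

lemma is_lincomb_Suc:
  "is_lincomb_of_idempotents n (Suc l) (A :: 'a::field mat) \<longleftrightarrow>
     (\<exists>c P B. idempotent_mat n P \<and> is_lincomb_of_idempotents n l B \<and> A = B + c \<cdot>\<^sub>m P)"
proof -
  interpret abelian_group "module_mat TYPE('a) n n" by (rule abelian_group_mat)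
  let ?fs = "finsum (module_mat TYPE('a) n n)"
  have car: "?fs f {1..l} \<in> carrier_mat n n"
    if "\<And>k. k \<in> {1..Suc l} \<Longrightarrow> f k \<in> carrier_mat n n" for f
    using finsum_closed[of f "{1..l}"] that by (auto simp: module_mat_simps)
  have ins: "?fs f {1..Suc l} = ?fs f {1..l} + f (Suc l)"
    if f: "\<And>k. k \<in> {1..Suc l} \<Longrightarrow> f k \<in> carrier_mat n n" for f
  proof -
    have "{1..Suc l} = insert (Suc l) {1..l}" by auto
    then have "?fs f {1..Suc l} = f (Suc l) + ?fs f {1..l}"
      using finsum_insert[of "{1..l}" "Suc l" f] f by (auto simp: module_mat_simps)
    also have "\<dots> = ?fs f {1..l} + f (Suc l)"
      using f by (intro comm_add_mat[OF _ car]) auto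
    finally show ?thesis .
  qed
  show ?thesis
  proof
    assume "is_lincomb_of_idempotents n (Suc l) A"
    then obtain \<alpha> P where P: "\<And>k. k \<in> {1..Suc l} \<Longrightarrow> idempotent_mat n (P k)"
      and A: "A = ?fs (\<lambda>k. \<alpha> k \<cdot>\<^sub>m P k) {1..Suc l}"
      unfolding is_lincomb_of_idempotents_def by blast
    have Pc: "\<alpha> k \<cdot>\<^sub>m P k \<in> carrier_mat n n" if "k \<in> {1..Suc l}" for k
      using P[OF that] by (auto simp: idempotent_mat_def)
    have "A = ?fs (\<lambda>k. \<alpha> k \<cdot>\<^sub>m P k) {1..l} + \<alpha> (Suc l) \<cdot>\<^sub>m P (Suc l)"
      unfolding A by (rule ins[OF Pc])
    moreover have "is_lincomb_of_idempotents n l (?fs (\<lambda>k. \<alpha> k \<cdot>\<^sub>m P k) {1..l})"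
      unfolding is_lincomb_of_idempotents_def using P by fastforce
    ultimately show "\<exists>c P B. idempotent_mat n P \<and> is_lincomb_of_idempotents n l B \<and> A = B + c \<cdot>\<^sub>m P"
      using P[of "Suc l"] by auto
  next
    assume "\<exists>c P B. idempotent_mat n P \<and> is_lincomb_of_idempotents n l B \<and> A = B + c \<cdot>\<^sub>m P"
    then obtain c Q B \<alpha> P where Q: "idempotent_mat n Q" and A: "A = B + c \<cdot>\<^sub>m Q"
      and P: "\<And>k. k \<in> {1..l} \<Longrightarrow> idempotent_mat n (P k)"
      and B: "B = ?fs (\<lambda>k. \<alpha> k \<cdot>\<^sub>m P k) {1..l}"
      unfolding is_lincomb_of_idempotents_def by blast
    define \<alpha>' where "\<alpha>' = \<alpha>(Suc l := c)"
    define P' where "P' = P(Suc l := Q)"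
    have P': "idempotent_mat n (P' k)" if "k \<in> {1..Suc l}" for k
      using P Q that by (auto simp: P'_def)
    then have Pc: "\<alpha>' k \<cdot>\<^sub>m P' k \<in> carrier_mat n n" if "k \<in> {1..Suc l}" for k
      using that by (auto simp: idempotent_mat_def)
    have B': "B = ?fs (\<lambda>k. \<alpha>' k \<cdot>\<^sub>m P' k) {1..l}"
      unfolding B
    proof (rule finsum_cong'[OF refl])
      show "(\<lambda>k. \<alpha>' k \<cdot>\<^sub>m P' k) \<in> {1..l} \<rightarrow> carrier (module_mat TYPE('a) n n)"
        using Pc by (auto simp: module_mat_simps)
    qed (auto simp: \<alpha>'_def P'_def)
    have "A = B + \<alpha>' (Suc l) \<cdot>\<^sub>m P' (Suc l)"
      unfolding A by (simp add: \<alpha>'_def P'_def)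
    also have "\<dots> = ?fs (\<lambda>k. \<alpha>' k \<cdot>\<^sub>m P' k) {1..Suc l}"
      unfolding B' by (rule ins[OF Pc, symmetric])
    finally have "A = \<dots>" .
    then show "is_lincomb_of_idempotents n (Suc l) A"
      unfolding is_lincomb_of_idempotents_def using P' by blast
  qed
qed

lemma is_lincomb_iff:
  "is_lincomb_of_idempotents n l A \<longleftrightarrow> (\<exists>cs. length cs = l \<and> idem_comb n cs A)"
proof (induction l arbitrary: A)
  case 0
  then show ?case by (simp add: is_lincomb_0)
next
  case (Suc l)
  have "(\<exists>cs. length cs = Suc l \<and> idem_comb n cs A) \<longleftrightarrow> (\<exists>c cs. length cs = l \<and> idem_comb n (c # cs) A)"
    by (metis length_Suc_conv)
  then show ?case unfolding is_lincomb_Suc Suc.IH idem_comb.simps by blast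
qed

lemma idempotent_0: "idempotent_mat n (0\<^sub>m n n)"
  and idempotent_1: "idempotent_mat n (1\<^sub>m n)"
  by (auto simp: idempotent_mat_def)

lemma is_lincomb_mono:
  assumes "is_lincomb_of_idempotents n l A" "l \<le> l'"
  shows "is_lincomb_of_idempotents n l' A"
  using assms(2)
proof (induction l' rule: dec_induct)
  case base
  show ?case by (fact assms(1))
next
  case (step m)
  from step(3) have "A \<in> carrier_mat n n"
    unfolding is_lincomb_iff using idem_comb_carrier by blast
  then have "A = A + 0 \<cdot>\<^sub>m 0\<^sub>m n n" by (intro eq_matI) auto
  then show ?case using step(3) idempotent_0 unfolding is_lincomb_Suc by blast
qed

text \<open>Padding with zero idempotents makes the admissible lengths upward closed, so a single
  matrix that fails for \<open>l\<close> excludes every length up to \<open>l\<close>.\<close>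

lemma ell_eqI:
  assumes "\<And>A. A \<in> carrier_mat n n \<Longrightarrow> is_lincomb_of_idempotents n (Suc l) (A :: 'a::field mat)"
    and "B \<in> carrier_mat n n" "\<not> is_lincomb_of_idempotents n l (B :: 'a mat)"
  shows "ell TYPE('a) n = Suc l"
  unfolding ell_def
proof (rule Least_equality)
  fix y assume y: "\<forall>A\<in>(carrier_mat n n :: 'a mat set). is_lincomb_of_idempotents n y A"
  show "Suc l \<le> y"
  proof (rule ccontr)
    assume "\<not> Suc l \<le> y"
    then have "y \<le> l" by simp
    with y assms(2,3) is_lincomb_mono show False by blast
  qed
qed (use assms(1) in blast)

section \<open>Operations that preserve the list of coefficients\<close>

lemma idem_comb_similar:
  assumes "similar_mat A B" "idem_comb n cs B"
  shows "idem_comb n cs A"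
proof -
  have B: "B \<in> carrier_mat n n" using assms(2) by (rule idem_comb_carrier)
  from assms(1) obtain P Q where "similar_mat_wit B A P Q"
    using similar_mat_sym unfolding similar_mat_def by blast
  then have "similar_mat_wit A B Q P" by (rule similar_mat_wit_sym)
  moreover from this B have "A \<in> carrier_mat n n"
    using assms(1) similar_matD[of A B] by auto
  ultimately have w: "P \<in> carrier_mat n n" "Q \<in> carrier_mat n n" "P * Q = 1\<^sub>m n" "A = Q * B * P"
    using similar_mat_witD2[of A n n B Q P] by auto
  have "idem_comb n cs (Q * B * P)" using assms(2)
  proof (induction cs arbitrary: B)
    case Nil
    then show ?case using w by auto
  next
    case (Cons c cs)
    then obtain R C where R: "R \<in> carrier_mat n n" "R * R = R" and C: "idem_comb n cs C"
      and B: "B = C + c \<cdot>\<^sub>m R" by (auto simp: idempotent_mat_def)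
    have Cc: "C \<in> carrier_mat n n" using C by (rule idem_comb_carrier)
    have PQ: "P * (Q * Y) = Y" if "Y \<in> carrier_mat n n" for Y
      using that w by (simp add: assoc_mult_mat[of P n n Q n Y n, symmetric])
    have RR: "R * (R * Y) = R * Y" if "Y \<in> carrier_mat n n" for Y
      using that R by (simp add: assoc_mult_mat[of R n n R n Y n, symmetric])
    have "Q * R * P * (Q * R * P) = Q * R * P"
      using w(1,2) R(1) by (simp add: assoc_mult_mat[of _ n n _ n _ n] PQ RR)
    then have "idempotent_mat n (Q * R * P)" using w R by (auto simp: idempotent_mat_def)
    moreover have "Q * B * P = Q * C * P + c \<cdot>\<^sub>m (Q * R * P)"
      unfolding B using w R Cc
      by (simp add: mult_add_distrib_mat[of _ n n _ n] add_mult_distrib_mat[of _ n n _ _ n]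
          mult_smult_distrib[of _ n n _ n] mult_smult_assoc_mat[of _ n n _ n])
    ultimately show ?case using Cons.IH[OF C] by auto
  qed
  then show ?thesis using w by simp
qed

lemma idem_comb_transpose:
  assumes "idem_comb n cs A"
  shows "idem_comb n cs (transpose_mat A)"
  using assms
proof (induction cs arbitrary: A)
  case (Cons c cs)
  then obtain R C where R: "R \<in> carrier_mat n n" "R * R = R" and C: "idem_comb n cs C"
      and A: "A = C + c \<cdot>\<^sub>m R" by (auto simp: idempotent_mat_def)
  have Cc: "C \<in> carrier_mat n n" using C by (rule idem_comb_carrier)
  have "idempotent_mat n (transpose_mat R)"
    using R transpose_mult[OF R(1) R(1)] by (auto simp: idempotent_mat_def)
  moreover have "transpose_mat A = transpose_mat C + c \<cdot>\<^sub>m transpose_mat R"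
    unfolding A using R Cc by (intro eq_matI) auto
  ultimately show ?case using Cons.IH[OF C] by auto
qed auto

lemma idem_comb_block:
  assumes "idem_comb n cs A" "idem_comb m cs B"
  shows "idem_comb (n + m) cs (four_block_mat A (0\<^sub>m n m) (0\<^sub>m m n) B)"
  using assms
proof (induction cs arbitrary: A B)
  case (Cons c cs)
  then obtain R C R' C' where R: "R \<in> carrier_mat n n" "R * R = R" and C: "idem_comb n cs C"
      and A: "A = C + c \<cdot>\<^sub>m R"
      and R': "R' \<in> carrier_mat m m" "R' * R' = R'" and C': "idem_comb m cs C'"
      and B: "B = C' + c \<cdot>\<^sub>m R'" by (auto simp: idempotent_mat_def)
  note Cc = idem_comb_carrier[OF C] idem_comb_carrier[OF C']
  have "idempotent_mat (n + m) (four_block_mat R (0\<^sub>m n m) (0\<^sub>m m n) R')"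
    using R R' by (auto simp: idempotent_mat_def mult_four_block_mat[of _ n n _ m _ m _ _ n _ m])
  moreover have "four_block_mat A (0\<^sub>m n m) (0\<^sub>m m n) B
    = four_block_mat C (0\<^sub>m n m) (0\<^sub>m m n) C' + c \<cdot>\<^sub>m four_block_mat R (0\<^sub>m n m) (0\<^sub>m m n) R'"
    unfolding A B using R R' Cc by (intro eq_matI) auto
  ultimately show ?case using Cons.IH[OF C C'] by auto
qed auto

lemma idem_comb_skip:
  assumes "idem_comb n cs A"
  shows "idem_comb n (c # cs) A"
proof -
  have "A = A + c \<cdot>\<^sub>m 0\<^sub>m n n" using idem_comb_carrier[OF assms] by (intro eq_matI) auto
  then show ?thesis using assms idempotent_0 unfolding idem_comb.simps by blast
qed

lemma idem_comb_add_scalar: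
  assumes "idem_comb n cs (x \<cdot>\<^sub>m 1\<^sub>m n)"
  shows "idem_comb n (c # cs) ((x + c) \<cdot>\<^sub>m 1\<^sub>m n)"
proof -
  have "(x + c) \<cdot>\<^sub>m 1\<^sub>m n = x \<cdot>\<^sub>m 1\<^sub>m n + c \<cdot>\<^sub>m 1\<^sub>m n" by (intro eq_matI) auto
  then show ?thesis using assms idempotent_1 unfolding idem_comb.simps by blast
qed

text \<open>With every idempotent chosen as 0 or the identity, the scalars obtained are the subset
  sums of the list; these are the ones needed for the scalar blocks.\<close>

lemma idem_comb_scalar:
  assumes "x \<in> {0, a, b, a + b, c}"
  shows "idem_comb n [c, a, b] (x \<cdot>\<^sub>m 1\<^sub>m n)"
proof -
  have 0: "idem_comb n [] (0 \<cdot>\<^sub>m 1\<^sub>m n)" by auto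
  from assms consider "x = 0" | "x = a" | "x = b" | "x = a + b" | "x = c" by blast
  then show ?thesis
  proof cases
    case 1 then show ?thesis using 0 idem_comb_skip by metis
  next
    case 2 then show ?thesis using idem_comb_add_scalar[OF idem_comb_skip[OF 0, of b], of a]
      by (metis add_0 idem_comb_skip)
  next
    case 3 then show ?thesis using idem_comb_add_scalar[OF 0, of b]
      by (metis add_0 idem_comb_skip)
  next
    case 4 then show ?thesis
      using idem_comb_add_scalar[OF idem_comb_add_scalar[OF 0, of b], of a]
      by (metis add.commute add_0 idem_comb_skip)
  next
    case 5 then show ?thesis
      using idem_comb_add_scalar[OF idem_comb_skip[OF idem_comb_skip[OF 0, of b], of a], of c]
      by simp
  qed
qed

section \<open>Idempotents recognised from their rows\<close>

lemma idempotent_rowsI: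
  fixes R :: "'a::field mat"
  assumes R: "R \<in> carrier_mat n n"
    and 0: "\<And>i j. i < n \<Longrightarrow> j < n \<Longrightarrow> \<not> U i \<Longrightarrow> R $$ (i, j) = 0"
    and 1: "\<And>i j. i < n \<Longrightarrow> j < n \<Longrightarrow> U i \<Longrightarrow> U j \<Longrightarrow> R $$ (i, j) = (if i = j then 1 else 0)"
  shows "idempotent_mat n R"
proof -
  have "R * R = R"
  proof (rule eq_matI)
    fix i j assume ij: "i < dim_row R" "j < dim_col R"
    then have ij: "i < n" "j < n" using R by auto
    have "(R * R) $$ (i, j) = (\<Sum>k<n. R $$ (i, k) * R $$ (k, j))"
      using R ij by (auto simp: scalar_prod_def intro!: sum.cong)
    also have "\<dots> = (\<Sum>k<n. if k = i then R $$ (i, j) else 0)"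
    proof (rule sum.cong)
      fix k assume "k \<in> {..<n}"
      then show "R $$ (i, k) * R $$ (k, j) = (if k = i then R $$ (i, j) else 0)"
        using ij 0[of i k] 0[of k j] 1[of i k] 0[of i j] by (cases "U i"; cases "U k") auto
    qed simp
    also have "\<dots> = R $$ (i, j)" using ij by simp
    finally show "(R * R) $$ (i, j) = R $$ (i, j)" .
  qed (use R in auto)
  then show ?thesis using R by (simp add: idempotent_mat_def)
qed

text \<open>The rows in \<open>S\<close> divided by \<open>a\<close> form one idempotent and the
  rows in \<open>T\<close> divided by \<open>b\<close> the other. Entries leading from
  \<open>S\<close> out of \<open>S\<close>, or from \<open>T\<close> out of \<open>T\<close>, are
  unrestricted; this freedom is what all later normal forms exploit.\<close>

lemma idem_comb_2_rowsI:
  fixes M :: "'a::field mat"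
  assumes M: "M \<in> carrier_mat n n" and ab: "a \<noteq> 0" "b \<noteq> 0"
    and dj: "\<And>i. i < n \<Longrightarrow> \<not> (S i \<and> T i)"
    and S: "\<And>i j. i < n \<Longrightarrow> j < n \<Longrightarrow> S i \<Longrightarrow> S j \<Longrightarrow> M $$ (i, j) = (if i = j then a else 0)"
    and T: "\<And>i j. i < n \<Longrightarrow> j < n \<Longrightarrow> T i \<Longrightarrow> T j \<Longrightarrow> M $$ (i, j) = (if i = j then b else 0)"
    and Z: "\<And>i j. i < n \<Longrightarrow> j < n \<Longrightarrow> \<not> S i \<Longrightarrow> \<not> T i \<Longrightarrow> M $$ (i, j) = 0"
  shows "idem_comb n [a, b] M"
proof -
  define P where "P = mat n n (\<lambda>(i,j). if S i then M $$ (i, j) / a else 0)"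
  define Q where "Q = mat n n (\<lambda>(i,j). if T i then M $$ (i, j) / b else 0)"
  have "idempotent_mat n P" by (rule idempotent_rowsI[of _ _ S]) (auto simp: P_def S ab)
  moreover have "idempotent_mat n Q" by (rule idempotent_rowsI[of _ _ T]) (auto simp: Q_def T ab)
  moreover have "M = (0\<^sub>m n n + b \<cdot>\<^sub>m Q) + a \<cdot>\<^sub>m P"
  proof (rule eq_matI)
    fix i j assume "i < dim_row (0\<^sub>m n n + b \<cdot>\<^sub>m Q + a \<cdot>\<^sub>m P)" "j < dim_col (0\<^sub>m n n + b \<cdot>\<^sub>m Q + a \<cdot>\<^sub>m P)"
    then have "i < n" "j < n" by (auto simp: P_def)
    then show "M $$ (i, j) = (0\<^sub>m n n + b \<cdot>\<^sub>m Q + a \<cdot>\<^sub>m P) $$ (i, j)"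
      using dj[of i] Z[of i j] ab by (auto simp: P_def Q_def)
  qed (use M in \<open>auto simp: P_def\<close>)
  ultimately show ?thesis by auto
qed

declare idem_comb.simps(2) [simp del]

section \<open>Hessenberg matrices\<close>

text \<open>\<open>hess_poly m j\<close> is the characteristic polynomial of \<open>hess_mat j m\<close>; this is the recursion
  satisfied by the polynomials \<open>p\<^sub>j\<close> that send the first basis vector to the \<open>j\<close>-th one.\<close>

fun hess_poly :: "(nat \<Rightarrow> nat \<Rightarrow> 'a::field) \<Rightarrow> nat \<Rightarrow> 'a poly" where
  "hess_poly m 0 = 1"
| "hess_poly m (Suc j) = pCons 0 (hess_poly m j) - (\<Sum>i\<le>j. smult (m i j) (hess_poly m i))"

declare hess_poly.simps(2) [simp del]

definition hess_mat :: "nat \<Rightarrow> (nat \<Rightarrow> nat \<Rightarrow> 'a::field) \<Rightarrow> 'a mat" where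
  "hess_mat h m = mat h h (\<lambda>(i, j). if i \<le> j then m i j else if i = Suc j then 1 else 0)"

lemma hess_mat_carrier [simp]: "hess_mat h m \<in> carrier_mat h h"
  by (simp add: hess_mat_def)

lemma coeff_hess_poly_Suc:
  "coeff (hess_poly m (Suc j)) k =
     (if k = 0 then 0 else coeff (hess_poly m j) (k - 1)) - (\<Sum>i\<le>j. m i j * coeff (hess_poly m i) k)"
  by (simp add: hess_poly.simps coeff_sum coeff_pCons split: nat.split)

lemma coeff_hess_poly_ge: "k \<ge> j \<Longrightarrow> coeff (hess_poly m j) k = (if k = j then 1 else 0)"
proof (induction j arbitrary: k rule: less_induct)
  case (less j)
  show ?case
  proof (cases j)
    case 0 then show ?thesis by simp
  next
    case (Suc i)
    have "(\<Sum>l\<le>i. m l i * coeff (hess_poly m l) k) = 0"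
      using less Suc by (intro sum.neutral) auto
    then show ?thesis using less Suc by (auto simp: coeff_hess_poly_Suc)
  qed
qed

lemma coeff_hess_poly_trace: "coeff (hess_poly m (Suc j)) j = - (\<Sum>i\<le>j. m i i)"
proof (induction j)
  case 0
  then show ?case by (simp add: coeff_hess_poly_Suc)
next
  case (Suc j)
  have "(\<Sum>i\<le>Suc j. m i (Suc j) * coeff (hess_poly m i) (Suc j)) =
        (\<Sum>i\<le>Suc j. if i = Suc j then m i i else 0)"
    by (intro sum.cong) (auto simp: coeff_hess_poly_ge)
  then show ?case using Suc by (subst coeff_hess_poly_Suc) simp
qed

lemma hess_poly_cong:
  assumes "\<And>i l. i \<le> l \<Longrightarrow> l < j \<Longrightarrow> m i l = m' i l"
  shows "hess_poly m j = hess_poly m' j"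
  using assms
proof (induction j rule: less_induct)
  case (less j)
  show ?case
  proof (cases j)
    case 0 then show ?thesis by simp
  next
    case (Suc i)
    then show ?thesis using less
      by (simp add: hess_poly.simps)
  qed
qed

text \<open>Altering the entry in position \<open>(r, s)\<close> first shows in the coefficient of degree
  \<open>h - 1 - (s - r)\<close>, so the coefficients can be corrected one superdiagonal at a time.\<close>

lemma coeff_hess_poly_upd:
  fixes m :: "nat \<Rightarrow> nat \<Rightarrow> 'a::field"
  assumes rs: "r < s" and m': "\<And>i j. m' i j = (if i = r \<and> j = s then m r s + x else m i j)"
    and sh: "s < h" and k: "h \<le> Suc (k + (s - r))"
  shows "coeff (hess_poly m' h) k =
    coeff (hess_poly m h) k - (if Suc (k + (s - r)) = h then x else 0)"
  using sh k
proof (induction h arbitrary: k rule: less_induct)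
  case (less h)
  then obtain j where h: "h = Suc j" by (cases h) auto
  \<comment> \<open>The polynomial of index \<open>i\<close> reads only columns before
    \<open>i\<close>, so column \<open>s\<close> is invisible up to index \<open>s\<close>.\<close>
  have low: "hess_poly m' i = hess_poly m i" if "i \<le> s" for i
    by (rule hess_poly_cong) (use that m' rs in auto)
  show ?case
  proof (cases "j = s")
    case True
    have "(\<Sum>i\<le>s. m' i s * coeff (hess_poly m' i) k)
      = (\<Sum>i\<le>s. m i s * coeff (hess_poly m i) k + (if i = r then x * coeff (hess_poly m i) k else 0))"
      by (intro sum.cong) (auto simp: low m' algebra_simps)
    also have "\<dots> = (\<Sum>i\<le>s. m i s * coeff (hess_poly m i) k) + x * coeff (hess_poly m r) k"
      using rs by (simp add: sum.distrib)
    also have "coeff (hess_poly m r) k = (if Suc (k + (s - r)) = h then 1 else 0)"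
      using less.prems rs h True by (subst coeff_hess_poly_ge) auto
    finally show ?thesis unfolding h True using low[of s]
      by (simp add: coeff_hess_poly_Suc h True)
  next
    case False
    then have sj: "s < j" using less.prems h by auto
    have *: "coeff (hess_poly m' i) k = coeff (hess_poly m i) k" if "i \<le> j" for i
    proof (cases "i \<le> s")
      case True then show ?thesis using low by simp
    next
      case False
      then show ?thesis using less.IH[of i k] that h less.prems by auto
    qed
    have "(\<Sum>i\<le>j. m' i j * coeff (hess_poly m' i) k) = (\<Sum>i\<le>j. m i j * coeff (hess_poly m i) k)"
      by (intro sum.cong) (use sj m' * in auto)
    moreover have "coeff (hess_poly m' j) (k - 1) =
       coeff (hess_poly m j) (k - 1) - (if Suc (k + (s - r)) = h then x else 0)" if "k > 0"
      using less.IH[of j "k - 1"] sj h less.prems that by auto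
    moreover have "Suc (k + (s - r)) \<noteq> h" if "k = 0" using that sj h rs by auto
    ultimately show ?thesis unfolding h by (auto simp: coeff_hess_poly_Suc)
  qed
qed

text \<open>The equations for the coefficients are triangular in the distance from the diagonal, so
  they can be solved one after the other once the permitted positions \<open>F\<close> meet every
  superdiagonal. The leading coefficient is 1 and the next one is minus the trace, which explains
  \<open>tr\<close>.\<close>

lemma hess_poly_prescribe:
  fixes m :: "nat \<Rightarrow> nat \<Rightarrow> 'a::field"
  assumes free: "\<And>g. 0 < g \<Longrightarrow> g < h \<Longrightarrow> \<exists>r. F r (r + g) \<and> r + g < h"
    and tr: "(\<Sum>i<h. m i i) = (\<Sum>i<h. t i i)"
  obtains m' where "hess_poly m' h = hess_poly t h"
    "\<And>i j. m' i j \<noteq> m i j \<Longrightarrow> F i j \<and> i < j"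
proof (cases h)
  case 0
  then show ?thesis using that[of m] by auto
next
  case (Suc h')
  have "\<exists>m'. (\<forall>k. h' - g \<le> k \<longrightarrow> coeff (hess_poly m' h) k = coeff (hess_poly t h) k) \<and>
    (\<forall>i j. m' i j \<noteq> m i j \<longrightarrow> F i j \<and> i < j)" if "g \<le> h'" for g
    using that
  proof (induction g)
    case 0
    have "coeff (hess_poly m h) k = coeff (hess_poly t h) k" if "h' \<le> k" for k
      using that tr \<open>h = Suc h'\<close> coeff_hess_poly_ge[of h k m] coeff_hess_poly_ge[of h k t]
        coeff_hess_poly_trace[of m h'] coeff_hess_poly_trace[of t h']
      by (cases "k = h'") (auto simp: lessThan_Suc_atMost)
    then show ?case by auto
  next
    case (Suc g)
    then obtain m' where m': "\<And>k. h' - g \<le> k \<Longrightarrow> coeff (hess_poly m' h) k = coeff (hess_poly t h) k"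
      and F: "\<And>i j. m' i j \<noteq> m i j \<Longrightarrow> F i j \<and> i < j" by auto
    obtain r where r: "F r (r + Suc g)" "r + Suc g < h" using free[of "Suc g"] Suc.prems \<open>h = Suc h'\<close> by auto
    define k0 where "k0 = h' - Suc g"
    define x where "x = coeff (hess_poly m' h) k0 - coeff (hess_poly t h) k0"
    define m2 where "m2 = (\<lambda>i j. if i = r \<and> j = r + Suc g then m' r (r + Suc g) + x else m' i j)"
    have upd: "coeff (hess_poly m2 h) k = coeff (hess_poly m' h) k - (if Suc (k + Suc g) = h then x else 0)"
      if "k \<ge> k0" for k
      using coeff_hess_poly_upd[of r "r + Suc g" m2 m' x h k] r that \<open>h = Suc h'\<close> Suc.prems
      by (auto simp: m2_def k0_def)
    have "coeff (hess_poly m2 h) k = coeff (hess_poly t h) k" if "k \<ge> k0" for k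
    proof (cases "k = k0")
      case True
      then show ?thesis using upd[of k0] Suc.prems \<open>h = Suc h'\<close> by (auto simp: x_def k0_def)
    next
      case False
      then have "k \<ge> h' - g" using that by (auto simp: k0_def)
      then show ?thesis using upd[of k] that m' False Suc.prems \<open>h = Suc h'\<close> by (auto simp: k0_def)
    qed
    moreover have "F i j \<and> i < j" if "m2 i j \<noteq> m i j" for i j
      using that r F[of i j] by (auto simp: m2_def split: if_splits)
    ultimately show ?case unfolding k0_def by blast
  qed
  from this[of h'] obtain m' where "\<And>k. coeff (hess_poly m' h) k = coeff (hess_poly t h) k"
    "\<And>i j. m' i j \<noteq> m i j \<Longrightarrow> F i j \<and> i < j" by auto
  then show ?thesis using that[of m'] by (auto simp: poly_eq_iff)
qed

section \<open>Hessenberg matrices with the same characteristic polynomial\<close>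

lemma inverse_matE:
  assumes "P \<in> carrier_mat n n" "det (P :: 'a::field mat) \<noteq> 0"
  obtains Q where "Q \<in> carrier_mat n n" "P * Q = 1\<^sub>m n" "Q * P = 1\<^sub>m n"
  using det_non_zero_imp_unit[OF assms, of "()"] unfolding Units_def ring_mat_def by auto

lemma similar_matI_intertwine:
  fixes A :: "'a::field mat"
  assumes "A \<in> carrier_mat n n" "B \<in> carrier_mat n n" "P \<in> carrier_mat n n" "det P \<noteq> 0"
    and "A * P = P * B"
  shows "similar_mat A B"
proof -
  obtain Q where Q: "Q \<in> carrier_mat n n" "P * Q = 1\<^sub>m n" "Q * P = 1\<^sub>m n"
    using inverse_matE[OF assms(3,4)] by blast
  have "A = A * (P * Q)" using assms Q by simp
  also have "\<dots> = P * B * Q" using assms(1,3) Q(1) by (simp add: assms(5) flip: assoc_mult_mat)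
  finally show ?thesis using assms Q by (intro similar_matI[of _ _ P Q n]) auto
qed

text \<open>Both matrices describe multiplication by the variable modulo
  \<open>hess_poly m h\<close>: the companion matrix \<open>C\<close> in the monomial basis,
  \<open>hess_mat h m\<close> in the basis of the polynomials \<open>hess_poly m j\<close> with
  \<open>j < h\<close>. The matrix \<open>P\<close> of their coefficients is the unitriangular
  change of basis.\<close>

lemma hess_mat_similar:
  fixes m :: "nat \<Rightarrow> nat \<Rightarrow> 'a::field"
  assumes "hess_poly m h = hess_poly t h"
  shows "similar_mat (hess_mat h m) (hess_mat h t)"
proof -
  define C where "C = (\<lambda>p :: 'a poly. mat h h (\<lambda>(i, j).
    (if i = Suc j then 1 else 0) - (if Suc j = h then coeff p i else 0)))"
  have "similar_mat (C (hess_poly m h)) (hess_mat h m)" for m :: "nat \<Rightarrow> nat \<Rightarrow> 'a"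
  proof -
    define P where "P = mat h h (\<lambda>(i, j). coeff (hess_poly m j) i)"
    have "det P = prod_list (diag_mat P)"
      by (rule det_upper_triangular[of _ h]) (auto simp: P_def coeff_hess_poly_ge)
    also have "diag_mat P = map (\<lambda>i. 1) [0..<h]"
      unfolding diag_mat_def by (intro map_cong) (auto simp: P_def coeff_hess_poly_ge)
    also have "prod_list \<dots> = (1::'a)" by (induction h) auto
    finally have "det P \<noteq> 0" by simp
    moreover have "C (hess_poly m h) * P = P * hess_mat h m"
    proof (rule eq_matI)
      fix i j assume "i < dim_row (P * hess_mat h m)" "j < dim_col (P * hess_mat h m)"
      then have ij: "i < h" "j < h" by (auto simp: P_def hess_mat_def)
      have "(C (hess_poly m h) * P) $$ (i, j) =
        (\<Sum>k<h. ((if i = Suc k then 1 else 0) - (if Suc k = h then coeff (hess_poly m h) i else 0))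
          * coeff (hess_poly m j) k)"
        using ij by (auto simp: C_def P_def scalar_prod_def intro!: sum.cong)
      also have "\<dots> = (\<Sum>k<h. if k = i - 1 then (if i = 0 then 0 else coeff (hess_poly m j) k) else 0)
         - (\<Sum>k<h. if k = h - 1 then coeff (hess_poly m h) i * coeff (hess_poly m j) k else 0)"
        unfolding sum_subtractf[symmetric] using ij by (intro sum.cong) auto
      also have "\<dots> = (if i = 0 then 0 else coeff (hess_poly m j) (i - 1))
         - coeff (hess_poly m h) i * coeff (hess_poly m j) (h - 1)"
        using ij by auto
      also have "\<dots> = (\<Sum>k\<le>j. m k j * coeff (hess_poly m k) i)
         + (if Suc j < h then coeff (hess_poly m (Suc j)) i else 0)"
      proof (cases "Suc j = h")
        case True
        then have "coeff (hess_poly m j) (h - 1) = 1" by (auto simp: coeff_hess_poly_ge)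
        moreover have "coeff (hess_poly m h) i = (if i = 0 then 0 else coeff (hess_poly m j) (i - 1))
          - (\<Sum>k\<le>j. m k j * coeff (hess_poly m k) i)"
          by (simp only: True[symmetric] coeff_hess_poly_Suc)
        ultimately show ?thesis using True by simp
      next
        case False
        then have "coeff (hess_poly m j) (h - 1) = 0" using ij by (auto simp: coeff_hess_poly_ge)
        then show ?thesis using ij False by (simp add: coeff_hess_poly_Suc)
      qed
      also have "\<dots> = (\<Sum>k<h. (if k \<le> j then m k j * coeff (hess_poly m k) i else 0)
         + (if k = Suc j then coeff (hess_poly m k) i else 0))"
      proof -
        have "(\<Sum>k<h. if k \<le> j then m k j * coeff (hess_poly m k) i else 0)
          = (\<Sum>k\<le>j. m k j * coeff (hess_poly m k) i)"
          by (rule sum.mono_neutral_cong_right) (use ij in auto)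
        then show ?thesis using ij by (simp add: sum.distrib)
      qed
      also have "\<dots> = (P * hess_mat h m) $$ (i, j)"
        using ij by (auto simp: hess_mat_def P_def scalar_prod_def intro!: sum.cong)
      finally show "(C (hess_poly m h) * P) $$ (i, j) = (P * hess_mat h m) $$ (i, j)" .
    qed (auto simp: C_def P_def hess_mat_def)
    ultimately show ?thesis
      by (intro similar_matI_intertwine[of _ h _ P]) (auto simp: C_def P_def)
  qed
  then show ?thesis using assms by (metis similar_mat_sym similar_mat_trans)
qed

section \<open>Splitting off one idempotent from a Hessenberg matrix\<close>

definition good_hess :: "nat \<Rightarrow> 'a::field mat \<Rightarrow> bool" where
  "good_hess h H \<longleftrightarrow> H \<in> carrier_mat h h
    \<and> (\<forall>i j. i < h \<longrightarrow> Suc j < i \<longrightarrow> H $$ (i, j) = 0)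
    \<and> (\<forall>i. Suc i < h \<longrightarrow> H $$ (Suc i, i) \<in> {0, 1})
    \<and> (\<forall>i. Suc i < h \<longrightarrow> H $$ (Suc i, i) = 0 \<longrightarrow> Suc (Suc i) < h \<and> H $$ (Suc (Suc i), Suc i) = 1)
    \<and> (0 < h \<longrightarrow> 1 < h \<and> H $$ (1, 0) = 1)"

text \<open>\<open>x\<close> and \<open>y\<close> count the diagonal entries \<open>a\<close> and
  \<open>b\<close>, read in the field. Being consecutive they do not both vanish; but if one does
  and \<open>\<tau> = 0\<close>, the first equation forces a zero coefficient, and a diagonal with
  equally many \<open>a\<close> and \<open>b\<close> is needed instead.\<close>

lemma trace_equation:
  fixes x y \<tau> :: "'a::field"
  assumes "y = x + 1 \<or> y = x - 1"
  shows "\<exists>a b. a \<noteq> 0 \<and> b \<noteq> 0 \<and> (x * a + y * b = \<tau> \<or> x * (a + b) = \<tau>)"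
proof -
  consider "x = 0" "\<tau> = 0" | "x = 0" "\<tau> \<noteq> 0" | "y = 0" "\<tau> = 0" | "x \<noteq> 0" "y = 0" "\<tau> \<noteq> 0" | "x \<noteq> 0" "y \<noteq> 0"
    by blast
  then show ?thesis
  proof cases
    case 1 then show ?thesis by (intro exI[of _ 1]) auto
  next
    case 2 then show ?thesis using assms by (intro exI[of _ 1] exI[of _ "\<tau> / y"]) auto
  next
    case 3 then show ?thesis by (intro exI[of _ 1] exI[of _ "-1"]) auto
  next
    case 4 then show ?thesis by (intro exI[of _ "\<tau> / x"] exI[of _ 1]) auto
  next
    case 5
    \<comment> \<open>\<open>e\<close> has to be a nonzero element other than 1. For
      \<open>x = 1\<close> the condition \<open>y \<noteq> 0\<close> leaves only
      \<open>y = 2\<close>, so the characteristic is not 2 and \<open>-1\<close> is different from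
      1.\<close>
    define e where "e = (if x = 1 then -1 else x)"
    have e: "e \<noteq> 0" "e \<noteq> 1" using 5 assms by (auto simp: e_def)
    define a where "a = (if \<tau> = x then e else 1)"
    have "a \<noteq> 0" "\<tau> - x * a \<noteq> 0" using e 5 by (auto simp: a_def)
    then show ?thesis using 5 by (intro exI[of _ a] exI[of _ "(\<tau> - x * a) / y"]) auto
  qed
qed

lemma sum_alternating:
  fixes a b :: "'a::field"
  shows "(\<Sum>i<h. if even i then a else b) = of_nat ((h + 1) div 2) * a + of_nat (h div 2) * b"
proof (induction h)
  case (Suc h)
  then show ?case by (cases "even h") (auto elim!: evenE oddE simp: algebra_simps)
qed auto

text \<open>Neighbouring diagonal entries belong to different idempotents, so the ones below the
  diagonal are unrestricted. \<open>d\<close> fills the whole diagonal and \<open>d0\<close> puts a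
  zero first; for either parity of \<open>h\<close>, one of them has equally many \<open>a\<close>
  and \<open>b\<close> and in the other the two numbers differ by one, as
  \<open>trace_equation\<close> demands.\<close>

lemma alternating_target:
  fixes \<tau> :: "'a::field"
  assumes "h \<ge> 2"
  shows "\<exists>a b t. a \<noteq> 0 \<and> b \<noteq> 0 \<and> (\<Sum>i<h. t i i) = \<tau> \<and> idem_comb h [a, b] (hess_mat h t)"
proof -
  define d where "d = (\<lambda>a b i j :: nat. if i = j then (if even i then a else b) else (0::'a))"
  define d0 where "d0 = (\<lambda>a b i j :: nat. if i = j \<and> i > 0 then (if even i then a else b) else (0::'a))"
  have d: "idem_comb h [a, b] (hess_mat h (d a b))" if "a \<noteq> 0" "b \<noteq> 0" for a b
    by (rule idem_comb_2_rowsI[of _ _ _ _ even odd]) (use that in \<open>auto simp: hess_mat_def d_def\<close>)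
  have d0: "idem_comb h [a, b] (hess_mat h (d0 a b))" if "a \<noteq> 0" "b \<noteq> 0" for a b
    by (rule idem_comb_2_rowsI[of _ _ _ _ "\<lambda>i. even i \<and> i > 0" odd])
      (use that in \<open>auto simp: hess_mat_def d0_def elim: oddE\<close>)
  have td: "(\<Sum>i<h. d a b i i) = of_nat ((h + 1) div 2) * a + of_nat (h div 2) * b" for a b
    unfolding sum_alternating[symmetric] by (simp add: d_def)
  have td0: "(\<Sum>i<h. d0 a b i i) = (\<Sum>i<h. d a b i i) - a" for a b
  proof -
    have "(\<Sum>i<h. d0 a b i i) = (\<Sum>i<h. d a b i i - (if i = 0 then a else 0))"
      by (intro sum.cong) (auto simp: d_def d0_def)
    then show ?thesis using assms by (simp add: sum_subtractf)
  qed
  define x where "x = (of_nat (h div 2) :: 'a)"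
  show ?thesis
  proof (cases "even h")
    case True
    then have s: "(\<Sum>i<h. d a b i i) = x * (a + b)" for a b
      by (auto simp: td x_def algebra_simps elim!: evenE)
    obtain a b where ab: "a \<noteq> 0" "b \<noteq> 0" "x * a + (x - 1) * b = \<tau> \<or> x * (a + b) = \<tau>"
      using trace_equation[of "x - 1" x \<tau>] by auto
    from ab(3) show ?thesis
    proof
      assume "x * a + (x - 1) * b = \<tau>"
      then have "(\<Sum>i<h. d0 b a i i) = \<tau>" by (simp add: td0 s algebra_simps)
      then show ?thesis using d0 ab by blast
    next
      assume "x * (a + b) = \<tau>"
      then have "(\<Sum>i<h. d a b i i) = \<tau>" by (simp add: s)
      then show ?thesis using d ab by blast
    qed
  next
    case False
    then have s: "(\<Sum>i<h. d a b i i) = (x + 1) * a + x * b" for a b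
      by (auto simp: td x_def algebra_simps elim!: oddE)
    obtain a b where ab: "a \<noteq> 0" "b \<noteq> 0" "x * a + (x + 1) * b = \<tau> \<or> x * (a + b) = \<tau>"
      using trace_equation[of "x + 1" x \<tau>] by auto
    from ab(3) show ?thesis
    proof
      assume "x * a + (x + 1) * b = \<tau>"
      then have "(\<Sum>i<h. d b a i i) = \<tau>" by (simp add: s algebra_simps)
      then show ?thesis using d ab by blast
    next
      assume "x * (a + b) = \<tau>"
      then have "(\<Sum>i<h. d0 a b i i) = \<tau>" by (simp add: td0 s algebra_simps)
      then show ?thesis using d0 ab by blast
    qed
  qed
qed

text \<open>The idempotent \<open>R\<close> is the identity on the rows in \<open>U\<close>, zero on the other rows, and arbitrary
  in the columns outside \<open>U\<close>. The choice of \<open>U\<close> lets \<open>R\<close> fill every zero of the subdiagonal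
  and leaves a free entry on each superdiagonal.\<close>

lemma good_hess_idem_comb:
  assumes H: "good_hess h H" and h: "h \<ge> 3" and H2: "H $$ (2, 1) = 1" and c: "c \<noteq> 0"
  shows "\<exists>a b. a \<noteq> 0 \<and> b \<noteq> 0 \<and> idem_comb h [c, a, b] H"
proof -
  have Hc: "H \<in> carrier_mat h h"
    and low: "\<And>i j. i < h \<Longrightarrow> Suc j < i \<Longrightarrow> H $$ (i, j) = 0"
    and sub: "\<And>i. Suc i < h \<Longrightarrow> H $$ (Suc i, i) \<noteq> 0 \<Longrightarrow> H $$ (Suc i, i) = 1"
    and adj: "\<And>i. Suc i < h \<Longrightarrow> H $$ (Suc i, i) = 0 \<Longrightarrow> Suc (Suc i) < h \<and> H $$ (Suc (Suc i), Suc i) = 1"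
    and H1: "H $$ (Suc 0, 0) = 1"
    using H h unfolding good_hess_def by auto
  define U where "U = (\<lambda>i. i < 2 \<or> H $$ (i, i - 1) = 0)"
  \<comment> \<open>The forced part of \<open>c R\<close> on and above the diagonal consists of the
    entries \<open>c\<close> in the diagonal positions from \<open>U\<close>. After its removal only
    positions leading from \<open>U\<close> to its complement remain adjustable.\<close>
  define m where "m = (\<lambda>i j. H $$ (i, j) - (if i = j \<and> U i then c else 0))"
  have U01: "U 0" "U 1" by (auto simp: U_def)
  have U2: "\<not> U 2" using H2 by (auto simp: U_def)
  have USuc: "Suc g < h \<and> \<not> U (Suc g)" if "U g" "2 \<le> g" "g < h" for g
    using that adj[of "g - 1"] by (auto simp: U_def)
  \<comment> \<open>For \<open>g = 1\<close> the position \<open>(1, 2)\<close> serves, which is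
    where \<open>H $$ (2, 1) = 1\<close> enters. For larger \<open>g\<close> take
    \<open>(0, g)\<close>, or \<open>(1, g + 1)\<close> if \<open>g\<close> lies in
    \<open>U\<close>, because then \<open>g + 1\<close> exists and does not.\<close>
  have free: "\<exists>r. (U r \<and> \<not> U (r + g)) \<and> r + g < h" if "0 < g" "g < h" for g
  proof (cases "g = 1")
    case True
    then show ?thesis using U01 U2 h by (intro exI[of _ 1]) (auto simp: numeral_2_eq_2)
  next
    case False
    then show ?thesis using that USuc[of g] U01
      by (cases "U g") (auto intro: exI[of _ 0] exI[of _ 1])
  qed
  obtain a b t where ab: "a \<noteq> 0" "b \<noteq> 0" and t: "(\<Sum>i<h. t i i) = (\<Sum>i<h. m i i)"
    and tc: "idem_comb h [a, b] (hess_mat h t)"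
    using alternating_target[of h "\<Sum>i<h. m i i"] h by auto
  obtain m' where m': "hess_poly m' h = hess_poly t h"
    and F: "\<And>i j. m' i j \<noteq> m i j \<Longrightarrow> (U i \<and> \<not> U j) \<and> i < j"
    using hess_poly_prescribe[of h "\<lambda>i j. U i \<and> \<not> U j" m t] free t by metis
  have Feq: "m' i j = m i j" if "\<not> (U i \<and> \<not> U j \<and> i < j)" for i j
    using F[of i j] that by blast
  define M where "M = hess_mat h m'"
  have Mc: "M \<in> carrier_mat h h" by (simp add: M_def)
  have Mi: "M $$ (i, j) = (if i \<le> j then m' i j else if i = Suc j then 1 else 0)" if "i < h" "j < h" for i j
    using that by (simp add: M_def hess_mat_def)
  have M: "idem_comb h [a, b] M"
    unfolding M_def using idem_comb_similar[OF hess_mat_similar[OF m'] tc] .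
  define R where "R = (1 / c) \<cdot>\<^sub>m (H - M)"
  have "idempotent_mat h R"
  proof (rule idempotent_rowsI[of _ _ U])
    show "R \<in> carrier_mat h h" using Hc Mc by (auto simp: R_def)
  next
    fix i j assume ij: "i < h" "j < h" "\<not> U i"
    then have "H $$ (Suc j, j) = 1" if "i = Suc j" using that sub[of j] by (auto simp: U_def)
    then have "H $$ (i, j) = M $$ (i, j)"
      using Feq[of i j] ij low[of i j] unfolding Mi[OF ij(1,2)] by (auto simp: m_def)
    then show "R $$ (i, j) = 0" using ij Hc Mc by (simp add: R_def)
  next
    fix i j assume ij: "i < h" "j < h" "U i" "U j"
    \<comment> \<open>Rows 0 and 1 are the only neighbours that both belong to \<open>U\<close>, and
      the entry between them is already 1.\<close>
    have "H $$ (Suc j, j) = 1" if "i = Suc j"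
    proof (rule ccontr)
      assume *: "H $$ (Suc j, j) \<noteq> 1"
      then have 0: "H $$ (Suc j, j) = 0" using sub[of j] ij that by auto
      have "j \<noteq> 0"
      proof
        assume "j = 0" then show False using 0 H1 by simp
      qed
      moreover have "j \<noteq> 1"
      proof
        assume "j = 1" then show False using 0 H2 by (simp add: numeral_2_eq_2)
      qed
      ultimately have "j \<noteq> 0" "j \<noteq> 1" by auto
      then show False using USuc[of j] ij that by auto
    qed
    then have "H $$ (i, j) - M $$ (i, j) = (if i = j then c else 0)"
      using Feq[of i j] ij low[of i j] unfolding Mi[OF ij(1,2)] by (auto simp: m_def)
    then show "R $$ (i, j) = (if i = j then 1 else 0)" using ij Hc Mc c by (simp add: R_def)
  qed
  moreover have "H = M + c \<cdot>\<^sub>m R"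
    using Hc Mc c by (intro eq_matI) (auto simp: R_def)
  ultimately have "idem_comb h [c, a, b] H" using M unfolding idem_comb.simps(2)[of h c] by blast
  then show ?thesis using ab by blast
qed

section \<open>Cyclic subspaces\<close>

lemma sum_delta_mult:
  fixes f :: "nat \<Rightarrow> 'a::field"
  shows "(\<Sum>j = 0..<k. (if i = j then 1 else 0) * f j) = (if i < k then f i else 0)"
proof -
  have "(\<Sum>j = 0..<k. (if i = j then 1 else 0) * f j) = (\<Sum>j = 0..<k. if j = i then f i else 0)"
    by (intro sum.cong) auto
  then show ?thesis by simp
qed

section \<open>Injective matrices and basis extension\<close>

definition trivial_kernel :: "'a::field mat \<Rightarrow> bool" where
  "trivial_kernel X \<longleftrightarrow> (\<forall>c\<in>carrier_vec (dim_col X). X *\<^sub>v c = 0\<^sub>v (dim_row X) \<longrightarrow> c = 0\<^sub>v (dim_col X))"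

lemma det_nonzero_iff_trivial_kernel:
  assumes "A \<in> carrier_mat n n"
  shows "det A \<noteq> 0 \<longleftrightarrow> trivial_kernel A"
  using assms unfolding det_0_iff_vec_prod_zero_field[OF assms] trivial_kernel_def by auto

definition col_id :: "nat \<Rightarrow> nat \<Rightarrow> 'a::field mat" where
  "col_id n k = mat n k (\<lambda>(i, j). if i = j then 1 else 0)"

lemma col_id_carrier [simp]: "col_id n k \<in> carrier_mat n k"
  by (simp add: col_id_def)

lemma mult_col_id:
  assumes "A \<in> carrier_mat m n" "k \<le> n" "i < m" "j < k"
  shows "(A * col_id n k) $$ (i, j) = A $$ (i, j)"
proof -
  have "(A * col_id n k) $$ (i, j) = (\<Sum>l<n. A $$ (i, l) * (if l = j then 1 else 0))"
    using assms by (auto simp: col_id_def scalar_prod_def atLeast0LessThan)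
  also have "\<dots> = (\<Sum>l<n. if l = j then A $$ (i, l) else 0)"
    by (intro sum.cong) auto
  finally have "(A * col_id n k) $$ (i, j) = \<dots>" .
  then show ?thesis using assms by simp
qed

text \<open>Basis extension in matrix form: the inverse of \<open>P\<close> is an invertible matrix
  whose first \<open>k\<close> columns are those of \<open>X\<close>. The proof is Gaussian
  elimination, one column at a time.\<close>

lemma trivial_kernel_reduce:
  fixes X :: "'a::field mat"
  assumes "X \<in> carrier_mat n k" "trivial_kernel X"
  shows "\<exists>P. P \<in> carrier_mat n n \<and> det P \<noteq> 0 \<and> k \<le> n \<and> P * X = col_id n k"
  using assms
proof (induction k arbitrary: X)
  case 0
  then show ?case
    by (intro exI[of _ "1\<^sub>m n"]) (auto simp: col_id_def intro!: eq_matI)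
next
  case (Suc k)
  define X' where "X' = mat n k (\<lambda>(i, j). X $$ (i, j))"
  have X: "X \<in> carrier_mat n (Suc k)" by fact
  have ext: "(X *\<^sub>v vec (Suc k) (\<lambda>j. if j < k then c $ j else z)) =
     (X' *\<^sub>v c) + z \<cdot>\<^sub>v col X k" if "c \<in> carrier_vec k" for c z
    using that X by (intro eq_vecI) (auto simp: X'_def scalar_prod_def algebra_simps intro!: sum.cong)
  have "trivial_kernel X'"
    unfolding trivial_kernel_def
  proof (intro ballI impI)
    fix c assume c: "c \<in> carrier_vec (dim_col X')" "X' *\<^sub>v c = 0\<^sub>v (dim_row X')"
    let ?c = "vec (Suc k) (\<lambda>j. if j < k then c $ j else 0)"
    have "X *\<^sub>v ?c = 0\<^sub>v n" using ext[of c 0] c X by (auto simp: X'_def)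
    then have "?c = 0\<^sub>v (Suc k)" using Suc.prems unfolding trivial_kernel_def by auto
    then have "?c $ j = 0" if "j < k" for j using that by simp
    then show "c = 0\<^sub>v (dim_col X')" using c by (intro eq_vecI) (auto simp: X'_def)
  qed
  then obtain P where P: "P \<in> carrier_mat n n" "det P \<noteq> 0" "k \<le> n" "P * X' = col_id n k"
    using Suc.IH[of X'] by (auto simp: X'_def)
  obtain Q where Q: "Q \<in> carrier_mat n n" "P * Q = 1\<^sub>m n" "Q * P = 1\<^sub>m n"
    using inverse_matE[OF P(1,2)] by blast
  define y where "y = P *\<^sub>v col X k"
  have y: "y \<in> carrier_vec n" using P X by (auto simp: y_def)
  have PX: "P * X = mat n (Suc k) (\<lambda>(i, j). if j = k then y $ i else if i = j then 1 else 0)"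
  proof (rule eq_matI)
    fix i j assume "i < dim_row (mat n (Suc k) (\<lambda>(i, j). if j = k then y $ i else if i = j then 1 else 0))"
      "j < dim_col (mat n (Suc k) (\<lambda>(i, j). if j = k then y $ i else if i = j then 1 else 0))"
    then have ij: "i < n" "j < Suc k" by auto
    have "(P * X) $$ (i, j) = (P * X') $$ (i, j)" if "j < k"
    proof -
      have "col X' j = col X j" using that X by (intro eq_vecI) (auto simp: X'_def)
      moreover have "X' \<in> carrier_mat n k" by (simp add: X'_def)
      ultimately show ?thesis using ij that P(1) X by simp
    qed
    then show "(P * X) $$ (i, j) = mat n (Suc k) (\<lambda>(i, j). if j = k then y $ i else if i = j then 1 else 0) $$ (i, j)"
      using ij P X by (auto simp: y_def col_id_def)
  qed (use P X in auto)
  \<comment> \<open>If \<open>y\<close> vanished from row \<open>k\<close> on, the last column of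
    \<open>X\<close> would be a combination of the preceding ones.\<close>
  have "\<exists>r. k \<le> r \<and> r < n \<and> y $ r \<noteq> 0"
  proof (rule ccontr)
    assume *: "\<not> ?thesis"
    let ?c = "vec (Suc k) (\<lambda>j. if j < k then - y $ j else 1)"
    have "(P * X) *\<^sub>v ?c = 0\<^sub>v n"
    proof (rule eq_vecI)
      fix i assume i: "i < dim_vec (0\<^sub>v n)"
      have "((P * X) *\<^sub>v ?c) $ i = y $ i - (\<Sum>j = 0..<k. (if i = j then 1 else 0) * y $ j)"
        using i unfolding PX by (auto simp: scalar_prod_def simp flip: sum_negf intro!: sum.cong)
      also have "\<dots> = 0" using i * by (simp only: sum_delta_mult) auto
      finally show "((P * X) *\<^sub>v ?c) $ i = 0\<^sub>v n $ i" using i by simp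
    qed (use P in auto)
    then have "Q *\<^sub>v ((P * X) *\<^sub>v ?c) = 0\<^sub>v n" using Q by auto
    also have "Q *\<^sub>v ((P * X) *\<^sub>v ?c) = (Q * P) * X *\<^sub>v ?c"
      using P(1) Q(1) X by (simp add: assoc_mult_mat_vec[of _ n n _ "Suc k"] assoc_mult_mat[of _ n n _ n _ "Suc k"])
    finally have "X *\<^sub>v ?c = 0\<^sub>v n" using Q X by simp
    then have "?c = 0\<^sub>v (Suc k)" using Suc.prems(2) X unfolding trivial_kernel_def by auto
    then have "?c $ k = 0" by simp
    then show False by simp
  qed
  then obtain r where r: "k \<le> r" "r < n" "y $ r \<noteq> 0" by blast
  \<comment> \<open>The identity with column \<open>k\<close> replaced by \<open>y\<close> and, if
    \<open>r\<close> differs from \<open>k\<close>, column \<open>r\<close> replaced by the unit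
    vector displaced from column \<open>k\<close>. The pivot \<open>y $ r\<close> makes it
    invertible.\<close>
  define N where "N = mat n n (\<lambda>(i, j). if j = k then y $ i else
    if j = r then (if i = k then 1 else 0) else if i = j then 1 else 0)"
  have N: "N \<in> carrier_mat n n" by (simp add: N_def)
  have "trivial_kernel N"
    unfolding trivial_kernel_def
  proof (intro ballI impI)
    fix c assume c: "c \<in> carrier_vec (dim_col N)" and Nc: "N *\<^sub>v c = 0\<^sub>v (dim_row N)"
    have sum0: "(if i = k \<and> r \<noteq> k then c $ r else 0) + (if i \<noteq> k \<and> i \<noteq> r then c $ i else 0) + y $ i * c $ k = 0"
      if i: "i < n" for i
    proof -
      have "(N *\<^sub>v c) $ i = (\<Sum>j<n. N $$ (i, j) * c $ j)"
        using i c N by (simp add: scalar_prod_def atLeast0LessThan)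
      also have "\<dots> = (\<Sum>j<n. (if j = r then (if i = k \<and> r \<noteq> k then c $ r else 0) else 0)
        + (if j = i then (if i \<noteq> k \<and> i \<noteq> r then c $ i else 0) else 0)
        + (if j = k then y $ i * c $ k else 0))"
        using i by (intro sum.cong) (auto simp: N_def)
      also have "\<dots> = (if i = k \<and> r \<noteq> k then c $ r else 0) + (if i \<noteq> k \<and> i \<noteq> r then c $ i else 0) + y $ i * c $ k"
        using i r by (simp only: sum.distrib) simp
      finally have *: "(N *\<^sub>v c) $ i = (if i = k \<and> r \<noteq> k then c $ r else 0)
        + (if i \<noteq> k \<and> i \<noteq> r then c $ i else 0) + y $ i * c $ k" .
      have "(N *\<^sub>v c) $ i = 0" unfolding Nc using i N by simp
      then show ?thesis unfolding * .
    qed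
    have ck: "c $ k = 0" using sum0[of r] r by (auto split: if_splits)
    show "c = 0\<^sub>v (dim_col N)"
    proof (rule eq_vecI)
      fix i assume i: "i < dim_vec (0\<^sub>v (dim_col N))"
      then have "i < n" by (simp add: N_def)
      then show "c $ i = 0\<^sub>v (dim_col N) $ i"
        using sum0[of i] sum0[of k] ck r i by (cases "i = k"; cases "i = r") (auto split: if_splits)
    qed (use c in auto)
  qed
  then have "det N \<noteq> 0" using det_nonzero_iff_trivial_kernel[OF N] by simp
  then obtain N' where N': "N' \<in> carrier_mat n n" "N * N' = 1\<^sub>m n" "N' * N = 1\<^sub>m n"
    using inverse_matE[OF N] by blast
  have dN': "det N' \<noteq> 0" using det_mult[OF N N'(1)] N'(2) by auto
  have kn: "Suc k \<le> n" using r by simp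
  have "N * col_id n (Suc k) = P * X"
  proof (rule eq_matI)
    fix i j assume "i < dim_row (P * X)" "j < dim_col (P * X)"
    then have ij: "i < n" "j < Suc k" using P X by auto
    then show "(N * col_id n (Suc k)) $$ (i, j) = (P * X) $$ (i, j)"
      unfolding PX using mult_col_id[OF N kn ij] r kn by (auto simp: N_def)
  qed (use N P X in \<open>auto simp: col_id_def\<close>)
  then have "N' * (P * X) = (N' * N) * col_id n (Suc k)"
    using assoc_mult_mat[OF N'(1) N col_id_carrier, of "Suc k"] by simp
  then have "N' * P * X = col_id n (Suc k)"
    using N' P X by (simp add: assoc_mult_mat[of _ n n _ n _ "Suc k"] col_id_def)
  then show ?case using N' P dN' kn det_mult[OF N'(1) P(1)] by (intro exI[of _ "N' * P"]) auto
qed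

text \<open>\<open>AX\<close> says that the columns of \<open>X\<close> span an invariant space on
  which \<open>A\<close> acts by \<open>C\<close>; \<open>YA\<close> makes the kernel of
  \<open>Y\<close> invariant, and \<open>YX\<close> makes it a complement. \<open>D\<close> is the
  action on that kernel.\<close>

lemma split_block:
  fixes A :: "'a::field mat"
  assumes A: "A \<in> carrier_mat n n" and X: "X \<in> carrier_mat n d" and Y: "Y \<in> carrier_mat d n"
    and C: "C \<in> carrier_mat d d" and AX: "A * X = X * C" and YA: "Y * A = C * Y" and YX: "Y * X = 1\<^sub>m d"
  shows "d \<le> n \<and> (\<exists>D. D \<in> carrier_mat (n - d) (n - d) \<and>
    similar_mat A (four_block_mat C (0\<^sub>m d (n - d)) (0\<^sub>m (n - d) d) D))"
proof -
  have YXc: "Y *\<^sub>v (X *\<^sub>v c) = c" if "c \<in> carrier_vec d" for c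
  proof -
    have "Y *\<^sub>v (X *\<^sub>v c) = (Y * X) *\<^sub>v c" using X Y that by simp
    then show ?thesis using YX that by simp
  qed
  have "trivial_kernel X"
    unfolding trivial_kernel_def
  proof (intro ballI impI)
    fix c assume c: "c \<in> carrier_vec (dim_col X)" "X *\<^sub>v c = 0\<^sub>v (dim_row X)"
    then show "c = 0\<^sub>v (dim_col X)" using YXc[of c] X Y by auto
  qed
  then obtain P where P: "P \<in> carrier_mat n n" "det P \<noteq> 0" "d \<le> n" "P * X = col_id n d"
    using trivial_kernel_reduce[OF X] by blast
  obtain P' where P': "P' \<in> carrier_mat n n" "P * P' = 1\<^sub>m n" "P' * P = 1\<^sub>m n"
    using inverse_matE[OF P(1,2)] by blast
  \<comment> \<open>The rows of \<open>P\<close> from \<open>d\<close> on vanish on the columns of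
    \<open>X\<close>. Stacked below \<open>Y\<close> they give coordinates adapted to the image of
    \<open>X\<close> and the kernel of \<open>Y\<close>.\<close>
  define Q where "Q = mat n n (\<lambda>(i, j). if i < d then Y $$ (i, j) else P $$ (i, j))"
  have Q: "Q \<in> carrier_mat n n" by (simp add: Q_def)
  have rowQ: "row Q i = (if i < d then row Y i else row P i)" if "i < n" for i
    using that Y P by (auto simp: Q_def intro!: eq_vecI)
  have QX: "Q * X = col_id n d"
  proof (rule eq_matI)
    fix i j assume "i < dim_row (col_id n d :: 'a mat)" "j < dim_col (col_id n d :: 'a mat)"
    then have ij: "i < n" "j < d" by (auto simp: col_id_def)
    have "(Q * X) $$ (i, j) = (if i < d then (Y * X) $$ (i, j) else (P * X) $$ (i, j))"
      using ij Q X Y P(1) rowQ by auto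
    then show "(Q * X) $$ (i, j) = col_id n d $$ (i, j)"
      using ij by (simp add: YX P(4) col_id_def)
  qed (use Q X in \<open>auto simp: col_id_def\<close>)
  have "trivial_kernel Q"
    unfolding trivial_kernel_def
  proof (intro ballI impI)
    fix v assume v: "v \<in> carrier_vec (dim_col Q)" and Qv: "Q *\<^sub>v v = 0\<^sub>v (dim_row Q)"
    have v: "v \<in> carrier_vec n" using v Q by auto
    have Qv: "row Q i \<bullet> v = 0" if "i < n" for i
      using Qv that Q by (metis index_mult_mat_vec carrier_matD(1) index_zero_vec(1))
    define w where "w = vec d (\<lambda>i. (P *\<^sub>v v) $ i)"
    have w: "w \<in> carrier_vec d" by (simp add: w_def)
    have "P *\<^sub>v v = col_id n d *\<^sub>v w"
    proof (rule eq_vecI)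
      fix i assume "i < dim_vec (col_id n d *\<^sub>v w)"
      then have i: "i < n" by (simp add: col_id_def)
      have "(col_id n d *\<^sub>v w) $ i = (if i < d then w $ i else 0)"
        using i w by (auto simp: col_id_def scalar_prod_def sum_delta_mult)
      then show "(P *\<^sub>v v) $ i = (col_id n d *\<^sub>v w) $ i"
        using i Qv[of i] rowQ[of i] P by (auto simp: w_def split: if_splits)
    qed (use P in \<open>simp add: col_id_def\<close>)
    also have "\<dots> = P *\<^sub>v (X *\<^sub>v w)" using P X w by (simp flip: P(4))
    finally have "P' *\<^sub>v (P *\<^sub>v v) = P' *\<^sub>v (P *\<^sub>v (X *\<^sub>v w))" by simp
    moreover have "P' *\<^sub>v (P *\<^sub>v x) = x" if "x \<in> carrier_vec n" for x
      using assoc_mult_mat_vec[OF P'(1) P(1) that] P'(3) that by simp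
    ultimately have vX: "v = X *\<^sub>v w" using v X w by simp
    have "Y *\<^sub>v v = 0\<^sub>v d"
    proof (rule eq_vecI)
      fix i assume "i < dim_vec (0\<^sub>v d)"
      then show "(Y *\<^sub>v v) $ i = 0\<^sub>v d $ i" using Qv[of i] rowQ[of i] Y P(3) by simp
    qed (use Y in simp)
    then have "w = 0\<^sub>v d" using YXc[OF w] vX by simp
    then show "v = 0\<^sub>v (dim_col Q)" using vX X Q by auto
  qed
  then have dQ: "det Q \<noteq> 0" using det_nonzero_iff_trivial_kernel[OF Q] by simp
  then obtain Q' where Q': "Q' \<in> carrier_mat n n" "Q * Q' = 1\<^sub>m n" "Q' * Q = 1\<^sub>m n"
    using inverse_matE[OF Q] by blast
  define B where "B = Q * A * Q'"
  have B: "B \<in> carrier_mat n n" using Q Q' A by (simp add: B_def)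
  have BQ: "B * Q = Q * A"
    unfolding B_def using Q Q' A by (simp add: assoc_mult_mat[of _ n n _ n _ n])
  have simAB: "similar_mat A B"
  proof -
    have "Q' * B * Q = (Q' * Q) * A * (Q' * Q)"
      unfolding B_def using Q Q'(1) A by (simp add: assoc_mult_mat[of _ n n _ n _ n])
    then have "A = Q' * B * Q" using Q' A by simp
    then show ?thesis using Q Q' A B by (intro similar_matI[of _ _ Q' Q n]) auto
  qed
  have BE: "B * col_id n d = col_id n d * C"
  proof -
    have "B * col_id n d = B * Q * X" using B Q X by (simp flip: QX)
    also have "\<dots> = Q * (X * C)" using BQ Q A X by (simp flip: AX)
    also have "\<dots> = col_id n d * C" using Q X C by (simp flip: QX)
    finally show ?thesis .
  qed
  have left: "B $$ (i, j) = (if i < d then C $$ (i, j) else 0)" if ij: "i < n" "j < d" for i j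
  proof -
    have "B $$ (i, j) = (col_id n d * C) $$ (i, j)" using mult_col_id[OF B P(3) ij] BE by simp
    also have "\<dots> = (if i < d then C $$ (i, j) else 0)"
      using ij C by (auto simp: col_id_def scalar_prod_def sum_delta_mult)
    finally show ?thesis .
  qed
  have trans: "(transpose_mat (col_id n d) * M) $$ (i, j) = M $$ (i, j)"
    if "M \<in> carrier_mat n n" "i < d" "j < n" for M :: "'a mat" and i j
  proof -
    have "(transpose_mat (col_id n d) * M) $$ (i, j) = (\<Sum>l = 0..<n. (if l = i then 1 else 0) * M $$ (l, j))"
      using that P(3) by (simp add: col_id_def scalar_prod_def)
    also have "\<dots> = (\<Sum>l = 0..<n. (if i = l then 1 else 0) * M $$ (l, j))"
      by (intro sum.cong) auto
    finally show ?thesis using that P(3) by (simp add: sum_delta_mult)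
  qed
  have "transpose_mat (col_id n d) * B = C * transpose_mat (col_id n d)"
  proof -
    have EQ: "transpose_mat (col_id n d) * Q = Y"
    proof (rule eq_matI)
      fix i j assume "i < dim_row Y" "j < dim_col Y"
      then have ij: "i < d" "j < n" using Y by auto
      then show "(transpose_mat (col_id n d) * Q) $$ (i, j) = Y $$ (i, j)"
        using trans[OF Q ij] P(3) by (simp add: Q_def)
    qed (use Q Y in \<open>auto simp: col_id_def\<close>)
    have "transpose_mat (col_id n d) * B = transpose_mat (col_id n d) * Q * A * Q'"
      unfolding B_def using Q Q' A
      by (simp add: assoc_mult_mat[of _ d n _ n _ n] assoc_mult_mat[of _ n n _ n _ n])
    also have "\<dots> = C * (Y * Q')" using Y C Q' by (simp add: EQ YA)
    also have "Y * Q' = transpose_mat (col_id n d)"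
      using Q Q' right_mult_one_mat[of "transpose_mat (col_id n d)" d n]
      by (simp add: assoc_mult_mat[of _ d n _ n _ n] flip: EQ)
    finally show ?thesis .
  qed
  then have top: "B $$ (i, j) = 0" if ij: "i < d" "d \<le> j" "j < n" for i j
  proof -
    have "B $$ (i, j) = (transpose_mat (col_id n d) * B) $$ (i, j)"
      using trans[OF B] ij by simp
    also have "\<dots> = (C * transpose_mat (col_id n d)) $$ (i, j)"
      using \<open>transpose_mat (col_id n d) * B = C * transpose_mat (col_id n d)\<close> by simp
    also have "\<dots> = 0"
      using ij C by (auto simp: col_id_def scalar_prod_def intro!: sum.neutral)
    finally show ?thesis .
  qed
  define D where "D = mat (n - d) (n - d) (\<lambda>(i, j). B $$ (i + d, j + d))"
  have "B = four_block_mat C (0\<^sub>m d (n - d)) (0\<^sub>m (n - d) d) D"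
  proof (rule eq_matI)
    fix i j assume "i < dim_row (four_block_mat C (0\<^sub>m d (n - d)) (0\<^sub>m (n - d) d) D)"
      "j < dim_col (four_block_mat C (0\<^sub>m d (n - d)) (0\<^sub>m (n - d) d) D)"
    then have ij: "i < n" "j < n" using C P(3) by (auto simp: D_def)
    then show "B $$ (i, j) = four_block_mat C (0\<^sub>m d (n - d)) (0\<^sub>m (n - d) d) D $$ (i, j)"
      using C left[of i j] top[of i j] P(3) by (auto simp: D_def)
  qed (use B C P(3) in \<open>auto simp: D_def\<close>)
  then show ?thesis using simAB P(3) by (intro conjI exI[of _ D]) (auto simp: D_def)
qed

section \<open>Krylov spaces and cyclic blocks\<close>

definition krylov :: "'a::field mat \<Rightarrow> 'a vec \<Rightarrow> nat \<Rightarrow> 'a mat" where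
  "krylov A v d = mat (dim_row A) d (\<lambda>(i, j). (((*\<^sub>v) A ^^ j) v) $ i)"

definition krylov_indep :: "'a::field mat \<Rightarrow> 'a vec \<Rightarrow> nat \<Rightarrow> bool" where
  "krylov_indep A v d \<longleftrightarrow> v \<in> carrier_vec (dim_row A) \<and> trivial_kernel (krylov A v d)"

lemma krylov_carrier: "A \<in> carrier_mat n n \<Longrightarrow> krylov A v d \<in> carrier_mat n d"
  by (simp add: krylov_def)

lemma funpow_mat_vec_carrier:
  assumes "A \<in> carrier_mat n n" "v \<in> carrier_vec n"
  shows "((*\<^sub>v) A ^^ j) v \<in> carrier_vec n"
  using assms by (induction j) auto

lemma col_krylov:
  assumes "A \<in> carrier_mat n n" "v \<in> carrier_vec n" "j < d"
  shows "col (krylov A v d) j = ((*\<^sub>v) A ^^ j) v"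
  using assms funpow_mat_vec_carrier[OF assms(1,2), of j] by (intro eq_vecI) (auto simp: krylov_def)

lemma scalar_prod_transpose_funpow:
  fixes A :: "'a::field mat"
  assumes "A \<in> carrier_mat n n" "w \<in> carrier_vec n" "f \<in> carrier_vec n"
  shows "((*\<^sub>v) (transpose_mat A) ^^ i) f \<bullet> w = f \<bullet> ((*\<^sub>v) A ^^ i) w"
  using assms(2)
proof (induction i arbitrary: w)
  case (Suc i)
  have g: "((*\<^sub>v) (transpose_mat A) ^^ i) f \<in> carrier_vec n"
    using assms by (intro funpow_mat_vec_carrier) auto
  have "((*\<^sub>v) (transpose_mat A) ^^ Suc i) f \<bullet> w = ((*\<^sub>v) (transpose_mat A) ^^ i) f \<bullet> (A *\<^sub>v w)"
    using transpose_vec_mult_scalar[OF assms(1) Suc.prems g] by simp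
  also have "\<dots> = f \<bullet> ((*\<^sub>v) A ^^ i) (A *\<^sub>v w)"
    using assms Suc.prems by (intro Suc.IH) auto
  finally show ?case by (simp only: funpow_Suc_right o_apply)
qed simp

text \<open>The functional \<open>f\<close> takes the value 1 on the last Krylov vector and 0 on the
  others. The pairings of the two Krylov families depend only on \<open>i + j\<close>, vanish for
  \<open>i + j < d - 1\<close> and equal 1 for \<open>i + j = d - 1\<close>. So the pairing matrix
  is triangular up to reversing the columns, hence invertible, and then the Krylov family of
  \<open>f\<close> is independent as well.\<close>

lemma krylov_dual:
  fixes A :: "'a::field mat"
  assumes A: "A \<in> carrier_mat n n" and ind: "krylov_indep A v d" and d: "d > 0"
  obtains f where "f \<in> carrier_vec n"
    "det (transpose_mat (krylov (transpose_mat A) f d) * krylov A v d) \<noteq> 0"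
    "krylov_indep (transpose_mat A) f d"
proof -
  let ?X = "krylov A v d"
  have v: "v \<in> carrier_vec n" using ind A by (simp add: krylov_indep_def)
  have X: "?X \<in> carrier_mat n d" using A by (rule krylov_carrier)
  obtain P where P: "P \<in> carrier_mat n n" "d \<le> n" "P * ?X = col_id n d"
    using trivial_kernel_reduce[OF X] ind by (auto simp: krylov_indep_def)
  define f where "f = row P (d - 1)"
  have f: "f \<in> carrier_vec n" using P d by (auto simp: f_def)
  have fX: "f \<bullet> (((*\<^sub>v) A ^^ j) v) = (if j = d - 1 then 1 else 0)" if "j < d" for j
  proof -
    have "f \<bullet> (((*\<^sub>v) A ^^ j) v) = (P * ?X) $$ (d - 1, j)"
      using that P(1,2) X d col_krylov[OF A v that] by (simp add: f_def)
    then show ?thesis using that P d by (auto simp: col_id_def)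
  qed
  let ?Z = "krylov (transpose_mat A) f d"
  have Z: "?Z \<in> carrier_mat n d" using A by (intro krylov_carrier) simp
  define T where "T = transpose_mat ?Z * ?X"
  have T: "T \<in> carrier_mat d d" using Z X by (simp add: T_def)
  have Tij: "T $$ (i, j) = f \<bullet> (((*\<^sub>v) A ^^ (i + j)) v)" if "i < d" "j < d" for i j
  proof -
    have "T $$ (i, j) = col ?Z i \<bullet> col ?X j"
      using that Z X by (simp add: T_def)
    also have "\<dots> = ((*\<^sub>v) (transpose_mat A) ^^ i) f \<bullet> ((*\<^sub>v) A ^^ j) v"
      using col_krylov[OF A v that(2)] col_krylov[of "transpose_mat A" n f i d] A f that by simp
    also have "\<dots> = f \<bullet> ((*\<^sub>v) A ^^ i) (((*\<^sub>v) A ^^ j) v)"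
      using scalar_prod_transpose_funpow[OF A funpow_mat_vec_carrier[OF A v] f] .
    finally show ?thesis by (simp add: funpow_add)
  qed
  have "trivial_kernel T"
    unfolding trivial_kernel_def
  proof (intro ballI impI)
    fix c assume c: "c \<in> carrier_vec (dim_col T)" and Tc: "T *\<^sub>v c = 0\<^sub>v (dim_row T)"
    have "c $ (d - 1 - i) = 0" if "i < d" for i
      using that
    proof (induction i rule: less_induct)
      case (less i)
      have "0 = (T *\<^sub>v c) $ i" using Tc T less.prems by simp
      also have "\<dots> = (\<Sum>j = 0..<d. T $$ (i, j) * c $ j)"
        using T c less.prems by (auto simp: scalar_prod_def)
      also have "\<dots> = (\<Sum>j = 0..<d. if j = d - 1 - i then c $ j else 0)"
      proof (intro sum.cong refl)
        fix j assume "j \<in> {0..<d}"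
        then have j: "j < d" by simp
        consider "j < d - 1 - i" | "j = d - 1 - i" | "j > d - 1 - i" by linarith
        then show "T $$ (i, j) * c $ j = (if j = d - 1 - i then c $ j else 0)"
        proof cases
          case 3
          then have "c $ (d - 1 - (d - 1 - j)) = 0" using less.IH[of "d - 1 - j"] less.prems j by auto
          then show ?thesis using 3 j by simp
        qed (use less.prems j Tij[of i j] fX[of "i + j"] in auto)
      qed
      finally show ?case using less.prems by simp
    qed
    then have "c $ j = 0" if "j < d" for j
    proof -
      have "d - 1 - (d - 1 - j) = j" "d - 1 - j < d" using that by auto
      then show ?thesis using \<open>\<And>i. i < d \<Longrightarrow> c $ (d - 1 - i) = 0\<close>[of "d - 1 - j"] by simp
    qed
    then show "c = 0\<^sub>v (dim_col T)" using c T by (intro eq_vecI) auto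
  qed
  then have det: "det T \<noteq> 0" using det_nonzero_iff_trivial_kernel[OF T] by simp
  have "trivial_kernel ?Z"
    unfolding trivial_kernel_def
  proof (intro ballI impI)
    fix c assume "c \<in> carrier_vec (dim_col ?Z)" and Zc: "?Z *\<^sub>v c = 0\<^sub>v (dim_row ?Z)"
    then have c: "c \<in> carrier_vec d" using Z by simp
    have "transpose_mat T *\<^sub>v c = transpose_mat ?X *\<^sub>v (?Z *\<^sub>v c)"
      unfolding T_def using Z X c by (subst transpose_mult) auto
    also have "\<dots> = 0\<^sub>v d" using Zc X Z by auto
    finally have "transpose_mat T *\<^sub>v c = 0\<^sub>v d" .
    moreover have "trivial_kernel (transpose_mat T)"
      using det T by (simp add: det_transpose flip: det_nonzero_iff_trivial_kernel[of _ d])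
    ultimately show "c = 0\<^sub>v (dim_col ?Z)" using c T Z unfolding trivial_kernel_def by auto
  qed
  then show ?thesis using that[OF f] det f A by (auto simp: krylov_indep_def T_def)
qed

text \<open>The companion matrix of \<open>X^d - (c_0 + ... + c_(d-1) X^(d-1))\<close>. In size 2
  this means trace \<open>c $ 1\<close> and determinant \<open>- c $ 0\<close>.\<close>

definition comp_mat :: "nat \<Rightarrow> 'a::field vec \<Rightarrow> 'a mat" where
  "comp_mat d c = mat d d (\<lambda>(i, j). if Suc j = d then c $ i else if i = Suc j then 1 else 0)"

lemma comp_mat_carrier [simp]: "comp_mat d c \<in> carrier_mat d d"
  by (simp add: comp_mat_def)

lemma krylov_mult:
  fixes A :: "'a::field mat"
  assumes A: "A \<in> carrier_mat n n" and ind: "krylov_indep A v d"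
    and dep: "\<not> krylov_indep A v (Suc d)"
  obtains c where "c \<in> carrier_vec d" "A * krylov A v d = krylov A v d * comp_mat d c"
proof -
  let ?X = "krylov A v d" and ?X' = "krylov A v (Suc d)"
  have v: "v \<in> carrier_vec n" using ind A by (simp add: krylov_indep_def)
  have X: "?X \<in> carrier_mat n d" and X': "?X' \<in> carrier_mat n (Suc d)" using A krylov_carrier by auto
  obtain e where e: "e \<in> carrier_vec (Suc d)" "?X' *\<^sub>v e = 0\<^sub>v n" "e \<noteq> 0\<^sub>v (Suc d)"
    using dep v A X' by (auto simp: krylov_indep_def trivial_kernel_def)
  define c0 where "c0 = vec d (\<lambda>i. e $ i)"
  have exp: "(?X *\<^sub>v c0) + e $ d \<cdot>\<^sub>v (((*\<^sub>v) A ^^ d) v) = 0\<^sub>v n"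
  proof -
    have "?X' *\<^sub>v e = (?X *\<^sub>v c0) + e $ d \<cdot>\<^sub>v (((*\<^sub>v) A ^^ d) v)"
      using e(1) A funpow_mat_vec_carrier[OF A v, of d]
      by (intro eq_vecI) (auto simp: krylov_def c0_def scalar_prod_def)
    then show ?thesis using e by simp
  qed
  have ed: "e $ d \<noteq> 0"
  proof
    assume 0: "e $ d = 0"
    have "e $ d \<cdot>\<^sub>v (((*\<^sub>v) A ^^ d) v) = 0\<^sub>v n"
      using 0 funpow_mat_vec_carrier[OF A v, of d] by (intro eq_vecI) auto
    then have "?X *\<^sub>v c0 = 0\<^sub>v n"
      using exp X right_zero_vec[of "?X *\<^sub>v c0" n] by (simp add: c0_def)
    then have "c0 = 0\<^sub>v d" using ind X unfolding krylov_indep_def trivial_kernel_def by (auto simp: c0_def)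
    then have "e $ i = 0" if "i < d" for i using that by (metis c0_def index_vec index_zero_vec(1))
    then have "e = 0\<^sub>v (Suc d)" using 0 e by (intro eq_vecI) (auto simp: less_Suc_eq)
    then show False using e by simp
  qed
  define c where "c = (- 1 / e $ d) \<cdot>\<^sub>v c0"
  have c: "c \<in> carrier_vec d" by (simp add: c_def c0_def)
  have Ad: "(((*\<^sub>v) A ^^ d) v) $ i = (?X *\<^sub>v c) $ i" if i: "i < n" for i
  proof -
    have "(?X *\<^sub>v c) $ i = (- 1 / e $ d) * (?X *\<^sub>v c0) $ i"
      using i X by (simp add: c_def c0_def)
    moreover have "((?X *\<^sub>v c0) + e $ d \<cdot>\<^sub>v (((*\<^sub>v) A ^^ d) v)) $ i = 0" using exp i by simp
    then have "(?X *\<^sub>v c0) $ i + e $ d * (((*\<^sub>v) A ^^ d) v) $ i = 0"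
      using i X funpow_mat_vec_carrier[OF A v, of d] by simp
    moreover have "a = - 1 / y * z" if "z + y * a = 0" "y \<noteq> 0" for a y z :: 'a
      using that by (simp add: field_simps eq_neg_iff_add_eq_0)
    ultimately show ?thesis using ed by presburger
  qed
  have "A * ?X = ?X * comp_mat d c"
  proof (rule eq_matI)
    fix i j assume "i < dim_row (?X * comp_mat d c)" "j < dim_col (?X * comp_mat d c)"
    then have ij: "i < n" "j < d" using X by (auto simp: comp_mat_def)
    have "(A * ?X) $$ (i, j) = (A *\<^sub>v col ?X j) $ i" using ij A X by simp
    also have "\<dots> = (((*\<^sub>v) A ^^ Suc j) v) $ i" using col_krylov[OF A v ij(2)] by simp
    also have "\<dots> = (?X * comp_mat d c) $$ (i, j)"
    proof (cases "Suc j = d")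
      case True
      then have "col (comp_mat d c) j = c" using c by (intro eq_vecI) (auto simp: comp_mat_def)
      then show ?thesis using True ij X Ad[OF ij(1)] by (simp add: comp_mat_def)
    next
      case False
      have "(?X * comp_mat d c) $$ (i, j) = (\<Sum>l = 0..<d. (if Suc j = l then 1 else 0) * ?X $$ (i, l))"
        using ij X False by (auto simp: comp_mat_def scalar_prod_def intro!: sum.cong)
      then show ?thesis using ij A False by (simp add: sum_delta_mult krylov_def)
    qed
    finally show "(A * ?X) $$ (i, j) = (?X * comp_mat d c) $$ (i, j)" .
  qed (use A X in \<open>auto simp: comp_mat_def\<close>)
  then show ?thesis using that c by blast
qed

text \<open>If the Krylov length \<open>d\<close> is maximal over all vectors it is maximal for the transpose too.
  A functional \<open>f\<close> whose Krylov space under the transpose pairs perfectly with that of \<open>v\<close>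
  then has an invariant annihilator, which complements the Krylov space of \<open>v\<close>.\<close>

lemma cyclic_split:
  fixes A :: "'a::field mat"
  assumes A: "A \<in> carrier_mat n n" and ind: "krylov_indep A v d" and d: "d > 0"
    and max: "\<And>w. \<not> krylov_indep A w (Suc d)"
  shows "d \<le> n \<and> (\<exists>c D. c \<in> carrier_vec d \<and> D \<in> carrier_mat (n - d) (n - d) \<and>
    similar_mat A (four_block_mat (comp_mat d c) (0\<^sub>m d (n - d)) (0\<^sub>m (n - d) d) D))"
proof -
  let ?X = "krylov A v d"
  have X: "?X \<in> carrier_mat n d" using A by (rule krylov_carrier)
  obtain f where f: "f \<in> carrier_vec n"
    and det: "det (transpose_mat (krylov (transpose_mat A) f d) * ?X) \<noteq> 0"
    and indf: "krylov_indep (transpose_mat A) f d"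
    using krylov_dual[OF A ind d] by blast
  let ?Z = "krylov (transpose_mat A) f d"
  have Z: "?Z \<in> carrier_mat n d" using A by (intro krylov_carrier) simp
  have maxf: "\<not> krylov_indep (transpose_mat A) f (Suc d)"
  proof
    assume "krylov_indep (transpose_mat A) f (Suc d)"
    then obtain w where "krylov_indep (transpose_mat (transpose_mat A)) w (Suc d)"
      using krylov_dual[of "transpose_mat A" n f "Suc d"] A by auto
    then show False using max by simp
  qed
  obtain c where c: "c \<in> carrier_vec d" and AX: "A * ?X = ?X * comp_mat d c"
    using krylov_mult[OF A ind max] by blast
  obtain c' where "c' \<in> carrier_vec d"
    and AZ: "transpose_mat A * ?Z = ?Z * comp_mat d c'"
    using krylov_mult[OF _ indf maxf] A by auto
  define C' where "C' = transpose_mat (comp_mat d c')"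
  have C': "C' \<in> carrier_mat d d" by (simp add: C'_def)
  define W where "W = transpose_mat ?Z"
  have W: "W \<in> carrier_mat d n" using Z by (simp add: W_def)
  have WA: "W * A = C' * W"
    using arg_cong[OF AZ, of transpose_mat] A Z
    by (simp add: W_def C'_def transpose_mult[of _ n n _ d] transpose_mult[of _ n d _ d])
  obtain S where S: "S \<in> carrier_mat d d" "(W * ?X) * S = 1\<^sub>m d" "S * (W * ?X) = 1\<^sub>m d"
    using inverse_matE[of "W * ?X" d] det W X by (auto simp: W_def)
  \<comment> \<open>Dividing \<open>W\<close> by the pairing matrix \<open>W * ?X\<close> turns it
    into a left inverse of \<open>?X\<close> with the same kernel, namely the annihilator of the
    Krylov space of \<open>f\<close>.\<close>
  define Y where "Y = S * W"
  have Y: "Y \<in> carrier_mat d n" using S W by (simp add: Y_def)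
  have YX: "Y * ?X = 1\<^sub>m d" using S W X by (simp add: Y_def)
  define E where "E = S * C' * (W * ?X)"
  have E: "E \<in> carrier_mat d d" unfolding E_def
    using mult_carrier_mat[OF mult_carrier_mat[OF S(1) C'] mult_carrier_mat[OF W X]] .
  have YA: "Y * A = E * Y"
  proof -
    define V where "V = W * ?X"
    have "V \<in> carrier_mat d d" using W X by (simp add: V_def)
    then have "E * Y = S * C' * ((V * S) * W)"
      unfolding E_def Y_def V_def[symmetric] using S(1) C' W
      by (simp add: assoc_mult_mat[of _ d d _ d _ n] assoc_mult_mat[of _ d d _ d _ d])
    also have "V * S = 1\<^sub>m d" using S(2) by (simp add: V_def)
    also have "S * C' * (1\<^sub>m d * W) = Y * A"
      using S(1) W C' A WA by (simp add: Y_def assoc_mult_mat[of _ d d _ d] assoc_mult_mat[of _ d d _ n])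
    finally show ?thesis by simp
  qed
  \<comment> \<open>\<open>Y * A * ?X\<close>, evaluated from either side, identifies the two
    actions \<open>E\<close> and \<open>comp_mat d c\<close>, as \<open>split_block\<close>
    requires.\<close>
  have "comp_mat d c = Y * ?X * comp_mat d c" by (simp add: YX left_mult_one_mat[of _ d d])
  also have "\<dots> = Y * (A * ?X)" unfolding AX using Y X by (simp add: assoc_mult_mat[of _ d n _ d _ d])
  also have "\<dots> = E * (Y * ?X)"
    using Y A X E YA by (simp flip: assoc_mult_mat[of _ d n _ n _ d])
  also have "\<dots> = E" using E by (simp add: YX)
  finally have "E = comp_mat d c" by simp
  then have "Y * A = comp_mat d c * Y" using YA by simp
  from split_block[OF A X Y comp_mat_carrier AX this YX] show ?thesis using c by blast
qed

lemma krylov_indep_le: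
  assumes "A \<in> carrier_mat n n" "krylov_indep A v d"
  shows "d \<le> n"
  using trivial_kernel_reduce[OF krylov_carrier[OF assms(1)]] assms(2)
  by (auto simp: krylov_indep_def)

lemma krylov_indep_max:
  fixes A :: "'a::field mat"
  assumes A: "A \<in> carrier_mat n n" and ind: "krylov_indep A v d"
  obtains d' v' where "d' \<ge> d" "krylov_indep A v' d'" "\<And>w. \<not> krylov_indep A w (Suc d')"
proof -
  let ?P = "\<lambda>d. \<exists>v. krylov_indep A v d"
  have P: "?P d" using ind by blast
  have b: "\<And>y. ?P y \<Longrightarrow> y \<le> n" using krylov_indep_le[OF A] by blast
  define m where "m = (GREATEST d. ?P d)"
  have "?P m" unfolding m_def by (rule GreatestI_nat[where P = ?P and k = d and b = n]) (use P b in auto)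
  moreover have "d \<le> m" unfolding m_def by (rule Greatest_le_nat[where P = ?P and k = d and b = n]) (use P b in auto)
  moreover have "\<not> ?P (Suc m)"
  proof
    assume "?P (Suc m)"
    then have "Suc m \<le> m" unfolding m_def
      by (rule Greatest_le_nat[where P = ?P and b = n]) (use b in auto)
    then show False by simp
  qed
  ultimately show ?thesis using that by blast
qed

text \<open>If no vector is independent of its image, every nonzero vector is an eigenvector. Unit
  vectors then show that the matrix is diagonal, and sums of two unit vectors show that the diagonal
  is constant.\<close>

lemma scalar_or_krylov_indep:
  fixes A :: "'a::field mat"
  assumes A: "A \<in> carrier_mat n n"
  shows "(\<exists>x. A = x \<cdot>\<^sub>m 1\<^sub>m n) \<or> (\<exists>v. krylov_indep A v 2)"
proof (cases "\<exists>v. krylov_indep A v 2")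
  case False
  have dep: "\<exists>c0 c1. (c0, c1) \<noteq> (0, 0) \<and> (\<forall>i<n. c0 * v $ i + c1 * (A *\<^sub>v v) $ i = 0)"
    if v: "v \<in> carrier_vec n" for v
  proof -
    obtain e where e: "e \<in> carrier_vec 2" "krylov A v 2 *\<^sub>v e = 0\<^sub>v n" "e \<noteq> 0\<^sub>v 2"
      using False A v by (auto simp: krylov_indep_def trivial_kernel_def krylov_def)
    have "e $ 0 * v $ i + e $ 1 * (A *\<^sub>v v) $ i = 0" if i: "i < n" for i
    proof -
      have "(krylov A v 2 *\<^sub>v e) $ i = e $ 0 * v $ i + e $ 1 * (A *\<^sub>v v) $ i"
        using i e(1) A v by (simp add: krylov_def scalar_prod_def numeral_2_eq_2 mult.commute)
      then show ?thesis using e(2) i by simp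
    qed
    moreover have "(e $ 0, e $ 1) \<noteq> (0, 0)"
    proof
      assume "(e $ 0, e $ 1) = (0, 0)"
      then have "e = 0\<^sub>v 2" using e(1) by (intro eq_vecI) (auto simp: less_2_cases_iff)
      then show False using e by simp
    qed
    ultimately show ?thesis by blast
  qed
  have Au: "(A *\<^sub>v unit_vec n j) $ i = A $$ (i, j)" if "i < n" "j < n" for i j
    using A that by simp
  have off: "A $$ (i, j) = 0" if ij: "i < n" "j < n" "i \<noteq> j" for i j
  proof -
    obtain c0 c1 where c: "(c0, c1) \<noteq> (0, 0)"
      "\<And>l. l < n \<Longrightarrow> c0 * (unit_vec n j :: 'a vec) $ l + c1 * (A *\<^sub>v unit_vec n j) $ l = 0"
      using dep[of "unit_vec n j"] by auto
    show ?thesis using c(1) c(2)[of i] c(2)[of j] Au[of i j] Au[of j j] ij by auto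
  qed
  have eq: "A $$ (i, i) = A $$ (j, j)" if ij: "i < n" "j < n" "i \<noteq> j" for i j
  proof -
    let ?v = "unit_vec n i + unit_vec n j :: 'a vec"
    obtain c0 c1 where c: "(c0, c1) \<noteq> (0, 0)"
      "\<And>l. l < n \<Longrightarrow> c0 * ?v $ l + c1 * (A *\<^sub>v ?v) $ l = 0"
      using dep[of ?v] by auto
    have Av: "(A *\<^sub>v ?v) $ l = A $$ (l, i) + A $$ (l, j)" if "l < n" for l
      using mult_add_distrib_mat_vec[OF A, of "unit_vec n i" "unit_vec n j"] that Au[of l i] Au[of l j] A ij
      by simp
    have e: "c0 + c1 * A $$ (i, i) = 0" "c0 + c1 * A $$ (j, j) = 0"
      using c(2)[of i] c(2)[of j] ij Av[of i] Av[of j] off[of i j] off[of j i] by auto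
    then have "c1 * A $$ (i, i) = c1 * A $$ (j, j)" by (metis add_left_imp_eq)
    moreover have "c1 \<noteq> 0" using c(1) e by auto
    ultimately show ?thesis by simp
  qed
  \<comment> \<open>For \<open>n = 0\<close> the entry taken is a meaningless default, but then both
    sides are empty.\<close>
  have "A = A $$ (0, 0) \<cdot>\<^sub>m 1\<^sub>m n"
  proof (rule eq_matI)
    fix i j assume "i < dim_row (A $$ (0, 0) \<cdot>\<^sub>m 1\<^sub>m n)" "j < dim_col (A $$ (0, 0) \<cdot>\<^sub>m 1\<^sub>m n)"
    then show "A $$ (i, j) = (A $$ (0, 0) \<cdot>\<^sub>m 1\<^sub>m n) $$ (i, j)"
      using off[of i j] eq[of i 0] by (cases "i = 0") auto
  qed (use A in auto)
  then show ?thesis by blast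
qed auto

text \<open>The seam contributes a single zero. The ones next to it come from the block in front,
  which has size at least 2, and from the leading one of \<open>H\<close>.\<close>

lemma good_hess_block:
  assumes d: "d \<ge> 2" and H: "good_hess h H"
  shows "good_hess (d + h) (four_block_mat (comp_mat d c) (0\<^sub>m d h) (0\<^sub>m h d) H)" (is "good_hess _ ?B")
proof -
  have Hc: "H \<in> carrier_mat h h" using H by (simp add: good_hess_def)
  have B: "?B $$ (i, j) = (if i < d then if j < d then (if Suc j = d then c $ i else if i = Suc j then 1 else 0) else 0
     else if j < d then 0 else H $$ (i - d, j - d))" if "i < d + h" "j < d + h" for i j
    using that Hc by (auto simp: comp_mat_def)
  have sub: "?B $$ (Suc i, i) = (if Suc i < d then 1 else if Suc i = d then 0 else H $$ (Suc (i - d), i - d))"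
    if "Suc i < d + h" for i
    using that by (auto simp: B Suc_diff_le)
  show ?thesis
    unfolding good_hess_def
  proof (intro conjI allI impI)
    show "?B \<in> carrier_mat (d + h) (d + h)" using Hc by simp
  next
    fix i j assume "i < d + h" "Suc j < i"
    then show "?B $$ (i, j) = 0"
      using H B[of i j] unfolding good_hess_def by auto
  next
    fix i assume "Suc i < d + h"
    then show "?B $$ (Suc i, i) \<in> {0, 1}"
      using H sub[of i] unfolding good_hess_def by auto
  next
    fix i assume i: "Suc i < d + h" "?B $$ (Suc i, i) = 0"
    show "Suc (Suc i) < d + h"
    proof (cases "Suc i = d")
      case True
      then have "0 < h" using i by simp
      then show ?thesis using H True unfolding good_hess_def by auto
    next
      case False
      then have "d \<le> i" "Suc (i - d) < h" "H $$ (Suc (i - d), i - d) = 0"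
        using i sub[of i] by (auto split: if_splits)
      then have "Suc (Suc (i - d)) < h" using H unfolding good_hess_def by blast
      then show ?thesis using \<open>d \<le> i\<close> by simp
    qed
    show "?B $$ (Suc (Suc i), Suc i) = 1"
    proof (cases "Suc i = d")
      case True
      then have "0 < h" using i by simp
      then show ?thesis using H True sub[of "Suc i"] unfolding good_hess_def by auto
    next
      case False
      then have "d \<le> i" "Suc (i - d) < h" "H $$ (Suc (i - d), i - d) = 0"
        using i sub[of i] by (auto split: if_splits)
      then have "H $$ (Suc (Suc (i - d)), Suc (i - d)) = 1" "Suc (Suc (i - d)) < h"
        using H unfolding good_hess_def by blast+
      then show ?thesis using \<open>d \<le> i\<close> sub[of "Suc i"] by (simp add: Suc_diff_le)
    qed
  next
    show "1 < d + h" using d by simp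
  next
    show "?B $$ (1, 0) = 1" using d sub[of 0] by simp
  qed
qed

text \<open>A matrix that is not scalar has a Krylov space of dimension at least 2, so the recursion
  can stop at a scalar remainder and never produces a block of size 1. The block split off first has
  the maximal length for all of \<open>A\<close>, which puts the one in position
  \<open>(2, 1)\<close> as soon as dimension 3 occurs.\<close>

lemma hess_form:
  fixes A :: "'a::field mat"
  assumes "A \<in> carrier_mat n n"
  shows "\<exists>h H x. h \<le> n \<and> good_hess h H \<and>
    ((\<exists>v. krylov_indep A v 3) \<longrightarrow> h \<ge> 3 \<and> H $$ (2, 1) = 1) \<and>
    similar_mat A (four_block_mat H (0\<^sub>m h (n - h)) (0\<^sub>m (n - h) h) (x \<cdot>\<^sub>m 1\<^sub>m (n - h)))"
  using assms
proof (induction n arbitrary: A rule: less_induct)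
  case (less n)
  note A = less.prems
  consider v where "krylov_indep A v 3" | x where "A = x \<cdot>\<^sub>m 1\<^sub>m n" "\<nexists>v. krylov_indep A v 3"
    | v where "krylov_indep A v 2" "\<nexists>v. krylov_indep A v 3"
    using scalar_or_krylov_indep[OF A] by blast
  then show ?case
  proof cases
    case (2 x)
    have "A = four_block_mat (mat 0 0 (\<lambda>_. 0)) (0\<^sub>m 0 n) (0\<^sub>m n 0) (x \<cdot>\<^sub>m 1\<^sub>m n)"
      unfolding 2(1) by (intro eq_matI) auto
    then have "similar_mat A (four_block_mat (mat 0 0 (\<lambda>_. 0)) (0\<^sub>m 0 n) (0\<^sub>m n 0) (x \<cdot>\<^sub>m 1\<^sub>m n))"
      using similar_mat_refl[OF A] by simp
    moreover have "good_hess 0 (mat 0 0 (\<lambda>_. 0))" by (auto simp: good_hess_def)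
    ultimately show ?thesis using 2(2)
      by (intro exI[of _ 0] exI[of _ "mat 0 0 (\<lambda>_. 0)"] exI[of _ x]) simp
  next
    have step: ?thesis if ind: "krylov_indep A v d" and d2: "d \<ge> 2"
      and d3: "(\<exists>v. krylov_indep A v 3) \<longrightarrow> d \<ge> 3" for v d
    proof -
      obtain d' v' where d': "d' \<ge> d" "krylov_indep A v' d'" "\<And>w. \<not> krylov_indep A w (Suc d')"
        using krylov_indep_max[OF A ind] by blast
      then obtain c D where dn: "d' \<le> n" and D: "D \<in> carrier_mat (n - d') (n - d')"
        and sim: "similar_mat A (four_block_mat (comp_mat d' c) (0\<^sub>m d' (n - d')) (0\<^sub>m (n - d') d') D)"
        using cyclic_split[OF A d'(2) _ d'(3)] d2 by auto
      obtain h H x where h: "h \<le> n - d'" and H: "good_hess h H"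
        and simD: "similar_mat D (four_block_mat H (0\<^sub>m h (n - d' - h)) (0\<^sub>m (n - d' - h) h) (x \<cdot>\<^sub>m 1\<^sub>m (n - d' - h)))"
        using less.IH[OF _ D] d2 d' dn by auto
      have Hc: "H \<in> carrier_mat h h" using H by (simp add: good_hess_def)
      define k where "k = n - d' - h"
      let ?C = "comp_mat d' c"
      let ?H = "four_block_mat ?C (0\<^sub>m d' h) (0\<^sub>m h d') H"
      have nk: "n - d' = h + k" "n - (d' + h) = k" using h dn by (auto simp: k_def)
      have "similar_mat A (four_block_mat ?C (0\<^sub>m d' (h + k)) (0\<^sub>m (h + k) d')
        (four_block_mat H (0\<^sub>m h k) (0\<^sub>m k h) (x \<cdot>\<^sub>m 1\<^sub>m k)))"
        using similar_mat_trans[OF sim similar_mat_four_block_0_0[OF similar_mat_refl[OF comp_mat_carrier] simD comp_mat_carrier D]]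
        unfolding k_def[symmetric] nk(1) by simp
      also have "four_block_mat ?C (0\<^sub>m d' (h + k)) (0\<^sub>m (h + k) d')
        (four_block_mat H (0\<^sub>m h k) (0\<^sub>m k h) (x \<cdot>\<^sub>m 1\<^sub>m k))
        = four_block_mat ?H (0\<^sub>m (d' + h) k) (0\<^sub>m k (d' + h)) (x \<cdot>\<^sub>m 1\<^sub>m k)"
        using assoc_four_block_mat[of ?C H "x \<cdot>\<^sub>m 1\<^sub>m k"] Hc carrier_matD[OF comp_mat_carrier[of d' c]]
        by simp
      finally have "similar_mat A (four_block_mat ?H (0\<^sub>m (d' + h) k) (0\<^sub>m k (d' + h)) (x \<cdot>\<^sub>m 1\<^sub>m k))" .
      moreover have "good_hess (d' + h) ?H" using good_hess_block[OF _ H] d' d2 by simp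
      moreover have "?H $$ (2, 1) = 1" if "d' \<ge> 3" using that Hc by (simp add: comp_mat_def)
      moreover have "d' + h \<le> n" using h dn by simp
      ultimately show ?thesis using nk(2) d3 d'(1)
        by (intro exI[of _ "d' + h"] exI[of _ ?H] exI[of _ x]) auto
    qed
    {
      case (1 v)
      then show ?thesis using step[of v 3] by simp
    next
      case (3 v)
      then show ?thesis using step[of v 2] by auto
    }
  qed
qed

section \<open>Matrices whose Krylov spaces have dimension at most 2\<close>

lemma similar_mat_quadratic:
  fixes A :: "'a::field mat"
  assumes "similar_mat A B" "A \<in> carrier_mat n n" "A * A = q \<cdot>\<^sub>m A + p \<cdot>\<^sub>m 1\<^sub>m n"
  shows "B * B = q \<cdot>\<^sub>m B + p \<cdot>\<^sub>m 1\<^sub>m n"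
proof -
  obtain P Q where "similar_mat_wit B A P Q"
    using assms(1) similar_mat_sym unfolding similar_mat_def by blast
  moreover have B: "B \<in> carrier_mat n n" using assms(1,2) similar_matD[OF assms(1)] by auto
  ultimately have w: "P \<in> carrier_mat n n" "Q \<in> carrier_mat n n" "P * Q = 1\<^sub>m n" "Q * P = 1\<^sub>m n" "B = P * A * Q"
    using similar_mat_witD2[of B n n A P Q] by auto
  have QP: "Q * (P * Y) = Y" if "Y \<in> carrier_mat n n" for Y
    using that w by (simp add: assoc_mult_mat[of Q n n P n Y n, symmetric])
  have "B * B = P * (A * A) * Q"
    unfolding w(5) using w(1,2) assms(2) by (simp add: assoc_mult_mat[of _ n n _ n _ n] QP)
  also have "\<dots> = q \<cdot>\<^sub>m (P * A * Q) + p \<cdot>\<^sub>m (P * Q)"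
    unfolding assms(3) using w(1,2) assms(2)
    by (simp add: mult_add_distrib_mat[of _ n n _ n] add_mult_distrib_mat[of _ n n _ _ n]
          mult_smult_distrib[of _ n n _ n] mult_smult_assoc_mat[of _ n n _ n])
  finally show ?thesis using w by simp
qed

lemma funpow_similar:
  fixes A :: "'a::field mat"
  assumes "A \<in> carrier_mat n n" "B \<in> carrier_mat n n" "P \<in> carrier_mat n n"
    "A * P = P * B" "w \<in> carrier_vec n"
  shows "((*\<^sub>v) A ^^ j) (P *\<^sub>v w) = P *\<^sub>v (((*\<^sub>v) B ^^ j) w)"
proof (induction j)
  case (Suc j)
  let ?w = "((*\<^sub>v) B ^^ j) w"
  have w: "?w \<in> carrier_vec n" using assms by (intro funpow_mat_vec_carrier)
  have "A *\<^sub>v (P *\<^sub>v ?w) = (P * B) *\<^sub>v ?w"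
    using assoc_mult_mat_vec[OF assms(1,3) w] assms(4) by simp
  also have "\<dots> = P *\<^sub>v (B *\<^sub>v ?w)" by (rule assoc_mult_mat_vec[OF assms(3,2) w])
  finally show ?case using Suc by simp
qed simp

lemma krylov_indep_similar:
  fixes A :: "'a::field mat"
  assumes "similar_mat A B" "A \<in> carrier_mat n n" "krylov_indep B w d"
  shows "\<exists>v. krylov_indep A v d"
proof -
  obtain P Q where wit: "similar_mat_wit A B P Q"
    using assms(1) unfolding similar_mat_def by blast
  note w = similar_mat_witD2[OF assms(2) wit]
  have wv: "w \<in> carrier_vec n" using assms(3) w by (simp add: krylov_indep_def)
  have AP: "A * P = P * B"
    using w by (simp add: assoc_mult_mat[of _ n n _ n _ n])
  have X: "krylov B w d \<in> carrier_mat n d" using w by (intro krylov_carrier) auto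
  have "krylov A (P *\<^sub>v w) d = P * krylov B w d"
  proof (rule eq_matI)
    fix i j assume "i < dim_row (P * krylov B w d)" "j < dim_col (P * krylov B w d)"
    then have ij: "i < n" "j < d" using w X by auto
    then have "krylov A (P *\<^sub>v w) d $$ (i, j) = (P *\<^sub>v (((*\<^sub>v) B ^^ j) w)) $ i"
      using funpow_similar[of A n B P w j] w AP wv by (simp add: krylov_def)
    also have "\<dots> = (P * krylov B w d) $$ (i, j)"
      using ij w X col_krylov[of B n w j d] wv by simp
    finally show "krylov A (P *\<^sub>v w) d $$ (i, j) = (P * krylov B w d) $$ (i, j)" .
  qed (use w X in \<open>auto simp: krylov_def\<close>)
  moreover have "trivial_kernel (P * krylov B w d)"
    unfolding trivial_kernel_def
  proof (intro ballI impI)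
    fix c assume c: "c \<in> carrier_vec (dim_col (P * krylov B w d))"
      "(P * krylov B w d) *\<^sub>v c = 0\<^sub>v (dim_row (P * krylov B w d))"
    then have c': "c \<in> carrier_vec d" and "(P * krylov B w d) *\<^sub>v c = 0\<^sub>v n" using w X by auto
    moreover have "Q *\<^sub>v 0\<^sub>v n = 0\<^sub>v n" using w by (intro eq_vecI) auto
    ultimately have "Q *\<^sub>v (P *\<^sub>v (krylov B w d *\<^sub>v c)) = 0\<^sub>v n" using w X by simp
    moreover have "Q *\<^sub>v (P *\<^sub>v y) = y" if "y \<in> carrier_vec n" for y
      using assoc_mult_mat_vec[of Q n n P n y] w that by simp
    ultimately have "krylov B w d *\<^sub>v c = 0\<^sub>v n" using X c' by simp
    then show "c = 0\<^sub>v (dim_col (P * krylov B w d))"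
      using assms(3) X c' unfolding krylov_indep_def trivial_kernel_def by auto
  qed
  ultimately have "krylov_indep A (P *\<^sub>v w) d"
    using w wv by (auto simp: krylov_indep_def)
  then show ?thesis by blast
qed

lemma krylov_indep_3I:
  fixes B :: "'a::field mat"
  assumes B: "B \<in> carrier_mat n n" and v: "v \<in> carrier_vec n"
    and ind: "\<And>x y z. \<forall>i<n. x * v $ i + y * (B *\<^sub>v v) $ i + z * (B *\<^sub>v (B *\<^sub>v v)) $ i = 0 \<Longrightarrow> x = 0 \<and> y = 0 \<and> z = 0"
  shows "krylov_indep B v 3"
proof -
  have "trivial_kernel (krylov B v 3)"
    unfolding trivial_kernel_def
  proof (intro ballI impI)
    fix e assume "e \<in> carrier_vec (dim_col (krylov B v 3))" and 0: "krylov B v 3 *\<^sub>v e = 0\<^sub>v (dim_row (krylov B v 3))"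
    then have e: "e \<in> carrier_vec 3" by (simp add: krylov_def)
    have "e $ 0 * v $ i + e $ 1 * (B *\<^sub>v v) $ i + e $ 2 * (B *\<^sub>v (B *\<^sub>v v)) $ i = 0" if i: "i < n" for i
    proof -
      have "(krylov B v 3 *\<^sub>v e) $ i = e $ 0 * v $ i + e $ 1 * (B *\<^sub>v v) $ i + e $ 2 * (B *\<^sub>v (B *\<^sub>v v)) $ i"
        using i e B v by (simp add: krylov_def scalar_prod_def numeral_3_eq_3 numeral_2_eq_2 mult.commute)
      moreover have "(krylov B v 3 *\<^sub>v e) $ i = 0" unfolding 0 using i B by (simp add: krylov_def)
      ultimately show ?thesis by simp
    qed
    then have "e $ 0 = 0" "e $ 1 = 0" "e $ 2 = 0" using ind[of "e $ 0" "e $ 1" "e $ 2"] by auto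
    then show "e = 0\<^sub>v (dim_col (krylov B v 3))"
      using e by (intro eq_vecI) (auto simp: krylov_def numeral_3_eq_3 less_Suc_eq numeral_2_eq_2)
  qed
  then show ?thesis using B v by (simp add: krylov_indep_def)
qed

lemma mult_block_diag:
  fixes A A' D D' :: "'a::field mat"
  assumes "A \<in> carrier_mat n n" "A' \<in> carrier_mat n n" "D \<in> carrier_mat m m" "D' \<in> carrier_mat m m"
  shows "four_block_mat A (0\<^sub>m n m) (0\<^sub>m m n) D * four_block_mat A' (0\<^sub>m n m) (0\<^sub>m m n) D'
    = four_block_mat (A * A') (0\<^sub>m n m) (0\<^sub>m m n) (D * D')"
  using assms by (auto simp: mult_four_block_mat[of _ n n _ m _ m _ _ n _ m])

lemma quadratic_block_diag:
  fixes A D :: "'a::field mat"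
  assumes "A \<in> carrier_mat n n" "D \<in> carrier_mat m m"
  shows "q \<cdot>\<^sub>m four_block_mat A (0\<^sub>m n m) (0\<^sub>m m n) D + p \<cdot>\<^sub>m 1\<^sub>m (n + m)
    = four_block_mat (q \<cdot>\<^sub>m A + p \<cdot>\<^sub>m 1\<^sub>m n) (0\<^sub>m n m) (0\<^sub>m m n) (q \<cdot>\<^sub>m D + p \<cdot>\<^sub>m 1\<^sub>m m)"
  using assms by (intro eq_matI) auto

text \<open>The test vector adds an arbitrary \<open>x\<close> from the complement to the cyclic
  generator of the split block. Its three iterates are dependent, and the two coordinates in the
  block force this dependence to be the polynomial of the block; read in the complement, it shows
  that \<open>D\<close> satisfies the same polynomial.\<close>

lemma locally_quadratic:
  fixes A :: "'a::field mat"
  assumes A: "A \<in> carrier_mat n n" and ind: "krylov_indep A v 2"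
    and max: "\<And>w. \<not> krylov_indep A w 3"
  shows "\<exists>p q. A * A = q \<cdot>\<^sub>m A + p \<cdot>\<^sub>m 1\<^sub>m n"
proof -
  obtain c D where n: "2 \<le> n" and c: "c \<in> carrier_vec 2" and D: "D \<in> carrier_mat (n - 2) (n - 2)"
    and sim: "similar_mat A (four_block_mat (comp_mat 2 c) (0\<^sub>m 2 (n - 2)) (0\<^sub>m (n - 2) 2) D)"
    using cyclic_split[OF A ind] max by (auto simp: numeral_3_eq_3 numeral_2_eq_2)
  define B where "B = four_block_mat (comp_mat 2 c) (0\<^sub>m 2 (n - 2)) (0\<^sub>m (n - 2) 2) D"
  have B: "B \<in> carrier_mat n n"
    using four_block_carrier_mat[OF comp_mat_carrier D, of 2 c] n unfolding B_def
    by (metis le_add_diff_inverse)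
  let ?p = "c $ 0" and ?q = "c $ 1"
  have Bx: "B *\<^sub>v (a @\<^sub>v x) = (comp_mat 2 c *\<^sub>v a) @\<^sub>v (D *\<^sub>v x)"
    if "a \<in> carrier_vec 2" "x \<in> carrier_vec (n - 2)" for a x
  proof -
    have 0: "0\<^sub>m k l *\<^sub>v y = 0\<^sub>v k" if "y \<in> carrier_vec l" for k l and y :: "'a vec"
      using that by (intro eq_vecI) auto
    have "comp_mat 2 c *\<^sub>v a \<in> carrier_vec 2" "D *\<^sub>v x \<in> carrier_vec (n - 2)"
      using that D mult_mat_vec_carrier[OF comp_mat_carrier, of a 2 c] by auto
    then show ?thesis
      unfolding B_def four_block_mat_mult_vec[OF comp_mat_carrier zero_carrier_mat zero_carrier_mat D that]
      by (simp add: 0 that)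
  qed
  have Dx: "(D *\<^sub>v (D *\<^sub>v x)) $ i = ?q * (D *\<^sub>v x) $ i + ?p * x $ i"
    if x: "x \<in> carrier_vec (n - 2)" and i: "i < n - 2" for x i
  proof -
    let ?e = "unit_vec 2 0 :: 'a vec"
    have Ce: "comp_mat 2 c *\<^sub>v ?e = unit_vec 2 1"
      by (intro eq_vecI) (auto simp: comp_mat_def less_2_cases_iff)
    have CCe: "comp_mat 2 c *\<^sub>v unit_vec 2 1 = c"
      using c by (intro eq_vecI) (auto simp: comp_mat_def less_2_cases_iff)
    have ex: "?e @\<^sub>v x \<in> carrier_vec n"
      using append_carrier_vec[OF unit_vec_carrier x, of 2 0] n by (metis le_add_diff_inverse)
    have "\<not> krylov_indep B (?e @\<^sub>v x) 3"
      using krylov_indep_similar[OF sim[folded B_def] A] max by blast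
    then obtain r s t where nz: "\<not> (r = 0 \<and> s = 0 \<and> t = 0)"
      and rel: "\<And>i. i < n \<Longrightarrow> r * (?e @\<^sub>v x) $ i + s * (B *\<^sub>v (?e @\<^sub>v x)) $ i + t * (B *\<^sub>v (B *\<^sub>v (?e @\<^sub>v x))) $ i = 0"
      using krylov_indep_3I[OF B ex] by blast
    have B1: "B *\<^sub>v (?e @\<^sub>v x) = unit_vec 2 1 @\<^sub>v (D *\<^sub>v x)" using Bx[of ?e x] x Ce by simp
    have B2: "B *\<^sub>v (B *\<^sub>v (?e @\<^sub>v x)) = c @\<^sub>v (D *\<^sub>v (D *\<^sub>v x))"
      unfolding B1 using Bx[of "unit_vec 2 1" "D *\<^sub>v x"] x D CCe by simp
    note rel = rel[unfolded B2, unfolded B1]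
    have "r + t * ?p = 0" using rel[of 0] n x c D by simp
    moreover have "s + t * ?q = 0" using rel[of 1] n x c D by simp
    moreover have "r * x $ i + s * (D *\<^sub>v x) $ i + t * (D *\<^sub>v (D *\<^sub>v x)) $ i = 0"
      using rel[of "i + 2"] n x c D i by simp
    moreover have "w = q * z + p * y"
      if "r + t * p = 0" "s + t * q = 0" "r * y + s * z + t * w = 0" for p q y z w :: 'a
    proof -
      have "t * (w - (q * z + p * y)) = (r * y + s * z + t * w) - (r + t * p) * y - (s + t * q) * z"
        by (simp add: algebra_simps)
      moreover have "t \<noteq> 0" using that nz by auto
      ultimately show ?thesis using that by simp
    qed
    ultimately show ?thesis by blast
  qed
  have DD: "D * D = ?q \<cdot>\<^sub>m D + ?p \<cdot>\<^sub>m 1\<^sub>m (n - 2)"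
  proof (rule eq_matI)
    fix i j assume "i < dim_row (?q \<cdot>\<^sub>m D + ?p \<cdot>\<^sub>m 1\<^sub>m (n - 2))" "j < dim_col (?q \<cdot>\<^sub>m D + ?p \<cdot>\<^sub>m 1\<^sub>m (n - 2))"
    then have ij: "i < n - 2" "j < n - 2" using D by auto
    have "col D j = D *\<^sub>v unit_vec (n - 2) j"
      using ij D by (intro eq_vecI) auto
    then have "(D * D) $$ (i, j) = (D *\<^sub>v (D *\<^sub>v unit_vec (n - 2) j)) $ i"
      using ij D by simp
    then show "(D * D) $$ (i, j) = (?q \<cdot>\<^sub>m D + ?p \<cdot>\<^sub>m 1\<^sub>m (n - 2)) $$ (i, j)"
      using Dx[of "unit_vec (n - 2) j" i] ij D by simp
  qed (use D in auto)
  have CC: "comp_mat 2 c * comp_mat 2 c = ?q \<cdot>\<^sub>m comp_mat 2 c + ?p \<cdot>\<^sub>m 1\<^sub>m 2"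
    by (intro eq_matI) (auto simp: comp_mat_def scalar_prod_def less_Suc_eq numeral_2_eq_2)
  have "B * B = ?q \<cdot>\<^sub>m B + ?p \<cdot>\<^sub>m 1\<^sub>m n"
  proof -
    have "B * B = four_block_mat (comp_mat 2 c * comp_mat 2 c) (0\<^sub>m 2 (n - 2)) (0\<^sub>m (n - 2) 2) (D * D)"
      unfolding B_def
      using mult_block_diag[OF comp_mat_carrier comp_mat_carrier D D] .
    also have "\<dots> = ?q \<cdot>\<^sub>m B + ?p \<cdot>\<^sub>m 1\<^sub>m (2 + (n - 2))"
      unfolding DD CC B_def by (rule quadratic_block_diag[OF comp_mat_carrier D, symmetric])
    also have "2 + (n - 2) = n" using n by simp
    finally show ?thesis .
  qed
  then show ?thesis using similar_mat_quadratic[OF similar_mat_sym[OF sim[folded B_def]] B] by blast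
qed

section \<open>Three idempotents\<close>

lemma idem_comb_zero: "idem_comb n cs (0\<^sub>m n n)"
  by (induction cs) (auto intro: idem_comb_skip)

text \<open>For a cyclic matrix of size 2 the diagonal is constrained by the trace alone; the entry
  in position \<open>(0, 1)\<close> absorbs the determinant.\<close>

lemma comp_mat_2_similar:
  fixes a b :: "'a::field"
  assumes "a + b = c $ 1"
  shows "\<exists>N. N \<in> carrier_mat 2 2 \<and> similar_mat (comp_mat 2 c) N \<and>
    N $$ (0, 0) = a \<and> N $$ (1, 1) = b \<and> N $$ (1, 0) = 1"
proof -
  define m where "m = (\<lambda>i j :: nat. if j = 1 then c $ i else 0)"
  define t where "t = (\<lambda>i j :: nat. if i = j then if i = 0 then a else b else 0)"
  have m: "comp_mat 2 c = hess_mat 2 m"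
    by (intro eq_matI) (auto simp: comp_mat_def hess_mat_def m_def less_Suc_eq numeral_2_eq_2)
  have free: "\<exists>r. True \<and> r + g < 2" if "0 < g" "g < 2" for g :: nat
    using that by (intro exI[of _ 0]) simp
  have "(\<Sum>i<2. t i i) = (\<Sum>i<2. m i i)"
    using assms by (simp add: t_def m_def numeral_2_eq_2)
  then obtain m' where m': "hess_poly m' 2 = hess_poly m 2" "\<And>i j. m' i j \<noteq> t i j \<Longrightarrow> i < j"
    using hess_poly_prescribe[of 2 "\<lambda>_ _. True" t m] free by metis
  have m't: "m' i i = t i i" for i using m'(2)[of i i] by auto
  have "similar_mat (comp_mat 2 c) (hess_mat 2 m')"
    unfolding m using hess_mat_similar[of m 2 m'] m'(1) by simp
  then show ?thesis
    by (intro exI[of _ "hess_mat 2 m'"]) (auto simp: hess_mat_def m't t_def)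
qed

lemma comp_mat_2_idem_comb:
  fixes a b :: "'a::field"
  assumes "a \<noteq> 0" "b \<noteq> 0" "a + b = c $ 1"
  shows "idem_comb 2 [a, b] (comp_mat 2 c)"
proof -
  obtain N where N: "N \<in> carrier_mat 2 2" "similar_mat (comp_mat 2 c) N" "N $$ (0, 0) = a" "N $$ (1, 1) = b"
    using comp_mat_2_similar[OF assms(3)] by blast
  have "idem_comb 2 [a, b] N"
    by (rule idem_comb_2_rowsI[of _ _ _ _ "\<lambda>i. i = 0" "\<lambda>i. i = 1"]) (use assms N in auto)
  then show ?thesis by (rule idem_comb_similar[OF N(2)])
qed

text \<open>Subtracting \<open>x\<close> in the corner changes the diagonal from
  \<open>0, c $ 1\<close> to \<open>- x, c $ 1\<close>, so two nonzero diagonal entries arise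
  without any relation between \<open>x\<close> and the trace.\<close>

lemma comp_mat_2_idem_comb_3:
  fixes x :: "'a::field"
  assumes "x \<noteq> 0" "c $ 1 \<noteq> 0"
  shows "idem_comb 2 [x, - x, c $ 1] (comp_mat 2 c)"
proof -
  define R where "R = mat 2 2 (\<lambda>(i, j). if i = 0 \<and> j = 0 then 1 else (0 :: 'a))"
  have "idempotent_mat 2 R"
    by (rule idempotent_rowsI[of _ _ "\<lambda>i. i = 0"]) (auto simp: R_def)
  moreover have "idem_comb 2 [- x, c $ 1] (comp_mat 2 c - x \<cdot>\<^sub>m R)"
    by (rule idem_comb_2_rowsI[of _ _ _ _ "\<lambda>i. i = 0" "\<lambda>i. i = 1"])
      (use assms in \<open>auto simp: R_def comp_mat_def intro!: minus_carrier_mat\<close>)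
  moreover have "comp_mat 2 c = (comp_mat 2 c - x \<cdot>\<^sub>m R) + x \<cdot>\<^sub>m R"
    by (intro eq_matI) (auto simp: R_def comp_mat_def)
  ultimately show ?thesis unfolding idem_comb.simps(2)[of 2 x] by blast
qed

lemma smult_mat_mult_vec:
  fixes M :: "'a::field mat"
  assumes "M \<in> carrier_mat n m" "w \<in> carrier_vec m"
  shows "(a \<cdot>\<^sub>m M) *\<^sub>v w = a \<cdot>\<^sub>v (M *\<^sub>v w)"
  by (intro eq_vecI) (use assms in \<open>auto simp: scalar_prod_def sum_distrib_left mult.assoc\<close>)

text \<open>Every cyclic block that splits off is the companion matrix of the same polynomial, and a
  scalar remainder is one of its roots. Hence a list that serves these two kinds of blocks serves
  \<open>A\<close>.\<close>

lemma quadratic_idem_comb: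
  fixes A :: "'a::field mat"
  assumes A: "A \<in> carrier_mat n n" and AA: "A * A = q \<cdot>\<^sub>m A + p \<cdot>\<^sub>m 1\<^sub>m n"
    and comp: "\<And>c. c $ 0 = p \<Longrightarrow> c $ 1 = q \<Longrightarrow> idem_comb 2 cs (comp_mat 2 c)"
    and root: "\<And>x n. x * x = q * x + p \<Longrightarrow> idem_comb n cs (x \<cdot>\<^sub>m 1\<^sub>m n)"
  shows "idem_comb n cs A"
  using A AA
proof (induction n arbitrary: A rule: less_induct)
  case (less n)
  note A = less.prems(1) and AA = less.prems(2)
  from scalar_or_krylov_indep[OF A] show ?case
  proof
    assume "\<exists>x. A = x \<cdot>\<^sub>m 1\<^sub>m n"
    then obtain x where x: "A = x \<cdot>\<^sub>m 1\<^sub>m n" by blast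
    show ?thesis
    proof (cases "n = 0")
      case True
      then have "A = 0\<^sub>m n n" using A by (intro eq_matI) auto
      then show ?thesis using idem_comb_zero by simp
    next
      case False
      have "A * A = x \<cdot>\<^sub>m A"
        using A mult_smult_assoc_mat[of "1\<^sub>m n" n n A n x] by (simp flip: x)
      then have 1: "(A * A) $$ (0, 0) = x * x" using False by (simp add: x)
      have 2: "(A * A) $$ (0, 0) = q * x + p" by (simp only: AA) (use False in \<open>simp add: x\<close>)
      have "x * x = q * x + p" using 1 2 by (rule trans[OF sym])
      then show ?thesis using root[of x n] x by simp
    qed
  next
    assume "\<exists>v. krylov_indep A v 2"
    then obtain v where v: "krylov_indep A v 2" by blast
    have max: "\<not> krylov_indep A w (Suc 2)" for w
    proof
      assume ind: "krylov_indep A w (Suc 2)"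
      then have w: "w \<in> carrier_vec n" using A by (simp add: krylov_indep_def)
      define e where "e = vec 3 (\<lambda>i. if i = 0 then - p else if i = 1 then - q else 1)"
      have AAw: "(A *\<^sub>v (A *\<^sub>v w)) $ i = q * (A *\<^sub>v w) $ i + p * w $ i" if "i < n" for i
      proof -
        have "A *\<^sub>v (A *\<^sub>v w) = (A * A) *\<^sub>v w" using A w by simp
        also have "\<dots> = q \<cdot>\<^sub>v (A *\<^sub>v w) + p \<cdot>\<^sub>v w"
          unfolding AA using A w smult_mat_mult_vec[OF A w, of q] smult_mat_mult_vec[OF one_carrier_mat w, of p]
          by (subst add_mult_distrib_mat_vec[of _ n n]) auto
        finally show ?thesis using that A w by simp
      qed
      have "krylov A w 3 *\<^sub>v e = 0\<^sub>v n"
      proof (rule eq_vecI)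
        fix i assume "i < dim_vec (0\<^sub>v n)"
        then have i: "i < n" by simp
        have "(krylov A w 3 *\<^sub>v e) $ i = - p * w $ i + - q * (A *\<^sub>v w) $ i + (A *\<^sub>v (A *\<^sub>v w)) $ i"
          using i A w by (simp add: krylov_def scalar_prod_def numeral_3_eq_3 numeral_2_eq_2 e_def)
        then show "(krylov A w 3 *\<^sub>v e) $ i = 0\<^sub>v n $ i" using i AAw[OF i] by simp
      qed (use A in \<open>simp add: krylov_def\<close>)
      moreover have "e \<in> carrier_vec 3" by (simp add: e_def)
      ultimately have "e = 0\<^sub>v 3"
        using ind A unfolding krylov_indep_def trivial_kernel_def by (auto simp: krylov_def numeral_3_eq_3 numeral_2_eq_2)
      then have "e $ 2 = 0" by simp
      then show False by (simp add: e_def)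
    qed
    obtain c D where n: "2 \<le> n" and c: "c \<in> carrier_vec 2" and D: "D \<in> carrier_mat (n - 2) (n - 2)"
      and sim: "similar_mat A (four_block_mat (comp_mat 2 c) (0\<^sub>m 2 (n - 2)) (0\<^sub>m (n - 2) 2) D)"
      using cyclic_split[OF A v _ max] by auto
    let ?C = "comp_mat 2 c"
    define B where "B = four_block_mat ?C (0\<^sub>m 2 (n - 2)) (0\<^sub>m (n - 2) 2) D"
    have B2: "B * B = four_block_mat (?C * ?C) (0\<^sub>m 2 (n - 2)) (0\<^sub>m (n - 2) 2) (D * D)"
      unfolding B_def
      using mult_block_diag[OF comp_mat_carrier comp_mat_carrier D D] .
    have Bc: "B \<in> carrier_mat n n"
      using four_block_carrier_mat[OF comp_mat_carrier D, of 2 c] n unfolding B_def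
      by (metis le_add_diff_inverse)
    have Bq: "B * B = q \<cdot>\<^sub>m B + p \<cdot>\<^sub>m 1\<^sub>m n"
      using similar_mat_quadratic[OF sim[folded B_def] A AA] .
    have 1: "(B * B) $$ (i, j) = q * B $$ (i, j) + (if i = j then p else 0)" if "i < n" "j < n" for i j
      unfolding Bq using that Bc by simp
    have "c $ 0 = p"
      using 1[of 0 0] n D unfolding B2
      by (simp add: B_def comp_mat_def scalar_prod_def numeral_2_eq_2)
    moreover have "c $ 1 = q"
      using 1[of 1 0] n D unfolding B2
      by (simp add: B_def comp_mat_def scalar_prod_def numeral_2_eq_2)
    ultimately have "idem_comb 2 cs ?C" by (rule comp)
    moreover have "D * D = q \<cdot>\<^sub>m D + p \<cdot>\<^sub>m 1\<^sub>m (n - 2)"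
    proof (rule eq_matI)
      fix i j assume "i < dim_row (q \<cdot>\<^sub>m D + p \<cdot>\<^sub>m 1\<^sub>m (n - 2))" "j < dim_col (q \<cdot>\<^sub>m D + p \<cdot>\<^sub>m 1\<^sub>m (n - 2))"
      then have ij: "i < n - 2" "j < n - 2" by auto
      have "(D * D) $$ (i, j) = (B * B) $$ (i + 2, j + 2)"
        unfolding B2 using ij D by (simp add: comp_mat_def)
      also have "\<dots> = q * B $$ (i + 2, j + 2) + (if i = j then p else 0)"
        using 1[of "i + 2" "j + 2"] ij by simp
      also have "\<dots> = (q \<cdot>\<^sub>m D + p \<cdot>\<^sub>m 1\<^sub>m (n - 2)) $$ (i, j)"
        using ij D by (simp add: B_def comp_mat_def)
      finally show "(D * D) $$ (i, j) = (q \<cdot>\<^sub>m D + p \<cdot>\<^sub>m 1\<^sub>m (n - 2)) $$ (i, j)" .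
    qed (use D in auto)
    then have "idem_comb (n - 2) cs D" using less.IH[OF _ D] n by simp
    ultimately have "idem_comb (2 + (n - 2)) cs B" unfolding B_def by (rule idem_comb_block)
    then have "idem_comb n cs B" using n by (simp only: le_add_diff_inverse)
    then show ?thesis using idem_comb_similar[OF sim[folded B_def]] by blast
  qed
qed

text \<open>With coefficient sum \<open>q\<close> each companion block of \<open>X\<^sup>2 - q X - p\<close> is a combination of two
  idempotents, but over the two-element field \<open>q = 1\<close> is not such a sum; hence \<open>[x, -x, q]\<close>.\<close>

lemma quadratic_three_idempotents:
  fixes A :: "'a::field mat"
  assumes A: "A \<in> carrier_mat n n" and AA: "A * A = q \<cdot>\<^sub>m A + p \<cdot>\<^sub>m 1\<^sub>m n"
  shows "\<exists>cs. length cs = 3 \<and> idem_comb n cs A"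
proof -
  \<comment> \<open>A nonzero root if there is one, and otherwise 1 so as to be a nonzero
    coefficient. Since the two roots have the sum \<open>q\<close>, every root lies in
    \<open>{0, x, q - x}\<close>, and these are subset sums of both lists used below.\<close>
  define x where "x = (if \<exists>x\<noteq>0. x * x = q * x + p then SOME x. x \<noteq> 0 \<and> x * x = q * x + p else 1)"
  have x: "x \<noteq> 0 \<and> ((\<exists>x\<noteq>0. x * x = q * x + p) \<longrightarrow> x * x = q * x + p)"
    using someI_ex[of "\<lambda>x. x \<noteq> 0 \<and> x * x = q * x + p"] by (auto simp: x_def)
  have roots: "y \<in> {0, x, q - x}" if y: "y * y = q * y + p" for y
  proof (cases "y = 0")
    case False
    then have "x * x = q * x + p" using x y by blast
    moreover have "(y - x) * (y - (q - x)) = (y * y - q * y) - (x * x - q * x)"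
      by (simp add: algebra_simps)
    ultimately have "(y - x) * (y - (q - x)) = 0" using y by simp
    then show ?thesis by auto
  qed simp
  show ?thesis
  proof (cases "q = 0")
    case True
    have "idem_comb n [1, x, - x] A"
    proof (rule quadratic_idem_comb[OF A AA])
      fix c :: "'a vec" assume "c $ 0 = p" "c $ 1 = q"
      then show "idem_comb 2 [1, x, - x] (comp_mat 2 c)"
        using idem_comb_skip[OF comp_mat_2_idem_comb[of x "- x" c]] x True by auto
    next
      fix y n assume "y * y = q * y + p"
      then show "idem_comb n [1, x, - x] (y \<cdot>\<^sub>m 1\<^sub>m n)"
        using roots[of y] True by (intro idem_comb_scalar) auto
    qed
    then show ?thesis by (intro exI[of _ "[1, x, - x]"]) auto
  next
    case False
    have "idem_comb n [x, - x, q] A"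
    proof (rule quadratic_idem_comb[OF A AA])
      fix c :: "'a vec" assume "c $ 0 = p" "c $ 1 = q"
      then show "idem_comb 2 [x, - x, q] (comp_mat 2 c)"
        using comp_mat_2_idem_comb_3[of x c] x False by auto
    next
      fix y n assume "y * y = q * y + p"
      then show "idem_comb n [x, - x, q] (y \<cdot>\<^sub>m 1\<^sub>m n)"
        using roots[of y] by (intro idem_comb_scalar) auto
    qed
    then show ?thesis by (intro exI[of _ "[x, - x, q]"]) auto
  qed
qed

lemma three_idempotents:
  fixes A :: "'a::field mat"
  assumes A: "A \<in> carrier_mat n n"
  shows "is_lincomb_of_idempotents n 3 A"
  unfolding is_lincomb_iff
proof (cases "\<exists>v. krylov_indep A v 3")
  case True
  then obtain h H x where h: "h \<le> n" "good_hess h H" "h \<ge> 3" "H $$ (2, 1) = 1"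
    and sim: "similar_mat A (four_block_mat H (0\<^sub>m h (n - h)) (0\<^sub>m (n - h) h) (x \<cdot>\<^sub>m 1\<^sub>m (n - h)))"
    using hess_form[OF A] by blast
  \<comment> \<open>The coefficient \<open>c\<close> produces the scalar block by itself through the
    identity. For \<open>x = 0\<close> that block needs nothing, and any nonzero \<open>c\<close>
    suits \<open>H\<close>.\<close>
  define c where "c = (if x = 0 then 1 else x)"
  have "c \<noteq> 0" by (simp add: c_def)
  then obtain a b where ab: "idem_comb h [c, a, b] H"
    using good_hess_idem_comb[OF h(2,3,4)] by blast
  have "idem_comb (n - h) [c, a, b] (x \<cdot>\<^sub>m 1\<^sub>m (n - h))"
    by (rule idem_comb_scalar) (simp add: c_def)
  from idem_comb_block[OF ab this] have "idem_comb n [c, a, b]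
    (four_block_mat H (0\<^sub>m h (n - h)) (0\<^sub>m (n - h) h) (x \<cdot>\<^sub>m 1\<^sub>m (n - h)))"
    using h(1) by (simp only: le_add_diff_inverse)
  then have "idem_comb n [c, a, b] A" by (rule idem_comb_similar[OF sim])
  then show "\<exists>cs. length cs = 3 \<and> idem_comb n cs A" by (intro exI[of _ "[c, a, b]"]) auto
next
  case False
  from scalar_or_krylov_indep[OF A] show "\<exists>cs. length cs = 3 \<and> idem_comb n cs A"
  proof
    assume "\<exists>x. A = x \<cdot>\<^sub>m 1\<^sub>m n"
    then obtain x where "A = x \<cdot>\<^sub>m 1\<^sub>m n" by blast
    then have "idem_comb n [x, 1, 1] A" using idem_comb_scalar[of x 1 1 x n] by simp
    then show ?thesis by (intro exI[of _ "[x, 1, 1]"]) auto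
  next
    assume "\<exists>v. krylov_indep A v 2"
    then obtain p q where "A * A = q \<cdot>\<^sub>m A + p \<cdot>\<^sub>m 1\<^sub>m n"
      using locally_quadratic[OF A] False by blast
    then show ?thesis using quadratic_three_idempotents[OF A] by blast
  qed
qed

section \<open>Matrices that need three idempotents\<close>

lemma trace_mult_commute:
  fixes X Y :: "'a::field mat"
  assumes "X \<in> carrier_mat n n" "Y \<in> carrier_mat n n"
  shows "(\<Sum>i<n. (X * Y) $$ (i, i)) = (\<Sum>i<n. (Y * X) $$ (i, i))"
proof -
  have "(\<Sum>i<n. (X * Y) $$ (i, i)) = (\<Sum>i<n. \<Sum>j<n. X $$ (i, j) * Y $$ (j, i))"
    using assms by (auto simp: scalar_prod_def atLeast0LessThan intro!: sum.cong)
  also have "\<dots> = (\<Sum>j<n. \<Sum>i<n. X $$ (i, j) * Y $$ (j, i))" by (rule sum.swap)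
  also have "\<dots> = (\<Sum>j<n. (Y * X) $$ (j, j))"
    using assms by (auto simp: scalar_prod_def atLeast0LessThan mult.commute intro!: sum.cong)
  finally show ?thesis .
qed

lemma trace_similar:
  fixes A :: "'a::field mat"
  assumes "similar_mat A B" "A \<in> carrier_mat n n"
  shows "(\<Sum>i<n. A $$ (i, i)) = (\<Sum>i<n. B $$ (i, i))"
proof -
  obtain P Q where "similar_mat_wit A B P Q"
    using assms(1) unfolding similar_mat_def by blast
  note w = similar_mat_witD2[OF assms(2) this]
  have "(\<Sum>i<n. A $$ (i, i)) = (\<Sum>i<n. (P * (B * Q)) $$ (i, i))"
    using w by (simp add: assoc_mult_mat[of _ n n _ n _ n])
  also have "\<dots> = (\<Sum>i<n. ((B * Q) * P) $$ (i, i))"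
    using w by (intro trace_mult_commute) auto
  also have "(B * Q) * P = B" using w by (simp add: assoc_mult_mat[of _ n n _ n _ n])
  finally show ?thesis .
qed

lemma infinite_of_every_cubic_has_root:
  assumes "every_cubic_has_root TYPE('a::field)"
  shows "infinite (UNIV :: 'a set)"
proof
  assume fin: "finite (UNIV :: 'a set)"
  let ?f = "\<lambda>x :: 'a. x ^ 3 - x"
  \<comment> \<open>0 and 1 have the same image. On a finite field a map that is not injective
    misses some value \<open>c\<close>, and then \<open>X^3 - X - c\<close> is a cubic without
    roots.\<close>
  have "\<not> inj ?f" using inj_onD[of ?f UNIV 0 1] by auto
  then have "\<not> surj ?f" using finite_UNIV_surj_inj[OF fin] by blast
  then obtain c :: 'a where c: "\<forall>x. c \<noteq> x ^ 3 - x" unfolding surj_def by blast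
  have "degree [:- c, - 1, 0, 1:] = 3" by simp
  then obtain x where "poly [:- c, - 1, 0, 1:] x = 0"
    using assms[unfolded every_cubic_has_root_def, rule_format] by blast
  then have "c = x ^ 3 - x" by (simp add: algebra_simps power3_eq_cube)
  then show False using c by simp
qed

section \<open>Pairs of idempotents and their common eigenvectors\<close>

lemma idem_comb_2D:
  assumes "idem_comb n [a, b] (A :: 'a::field mat)"
  obtains P Q where "P \<in> carrier_mat n n" "Q \<in> carrier_mat n n" "P * P = P" "Q * Q = Q"
    "A = a \<cdot>\<^sub>m P + b \<cdot>\<^sub>m Q"
proof -
  obtain P Q where PQ: "idempotent_mat n P" "idempotent_mat n Q" and A: "A = (0\<^sub>m n n + b \<cdot>\<^sub>m Q) + a \<cdot>\<^sub>m P"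
    using assms by (auto simp: idem_comb.simps)
  then have "A = a \<cdot>\<^sub>m P + b \<cdot>\<^sub>m Q"
    unfolding A by (intro eq_matI) (auto simp: idempotent_mat_def)
  then show ?thesis using that PQ by (auto simp: idempotent_mat_def)
qed

lemma common_eigenvector_lincomb:
  fixes P Q :: "'a::field mat"
  assumes P: "P \<in> carrier_mat n n" and Q: "Q \<in> carrier_mat n n" and x: "x \<in> carrier_vec n"
    and Px: "P *\<^sub>v x \<in> {0\<^sub>v n, x}" and Qx: "Q *\<^sub>v x \<in> {0\<^sub>v n, x}"
  shows "\<exists>y. (a \<cdot>\<^sub>m P + b \<cdot>\<^sub>m Q) *\<^sub>v x = y \<cdot>\<^sub>v x"
proof -
  have "\<exists>u. y = u \<cdot>\<^sub>v x" if "y \<in> {0\<^sub>v n, x}" for y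
  proof (cases "y = x")
    case False
    then have "y = 0 \<cdot>\<^sub>v x" using that x by (intro eq_vecI) auto
    then show ?thesis by blast
  qed (auto intro: exI[of _ 1])
  then obtain u w where u: "P *\<^sub>v x = u \<cdot>\<^sub>v x" and w: "Q *\<^sub>v x = w \<cdot>\<^sub>v x"
    using Px Qx by blast
  have "(a \<cdot>\<^sub>m P + b \<cdot>\<^sub>m Q) *\<^sub>v x = a \<cdot>\<^sub>v (P *\<^sub>v x) + b \<cdot>\<^sub>v (Q *\<^sub>v x)"
    using P Q x smult_mat_mult_vec[OF P x] smult_mat_mult_vec[OF Q x]
    by (subst add_mult_distrib_mat_vec[of _ n n]) auto
  also have "\<dots> = (a * u + b * w) \<cdot>\<^sub>v x"
    unfolding u w using x by (intro eq_vecI) (auto simp: algebra_simps)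
  finally show ?thesis by blast
qed

lemma det_uminus_mat:
  fixes A :: "'a::field mat"
  assumes "A \<in> carrier_mat n n"
  shows "det (- A) = (- 1) ^ n * det A"
proof -
  have "- A = (- 1) \<cdot>\<^sub>m A" by (intro eq_matI) auto
  then show ?thesis using assms by simp
qed

text \<open>Without a common eigenvector \<open>E = P - Q\<close> and \<open>F = P + Q - 1\<close> are invertible; they
  anticommute and intertwine \<open>P\<close> with \<open>1 - Q\<close> and with \<open>Q\<close>.\<close>

lemma idempotents_no_common_eigenvector:
  fixes P Q :: "'a::field mat"
  assumes P: "P \<in> carrier_mat n n" "P * P = P" and Q: "Q \<in> carrier_mat n n" "Q * Q = Q"
    and no: "\<And>x. x \<in> carrier_vec n \<Longrightarrow> P *\<^sub>v x \<in> {0\<^sub>v n, x} \<Longrightarrow> Q *\<^sub>v x \<in> {0\<^sub>v n, x} \<Longrightarrow> x = 0\<^sub>v n"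
  shows "(\<Sum>i<n. P $$ (i, i)) = (\<Sum>i<n. Q $$ (i, i))"
    and "(\<Sum>i<n. P $$ (i, i)) + (\<Sum>i<n. Q $$ (i, i)) = of_nat n"
    and "odd n \<Longrightarrow> (2 :: 'a) = 0"
proof -
  define E where "E = P - Q"
  define F where "F = P + Q - 1\<^sub>m n"
  have E: "E \<in> carrier_mat n n" and F: "F \<in> carrier_mat n n" using P Q by (auto simp: E_def F_def)
  have PPx: "P *\<^sub>v (P *\<^sub>v x) = P *\<^sub>v x" and QQx: "Q *\<^sub>v (Q *\<^sub>v x) = Q *\<^sub>v x" if "x \<in> carrier_vec n" for x
    using assoc_mult_mat_vec[OF P(1) P(1) that] assoc_mult_mat_vec[OF Q(1) Q(1) that] P Q by simp_all
  \<comment> \<open>If \<open>E x = 0\<close>, then \<open>P x = Q x\<close> is fixed by both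
    idempotents, hence zero; then \<open>x\<close> is killed by both and is zero too.\<close>
  have "trivial_kernel E"
    unfolding trivial_kernel_def
  proof (intro ballI impI)
    fix x assume "x \<in> carrier_vec (dim_col E)" and "E *\<^sub>v x = 0\<^sub>v (dim_row E)"
    then have x: "x \<in> carrier_vec n" and "E *\<^sub>v x = 0\<^sub>v n" using E by auto
    then have Ex: "P *\<^sub>v x - Q *\<^sub>v x = 0\<^sub>v n"
      using minus_mult_distrib_mat_vec[OF P(1) Q(1) x] by (simp add: E_def)
    have eq: "P *\<^sub>v x = Q *\<^sub>v x"
    proof (rule eq_vecI)
      fix i assume "i < dim_vec (Q *\<^sub>v x)"
      then have i: "i < n" using Q by simp
      have "(P *\<^sub>v x - Q *\<^sub>v x) $ i = 0" using Ex i by simp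
      then show "(P *\<^sub>v x) $ i = (Q *\<^sub>v x) $ i" using i P Q by simp
    qed (use P Q in simp)
    have "P *\<^sub>v x = 0\<^sub>v n" using no[of "P *\<^sub>v x"] PPx[OF x] QQx[OF x] eq P(1) Q(1) x by simp
    then show "x = 0\<^sub>v (dim_col E)" using no[of x] eq x E by simp
  qed
  then have dE: "det E \<noteq> 0" using det_nonzero_iff_trivial_kernel[OF E] by simp
  \<comment> \<open>If \<open>F x = 0\<close>, then \<open>P x + Q x = x\<close>, and applying
    \<open>P\<close> gives \<open>P Q x = 0\<close>. So \<open>Q x\<close> is killed by
    \<open>P\<close> and fixed by \<open>Q\<close>, hence zero, which leaves \<open>x\<close> fixed
    by \<open>P\<close> and killed by \<open>Q\<close>.\<close>
  have "trivial_kernel F"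
    unfolding trivial_kernel_def
  proof (intro ballI impI)
    fix x assume "x \<in> carrier_vec (dim_col F)" and "F *\<^sub>v x = 0\<^sub>v (dim_row F)"
    then have x: "x \<in> carrier_vec n" and "F *\<^sub>v x = 0\<^sub>v n" using F by auto
    moreover have "F *\<^sub>v x = P *\<^sub>v x + Q *\<^sub>v x - x"
      unfolding F_def using minus_mult_distrib_mat_vec[of "P + Q" n n "1\<^sub>m n" x]
        add_mult_distrib_mat_vec[OF P(1) Q(1) x] P Q x by simp
    ultimately have Fx: "P *\<^sub>v x + Q *\<^sub>v x - x = 0\<^sub>v n" by simp
    have eq: "P *\<^sub>v x + Q *\<^sub>v x = x"
    proof (rule eq_vecI)
      fix i assume "i < dim_vec x"
      then have i: "i < n" using x by simp
      have "(P *\<^sub>v x + Q *\<^sub>v x - x) $ i = 0" using Fx i by simp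
      then show "(P *\<^sub>v x + Q *\<^sub>v x) $ i = x $ i" using i P Q x by simp
    qed (use P Q x in simp)
    have "P *\<^sub>v x + P *\<^sub>v (Q *\<^sub>v x) = P *\<^sub>v x"
      using arg_cong[OF eq, of "\<lambda>y. P *\<^sub>v y"] mult_add_distrib_mat_vec[OF P(1), of "P *\<^sub>v x" "Q *\<^sub>v x"]
        PPx[OF x] P Q x by simp
    then have PQ0: "(P *\<^sub>v (Q *\<^sub>v x)) $ i = 0" if i: "i < n" for i
      using i P index_add_vec(1)[of i "P *\<^sub>v (Q *\<^sub>v x)" "P *\<^sub>v x"]
      by (metis add_cancel_right_right carrier_matD(1) dim_mult_mat_vec)
    have "P *\<^sub>v (Q *\<^sub>v x) = 0\<^sub>v n"
      by (rule eq_vecI) (use PQ0 P in auto)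
    then have Qx: "Q *\<^sub>v x = 0\<^sub>v n" using no[of "Q *\<^sub>v x"] QQx[OF x] Q x by simp
    then have "P *\<^sub>v x = x" using eq right_zero_vec[of "P *\<^sub>v x" n] P x by simp
    then show "x = 0\<^sub>v (dim_col F)" using no[of x] Qx x F by simp
  qed
  then have dF: "det F \<noteq> 0" using det_nonzero_iff_trivial_kernel[OF F] by simp
  have PQ: "P * Q \<in> carrier_mat n n" "Q * P \<in> carrier_mat n n" using P Q by auto
  have cancel: "X + Y - X = Y" "Y + X - X = Y" if "X \<in> carrier_mat n n" "Y \<in> carrier_mat n n" for X Y :: "'a mat"
    using that by (auto intro!: eq_matI)
  have PF: "P * F = P * Q" unfolding F_def using P Q PQ
    by (simp add: mult_minus_distrib_mat[of _ n n _ n] mult_add_distrib_mat[of _ n n _ n] cancel)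
  have QF: "Q * F = Q * P" unfolding F_def using P Q PQ
    by (simp add: mult_minus_distrib_mat[of _ n n _ n] mult_add_distrib_mat[of _ n n _ n] cancel)
  have FP: "F * P = Q * P" unfolding F_def using P Q PQ
    by (simp add: minus_mult_distrib_mat[of _ n n _ _ n] add_mult_distrib_mat[of _ n n _ _ n] cancel)
  have FQ: "F * Q = P * Q" unfolding F_def using P Q PQ
    by (simp add: minus_mult_distrib_mat[of _ n n _ _ n] add_mult_distrib_mat[of _ n n _ _ n] cancel)
  have "(1\<^sub>m n - Q) * E = E - Q * E"
    using minus_mult_distrib_mat[OF one_carrier_mat Q(1) E] E by simp
  also have "\<dots> = (P - Q) - (Q * P - Q)"
    unfolding E_def using mult_minus_distrib_mat[OF Q(1) P(1) Q(1)] Q by simp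
  also have "\<dots> = P - Q * P" using P Q PQ by (intro eq_matI) auto
  also have "\<dots> = E * P" unfolding E_def using P Q
    by (simp add: minus_mult_distrib_mat[of _ n n _ _ n])
  finally have "similar_mat (1\<^sub>m n - Q) P"
    using E P Q dE by (intro similar_matI_intertwine[of _ n _ E]) auto
  then have "(\<Sum>i<n. (1\<^sub>m n - Q) $$ (i, i)) = (\<Sum>i<n. P $$ (i, i))"
    using Q by (intro trace_similar) auto
  moreover have "(\<Sum>i<n. (1\<^sub>m n - Q) $$ (i, i)) = (\<Sum>i<n. 1 - Q $$ (i, i))"
    using Q by (intro sum.cong) auto
  ultimately show "(\<Sum>i<n. P $$ (i, i)) + (\<Sum>i<n. Q $$ (i, i)) = of_nat n"
    by (simp add: sum_subtractf algebra_simps)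
  have "similar_mat Q P"
    using F P Q dF QF FP by (intro similar_matI_intertwine[of _ n _ F]) auto
  then show "(\<Sum>i<n. P $$ (i, i)) = (\<Sum>i<n. Q $$ (i, i))"
    using trace_similar[of Q P n] Q by simp
  have "E * F = P * Q - Q * P" unfolding E_def using P Q F
    by (simp add: minus_mult_distrib_mat[of _ n n _ _ n] PF QF)
  also have "\<dots> = - (Q * P - P * Q)" using P(1) Q(1) by (intro eq_matI) auto
  also have "\<dots> = - (F * E)" unfolding E_def using P Q F
    by (simp add: mult_minus_distrib_mat[of _ n n _ n] FP FQ)
  finally have EF: "E * F = - (F * E)" .
  \<comment> \<open>Anticommuting invertible matrices satisfy \<open>(-1)^n = 1\<close>, as
    determinants show; in odd dimension this means characteristic 2.\<close>
  have "det E * det F = det (E * F)" using det_mult[OF E F] by simp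
  also have "\<dots> = (- 1) ^ n * det (F * E)"
    unfolding EF using E F by (intro det_uminus_mat) auto
  also have "det (F * E) = det F * det E" using det_mult[OF F E] by simp
  finally have "det E * det F = (- 1) ^ n * (det F * det E)" .
  then show "(2 :: 'a) = 0" if "odd n"
    using that dE dF by (simp add: eq_neg_iff_add_eq_0 flip: mult_2) 
qed

text \<open>Without a common eigenvector the odd dimension forces characteristic 2, whereas the
  traces give \<open>2 * t = 3\<close>; together these say that 3, and hence 1, is zero.\<close>

lemma idempotents_3_common_eigenvector:
  fixes P Q :: "'a::field mat"
  assumes P: "P \<in> carrier_mat 3 3" "P * P = P" and Q: "Q \<in> carrier_mat 3 3" "Q * Q = Q"
  obtains x where "x \<in> carrier_vec 3" "x \<noteq> 0\<^sub>v 3" "P *\<^sub>v x \<in> {0\<^sub>v 3, x}" "Q *\<^sub>v x \<in> {0\<^sub>v 3, x}"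
proof (rule ccontr)
  assume "\<not> thesis"
  then have no: "x = 0\<^sub>v 3" if "x \<in> carrier_vec 3" "P *\<^sub>v x \<in> {0\<^sub>v 3, x}" "Q *\<^sub>v x \<in> {0\<^sub>v 3, x}" for x
    using that \<open>\<And>x. \<lbrakk>x \<in> carrier_vec 3; x \<noteq> 0\<^sub>v 3; P *\<^sub>v x \<in> {0\<^sub>v 3, x}; Q *\<^sub>v x \<in> {0\<^sub>v 3, x}\<rbrakk> \<Longrightarrow> thesis\<close> by blast
  note facts = idempotents_no_common_eigenvector[OF P Q no]
  define t where "t = (\<Sum>i<3. P $$ (i, i))"
  have "2 * t = 3" using facts(1,2) by (simp add: t_def)
  moreover have "(2 :: 'a) = 0" using facts(3) by simp
  ultimately have "(3 :: 'a) = 0" by simp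
  then have "(3 :: 'a) - 2 = 0" using \<open>(2 :: 'a) = 0\<close> by simp
  then show False by simp
qed

text \<open>Both \<open>P D\<close> and \<open>D P\<close> reduce to \<open>a b (P - P Q P)\<close>:
  the multiples of \<open>P Q\<close>, respectively \<open>Q P\<close>, cancel because of the factor
  \<open>a + b\<close> in \<open>D\<close>. The statement for \<open>Q\<close> follows by exchanging
  the two summands.\<close>

lemma idem_comb_2_commute:
  fixes A :: "'a::field mat"
  assumes "idem_comb n [a, b] A"
  obtains P Q D where "P \<in> carrier_mat n n" "Q \<in> carrier_mat n n" "P * P = P" "Q * Q = Q"
    "A = a \<cdot>\<^sub>m P + b \<cdot>\<^sub>m Q" "D = A * ((a + b) \<cdot>\<^sub>m 1\<^sub>m n - A)" "P * D = D * P" "Q * D = D * Q"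
proof -
  have step: "P * (A * ((a + b) \<cdot>\<^sub>m 1\<^sub>m n - A)) = A * ((a + b) \<cdot>\<^sub>m 1\<^sub>m n - A) * P"
    if P: "P \<in> carrier_mat n n" "P * P = P" and Q: "Q \<in> carrier_mat n n" "Q * Q = Q"
      and A: "A = a \<cdot>\<^sub>m P + b \<cdot>\<^sub>m Q" for P Q A :: "'a mat" and a b
  proof -
    have PPx: "P * (P * X) = P * X" and QQx: "Q * (Q * X) = Q * X" if "X \<in> carrier_mat n n" for X
      using that P Q assoc_mult_mat[OF P(1) P(1) that] assoc_mult_mat[OF Q(1) Q(1) that] by simp_all
    let ?S = "(a + b) \<cdot>\<^sub>m 1\<^sub>m n - A"
    have Ac: "A \<in> carrier_mat n n" unfolding A using P Q by auto
    have S: "?S \<in> carrier_mat n n" using Ac by (rule minus_carrier_mat)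
    have PA: "P * A = a \<cdot>\<^sub>m P + b \<cdot>\<^sub>m (P * Q)"
      unfolding A using P Q by (simp add: mult_add_distrib_mat[of _ n n _ n] mult_smult_distrib[of _ n n _ n])
    have AP: "A * P = a \<cdot>\<^sub>m P + b \<cdot>\<^sub>m (Q * P)"
      unfolding A using P Q by (simp add: add_mult_distrib_mat[of _ n n _ _ n] mult_smult_assoc_mat[of _ n n _ n])
    have SP: "?S * P = (a + b) \<cdot>\<^sub>m P - A * P"
      using P Ac by (simp add: minus_mult_distrib_mat[of _ n n _ _ n] mult_smult_assoc_mat[of _ n n _ n])
    have PAS: "P * (A * ?S) = (P * A) * ?S" using P Ac S by simp
    have PAS': "(P * A) * ?S = (a + b) \<cdot>\<^sub>m (P * A) - (P * A) * A"
      using P Ac by (simp add: mult_minus_distrib_mat[of _ n n _ n] mult_smult_distrib[of _ n n _ n])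
    have "(A * ?S) * P = A * ((a + b) \<cdot>\<^sub>m P - A * P)"
      using assoc_mult_mat[OF Ac S P(1)] SP by simp
    also have "\<dots> = (a + b) \<cdot>\<^sub>m (A * P) - A * (A * P)"
      using P Ac by (simp add: mult_minus_distrib_mat[of _ n n _ n] mult_smult_distrib[of _ n n _ n])
    finally have ASP: "(A * ?S) * P = \<dots>" .
    have 1: "(P * A) * A = a \<cdot>\<^sub>m (P * A) + b \<cdot>\<^sub>m (P * (Q * A))"
      using arg_cong[OF PA, of "\<lambda>X. X * A"] P(1) Q(1) Ac
      by (simp add: add_mult_distrib_mat[of _ n n _ _ n] mult_smult_assoc_mat[of _ n n _ n])
    have QA: "Q * A = a \<cdot>\<^sub>m (Q * P) + b \<cdot>\<^sub>m Q"
      unfolding A using P Q by (simp add: mult_add_distrib_mat[of _ n n _ n] mult_smult_distrib[of _ n n _ n])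
    have PQA: "P * (Q * A) = a \<cdot>\<^sub>m (P * (Q * P)) + b \<cdot>\<^sub>m (P * Q)"
      unfolding QA using P Q by (simp add: mult_add_distrib_mat[of _ n n _ n] mult_smult_distrib[of _ n n _ n])
    have AQ: "A * Q = a \<cdot>\<^sub>m (P * Q) + b \<cdot>\<^sub>m Q"
      unfolding A using P Q by (simp add: add_mult_distrib_mat[of _ n n _ _ n] mult_smult_assoc_mat[of _ n n _ n])
    have 2: "A * (A * P) = a \<cdot>\<^sub>m (A * P) + b \<cdot>\<^sub>m ((A * Q) * P)"
      using arg_cong[OF AP, of "\<lambda>X. A * X"] P(1) Q(1) Ac
      by (simp add: mult_add_distrib_mat[of _ n n _ n] mult_smult_distrib[of _ n n _ n])
    have AQP: "(A * Q) * P = a \<cdot>\<^sub>m (P * (Q * P)) + b \<cdot>\<^sub>m (Q * P)"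
      unfolding AQ using P Q by (simp add: add_mult_distrib_mat[of _ n n _ _ n] mult_smult_assoc_mat[of _ n n _ n])
    have c: "P * Q \<in> carrier_mat n n" "Q * P \<in> carrier_mat n n" "P * (Q * P) \<in> carrier_mat n n" using P Q by auto
    show ?thesis
      unfolding PAS[unfolded PAS' 1 PQA, unfolded PA] ASP[unfolded 2 AQP, unfolded AP]
    proof (rule eq_matI, goal_cases)
      case (1 i j)
      then have ij: "i < n" "j < n" using P Q Ac by auto
      define x y z w where "x = P $$ (i, j)" "y = (P * Q) $$ (i, j)" "z = (Q * P) $$ (i, j)" "w = (P * (Q * P)) $$ (i, j)"
      then show ?case using ij P(1) Q(1) c by (simp add: algebra_simps del: index_mult_mat(1))
    qed (use P Q Ac in auto)
  qed
  obtain P Q where PQ: "P \<in> carrier_mat n n" "Q \<in> carrier_mat n n" "P * P = P" "Q * Q = Q"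
    and A: "A = a \<cdot>\<^sub>m P + b \<cdot>\<^sub>m Q"
    using idem_comb_2D[OF assms] by blast
  have "A = b \<cdot>\<^sub>m Q + a \<cdot>\<^sub>m P"
    unfolding A using PQ by (intro comm_add_mat) auto
  then show ?thesis
    using that[OF PQ A refl] step[OF PQ(1,3,2,4) A] step[OF PQ(2,4,1,3), of A b a] by (simp add: add.commute)
qed

text \<open>\<open>D\<close> lives on the upper corner and is invertible there, since neither 0 nor
  \<open>a + b\<close> is an eigenvalue of \<open>B\<close>. Whatever commutes with \<open>D\<close>
  preserves its range, so the corners of \<open>P\<close> and \<open>Q\<close> are idempotents with
  combination \<open>B\<close>, and a common eigenvector of theirs would be one of
  \<open>B\<close>.\<close>

lemma not_idem_comb_2_padded:
  fixes B :: "'a::field mat"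
  assumes B: "B \<in> carrier_mat 3 3" and n: "n \<ge> 3"
    and no: "\<And>v y. v \<in> carrier_vec 3 \<Longrightarrow> B *\<^sub>v v = y \<cdot>\<^sub>v v \<Longrightarrow> v = 0\<^sub>v 3"
  shows "\<not> idem_comb n [a, b] (four_block_mat B (0\<^sub>m 3 (n - 3)) (0\<^sub>m (n - 3) 3) (0\<^sub>m (n - 3) (n - 3)))"
    (is "\<not> idem_comb n _ ?A")
proof
  assume "idem_comb n [a, b] ?A"
  then obtain P Q D where P: "P \<in> carrier_mat n n" "P * P = P" and Q: "Q \<in> carrier_mat n n" "Q * Q = Q"
    and A: "?A = a \<cdot>\<^sub>m P + b \<cdot>\<^sub>m Q" and D: "D = ?A * ((a + b) \<cdot>\<^sub>m 1\<^sub>m n - ?A)"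
    and PD: "P * D = D * P" and QD: "Q * D = D * Q"
    by (rule idem_comb_2_commute) blast
  let ?s = "a + b"
  define D3 where "D3 = B * (?s \<cdot>\<^sub>m 1\<^sub>m 3 - B)"
  have S3: "?s \<cdot>\<^sub>m 1\<^sub>m 3 - B \<in> carrier_mat 3 3" using B by (rule minus_carrier_mat)
  have D3: "D3 \<in> carrier_mat 3 3" using B S3 by (simp add: D3_def)
  have "?s \<cdot>\<^sub>m 1\<^sub>m n - ?A = four_block_mat (?s \<cdot>\<^sub>m 1\<^sub>m 3 - B) (0\<^sub>m 3 (n - 3)) (0\<^sub>m (n - 3) 3) (?s \<cdot>\<^sub>m 1\<^sub>m (n - 3))"
    using B n by (intro eq_matI) auto
  then have Dblock: "D = four_block_mat D3 (0\<^sub>m 3 (n - 3)) (0\<^sub>m (n - 3) 3) (0\<^sub>m (n - 3) (n - 3))"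
    unfolding D D3_def
    using mult_block_diag[OF B S3 zero_carrier_mat, of "?s \<cdot>\<^sub>m 1\<^sub>m (n - 3)" "n - 3"] by simp
  have Dc: "D \<in> carrier_mat n n"
    using four_block_carrier_mat[OF D3 zero_carrier_mat[of "n - 3" "n - 3"]] n unfolding Dblock
    by (metis le_add_diff_inverse)
  have "trivial_kernel B"
    unfolding trivial_kernel_def
  proof (intro ballI impI)
    fix v assume v: "v \<in> carrier_vec (dim_col B)" "B *\<^sub>v v = 0\<^sub>v (dim_row B)"
    then have "0 \<cdot>\<^sub>v v = 0\<^sub>v 3" using B by (intro eq_vecI) auto
    then show "v = 0\<^sub>v (dim_col B)" using no[of v 0] B v by simp
  qed
  moreover have "trivial_kernel (?s \<cdot>\<^sub>m 1\<^sub>m 3 - B)"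
    unfolding trivial_kernel_def
  proof (intro ballI impI)
    fix v assume "v \<in> carrier_vec (dim_col (?s \<cdot>\<^sub>m 1\<^sub>m 3 - B))" and
      0: "(?s \<cdot>\<^sub>m 1\<^sub>m 3 - B) *\<^sub>v v = 0\<^sub>v (dim_row (?s \<cdot>\<^sub>m 1\<^sub>m 3 - B))"
    then have v: "v \<in> carrier_vec 3" using B by simp
    have "B *\<^sub>v v = ?s \<cdot>\<^sub>v v"
    proof (rule eq_vecI)
      fix i assume "i < dim_vec (?s \<cdot>\<^sub>v v)"
      then have i: "i < 3" using v by simp
      have "(?s \<cdot>\<^sub>m 1\<^sub>m 3 - B) *\<^sub>v v = (?s \<cdot>\<^sub>m 1\<^sub>m 3) *\<^sub>v v - B *\<^sub>v v"
        using B v by (intro minus_mult_distrib_mat_vec) auto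
      then have z: "(?s \<cdot>\<^sub>m 1\<^sub>m 3) *\<^sub>v v - B *\<^sub>v v = 0\<^sub>v 3" using 0 B by simp
      have "((?s \<cdot>\<^sub>m 1\<^sub>m 3) *\<^sub>v v - B *\<^sub>v v) $ i = 0" using i by (simp only: z) simp
      moreover have "((?s \<cdot>\<^sub>m 1\<^sub>m 3) *\<^sub>v v) $ i = ?s * v $ i"
        using i v by simp
      ultimately show "(B *\<^sub>v v) $ i = (?s \<cdot>\<^sub>v v) $ i" using i B v by simp
    qed (use B v in auto)
    then show "v = 0\<^sub>v (dim_col (?s \<cdot>\<^sub>m 1\<^sub>m 3 - B))" using no[OF v] B by simp
  qed
  ultimately have "det D3 \<noteq> 0"
    unfolding D3_def det_mult[OF B S3]
    using det_nonzero_iff_trivial_kernel[OF B] det_nonzero_iff_trivial_kernel[OF S3] by simp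
  then have tk: "trivial_kernel (transpose_mat D3)"
    using det_nonzero_iff_trivial_kernel[of "transpose_mat D3" 3] D3 by (simp add: det_transpose)
  \<comment> \<open>Below the corner \<open>D\<close> has only zero rows, so
    \<open>R * D = D * R\<close> makes each lower row of \<open>R\<close>, cut to the first three
    columns, a left null vector of \<open>D3\<close>.\<close>
  have lower: "R $$ (i, j) = 0" if R: "R \<in> carrier_mat n n" "R * D = D * R" and ij: "3 \<le> i" "i < n" "j < 3"
    for R i j
  proof -
    define r where "r = vec 3 (\<lambda>k. R $$ (i, k))"
    have "(transpose_mat D3 *\<^sub>v r) $ l = 0" if l: "l < 3" for l
    proof -
      have "D $$ (i, k) = 0" if "k < n" for k
        using that ij D3 unfolding Dblock by auto
      then have "0 = (\<Sum>k = 0..<n. D $$ (i, k) * R $$ (k, l))" by simp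
      also have "\<dots> = (D * R) $$ (i, l)"
        using ij l R(1) n Dc by (simp add: scalar_prod_def)
      also have "\<dots> = (R * D) $$ (i, l)" using R by simp
      also have "\<dots> = (\<Sum>k = 0..<n. R $$ (i, k) * D $$ (k, l))"
        using ij l R(1) n Dc by (simp add: scalar_prod_def)
      also have "\<dots> = (\<Sum>k = 0..<3. R $$ (i, k) * D3 $$ (k, l))"
        using n l D3 unfolding Dblock by (intro sum.mono_neutral_cong_right) auto
      also have "\<dots> = (transpose_mat D3 *\<^sub>v r) $ l"
        using l D3 by (simp add: r_def scalar_prod_def mult.commute)
      finally show ?thesis by simp
    qed
    then have "transpose_mat D3 *\<^sub>v r = 0\<^sub>v 3" using D3 by (intro eq_vecI) auto
    then have "r = 0\<^sub>v 3" using tk D3 unfolding trivial_kernel_def by (auto simp: r_def)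
    then have "r $ j = 0" using ij by simp
    then show ?thesis using ij by (simp add: r_def)
  qed
  define c3 where "c3 = (\<lambda>R :: 'a mat. mat 3 3 (\<lambda>(i, j). R $$ (i, j)))"
  have idem: "c3 R * c3 R = c3 R" if R: "R \<in> carrier_mat n n" "R * D = D * R" "R * R = R" for R
  proof (rule eq_matI)
    fix i j assume "i < dim_row (c3 R)" "j < dim_col (c3 R)"
    then have ij: "i < 3" "j < 3" by (auto simp: c3_def)
    have "(c3 R * c3 R) $$ (i, j) = (\<Sum>k = 0..<3. R $$ (i, k) * R $$ (k, j))"
      using ij by (simp add: c3_def scalar_prod_def)
    also have "\<dots> = (\<Sum>k = 0..<n. R $$ (i, k) * R $$ (k, j))"
      using n ij lower[OF R(1,2)] by (intro sum.mono_neutral_cong_left) auto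
    also have "\<dots> = (R * R) $$ (i, j)" using ij n R(1) by (simp add: scalar_prod_def)
    finally show "(c3 R * c3 R) $$ (i, j) = c3 R $$ (i, j)" using ij R(3) by (simp add: c3_def)
  qed (auto simp: c3_def)
  obtain x where x: "x \<in> carrier_vec 3" "x \<noteq> 0\<^sub>v 3" "c3 P *\<^sub>v x \<in> {0\<^sub>v 3, x}" "c3 Q *\<^sub>v x \<in> {0\<^sub>v 3, x}"
    using idempotents_3_common_eigenvector[of "c3 P" "c3 Q"] idem P Q PD QD by (auto simp: c3_def)
  have Beq: "B = a \<cdot>\<^sub>m c3 P + b \<cdot>\<^sub>m c3 Q"
  proof (rule eq_matI)
    fix i j assume "i < dim_row (a \<cdot>\<^sub>m c3 P + b \<cdot>\<^sub>m c3 Q)" "j < dim_col (a \<cdot>\<^sub>m c3 P + b \<cdot>\<^sub>m c3 Q)"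
    then have ij: "i < 3" "j < 3" by (auto simp: c3_def)
    have "B $$ (i, j) = ?A $$ (i, j)" using ij n B by simp
    then show "B $$ (i, j) = (a \<cdot>\<^sub>m c3 P + b \<cdot>\<^sub>m c3 Q) $$ (i, j)"
      unfolding A using ij n P Q by (simp add: c3_def)
  qed (use B in \<open>auto simp: c3_def\<close>)
  obtain y where "(a \<cdot>\<^sub>m c3 P + b \<cdot>\<^sub>m c3 Q) *\<^sub>v x = y \<cdot>\<^sub>v x"
    using common_eigenvector_lincomb[of "c3 P" 3 "c3 Q" x a b] x by (auto simp: c3_def)
  then show False using no[OF x(1)] x(2) Beq by blast
qed

text \<open>The first two rows make an eigenvector for \<open>y\<close> a multiple of
  \<open>(1, y, y^2)\<close>; the last row says that this multiple times the value of
  \<open>p\<close> at \<open>y\<close> is zero.\<close>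

lemma rootless_cubic_matrix:
  fixes p :: "'a::field poly"
  assumes p: "degree p = 3" "\<And>x. poly p x \<noteq> 0"
  obtains B :: "'a mat" where "B \<in> carrier_mat 3 3"
    "\<And>v y. v \<in> carrier_vec 3 \<Longrightarrow> B *\<^sub>v v = y \<cdot>\<^sub>v v \<Longrightarrow> v = 0\<^sub>v 3"
proof -
  define B where "B = mat 3 3 (\<lambda>(i, j). if i < 2 then if j = Suc i then 1 else 0
    else - coeff p j / coeff p 3)"
  have p3: "coeff p 3 \<noteq> 0" using p(1) by (metis leading_coeff_0_iff degree_0 zero_neq_numeral)
  have "v = 0\<^sub>v 3" if v: "v \<in> carrier_vec 3" and Bv: "B *\<^sub>v v = y \<cdot>\<^sub>v v" for v y
  proof -
    have e: "(B *\<^sub>v v) $ i = y * v $ i" if "i < 3" for i using that v Bv by simp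
    have 1: "v $ 1 = y * v $ 0" and 2: "v $ 2 = y * v $ 1"
      and 3: "- coeff p 0 / coeff p 3 * v $ 0 + (- coeff p 1 / coeff p 3 * v $ 1 + - coeff p 2 / coeff p 3 * v $ 2) = y * v $ 2"
      using e[of 0] e[of 1] e[of 2] v
      by (simp_all add: B_def scalar_prod_def numeral_3_eq_3 numeral_2_eq_2 algebra_simps)
    have "poly p y = coeff p 0 + coeff p 1 * y + coeff p 2 * y ^ 2 + coeff p 3 * y ^ 3"
      unfolding poly_altdef p(1) by (simp add: numeral_3_eq_3 numeral_2_eq_2)
    also have "\<dots> * v $ 0 = - coeff p 3 * (- coeff p 0 / coeff p 3 * v $ 0 + (- coeff p 1 / coeff p 3 * v $ 1
      + - coeff p 2 / coeff p 3 * v $ 2) - y * v $ 2)"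
      unfolding 2 1 using p3 by (simp add: algebra_simps power2_eq_square power3_eq_cube)
    also have "\<dots> = 0" using 3 by simp
    finally have "v $ 0 = 0" using p(2)[of y] by simp
    then show ?thesis using 1 2 v by (intro eq_vecI) (auto simp: numeral_3_eq_3 numeral_2_eq_2 less_Suc_eq)
  qed
  then show ?thesis using that[of B] by (auto simp: B_def)
qed

section \<open>Generic diagonal matrices\<close>

text \<open>If \<open>x + y\<close> were \<open>a + b\<close>, then by genericity no pair containing
  \<open>z\<close> or \<open>w\<close> could have this sum and neither could equal it. So
  \<open>z\<close> and \<open>w\<close> would be \<open>a\<close> and \<open>b\<close> in some
  order, but then \<open>z + w\<close> is \<open>a + b\<close> after all.\<close>

lemma distinct_pair_sums_contradiction:
  fixes x y z w a b :: "'a::field"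
  assumes d: "distinct [x, y, z, w]"
    and s: "x + y \<notin> {z, w, z + w}"
    and h: "z \<in> {a, b, a + b} \<or> z + x = a + b \<or> z + y = a + b \<or> z + w = a + b"
      "w \<in> {a, b, a + b} \<or> w + x = a + b \<or> w + y = a + b \<or> w + z = a + b"
  shows "x + y \<noteq> a + b"
proof
  assume *: "x + y = a + b"
  have "z + x \<noteq> x + y" "z + y \<noteq> x + y" "w + x \<noteq> x + y" "w + y \<noteq> x + y" using d by auto
  moreover have "z \<noteq> x + y" "w \<noteq> x + y" "z + w \<noteq> x + y" "w + z \<noteq> x + y"
    using s by (auto simp: add.commute)
  ultimately have "z = a \<or> z = b" "w = a \<or> w = b" using h unfolding *[symmetric] by auto
  moreover have "z \<noteq> w" using d by simp
  ultimately have "z + w = a + b" by (auto simp: add.commute)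
  then show False using s * by simp
qed

text \<open>\<open>P\<close> and \<open>Q\<close> respect the eigenspaces of the diagonal matrix
  \<open>D\<close>. An index whose eigenvalue in \<open>D\<close> is simple therefore has diagonal
  entries 0 or 1 in \<open>P\<close> and \<open>Q\<close>, which puts \<open>d i\<close> into
  \<open>{a, b, a + b}\<close>. The only way out is a partner \<open>j\<close> with
  \<open>d i + d j = a + b\<close>, and this is excluded for all six pairs; four distinct values do
  not fit into three places. A zero in the tail shares the eigenvalue of \<open>i\<close> only if
  \<open>d i = a + b\<close>.\<close>

lemma not_idem_comb_2_generic_diagonal:
  fixes d :: "nat \<Rightarrow> 'a::field"
  assumes n: "n \<ge> 4" and nz: "d 0 \<noteq> 0" "d 1 \<noteq> 0" "d 2 \<noteq> 0" "d 3 \<noteq> 0"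
    and tail: "\<And>i. i \<ge> 4 \<Longrightarrow> d i = 0"
    and dist: "distinct [d 0, d 1, d 2, d 3]"
    and sums: "d 0 + d 1 \<notin> {d 2, d 3, d 2 + d 3}" "d 0 + d 2 \<notin> {d 1, d 3, d 1 + d 3}"
      "d 0 + d 3 \<notin> {d 1, d 2, d 1 + d 2}" "d 1 + d 2 \<notin> {d 0, d 3}" "d 1 + d 3 \<notin> {d 0, d 2}"
      "d 2 + d 3 \<notin> {d 0, d 1}"
  shows "\<not> idem_comb n [a, b] (mat n n (\<lambda>(i, j). if i = j then d i else 0))" (is "\<not> idem_comb n _ ?A")
proof
  assume "idem_comb n [a, b] ?A"
  then obtain P Q D where P: "P \<in> carrier_mat n n" "P * P = P" and Q: "Q \<in> carrier_mat n n" "Q * Q = Q"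
    and A: "?A = a \<cdot>\<^sub>m P + b \<cdot>\<^sub>m Q" and D: "D = ?A * ((a + b) \<cdot>\<^sub>m 1\<^sub>m n - ?A)"
    and PD: "P * D = D * P" and QD: "Q * D = D * Q"
    by (rule idem_comb_2_commute) blast
  let ?s = "a + b"
  let ?e = "\<lambda>i. d i * (?s - d i)"
  have Dij: "D $$ (i, j) = (if i = j then ?e i else 0)" if ij: "i < n" "j < n" for i j
  proof -
    have "D $$ (i, j) = (\<Sum>k = 0..<n. (if i = k then 1 else 0) * (d k * (if k = j then ?s - d j else 0)))"
      unfolding D using ij by (auto simp: scalar_prod_def intro!: sum.cong)
    then show ?thesis using ij by (simp only: sum_delta_mult) auto
  qed
  have Dc: "D \<in> carrier_mat n n" unfolding D by auto
  have off: "R $$ (i, j) = 0"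
    if R: "R \<in> carrier_mat n n" "R * D = D * R" and ij: "i < n" "j < n" "?e i \<noteq> ?e j" for R i j
  proof -
    have "(R * D) $$ (i, j) = (\<Sum>k = 0..<n. (if j = k then 1 else 0) * (R $$ (i, k) * ?e k))"
      using R(1) Dc ij by (auto simp: scalar_prod_def Dij intro!: sum.cong)
    then have 1: "(R * D) $$ (i, j) = R $$ (i, j) * ?e j" using ij by (simp only: sum_delta_mult) simp
    have "(D * R) $$ (i, j) = (\<Sum>k = 0..<n. (if i = k then 1 else 0) * (?e k * R $$ (k, j)))"
      using R(1) Dc ij by (auto simp: scalar_prod_def Dij intro!: sum.cong)
    then have 2: "(D * R) $$ (i, j) = ?e i * R $$ (i, j)" using ij by (simp only: sum_delta_mult) simp
    have "(?e i - ?e j) * R $$ (i, j) = 0" using 1 2 R(2) by (simp add: algebra_simps)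
    then show ?thesis using ij by simp
  qed
  have single: "R $$ (i, i) \<in> {0, 1}"
    if R: "R \<in> carrier_mat n n" "R * D = D * R" "R * R = R"
      and i: "i < n" "\<And>j. j < n \<Longrightarrow> j \<noteq> i \<Longrightarrow> ?e i \<noteq> ?e j" for R i
  proof -
    have "R $$ (i, i) = (R * R) $$ (i, i)" using R by simp
    also have "\<dots> = (\<Sum>k = 0..<n. R $$ (i, k) * R $$ (k, i))"
      using R(1) i by (simp add: scalar_prod_def)
    also have "\<dots> = (\<Sum>k = 0..<n. (if i = k then 1 else 0) * (R $$ (i, k) * R $$ (k, i)))"
    proof (intro sum.cong refl)
      fix k assume "k \<in> {0..<n}"
      then show "R $$ (i, k) * R $$ (k, i) = (if i = k then 1 else 0) * (R $$ (i, k) * R $$ (k, i))"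
        using off[OF R(1,2), of i k] i by (cases "k = i") auto
    qed
    also have "\<dots> = R $$ (i, i) * R $$ (i, i)" using i by (simp only: sum_delta_mult) simp
    finally have "R $$ (i, i) * (R $$ (i, i) - 1) = 0" by (simp add: algebra_simps)
    then show ?thesis by simp
  qed
  have key: "d i \<in> {a, b, ?s} \<or> (\<exists>j<4. j \<noteq> i \<and> d i + d j = ?s)" if i: "i < 4" for i
  proof (rule ccontr)
    assume *: "\<not> ?thesis"
    have di: "d i \<noteq> 0" using nz i by (auto simp: less_Suc_eq numeral_eq_Suc)
    have dj: "d i \<noteq> d j" if "j < 4" "j \<noteq> i" for j
      using that i dist by (auto simp: less_Suc_eq numeral_eq_Suc)
    have ne: "?e i \<noteq> ?e j" if "j < n" "j \<noteq> i" for j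
    proof
      assume e: "?e i = ?e j"
      show False
      proof (cases "j < 4")
        case True
        have "(d i - d j) * (?s - (d i + d j)) = ?e i - ?e j" by (simp add: algebra_simps)
        then have "?s = d i + d j" using e dj[OF True that(2)] by simp
        then show False using * True that by auto
      next
        case False
        then show False using e tail[of j] di * by simp
      qed
    qed
    have "P $$ (i, i) \<in> {0, 1}" "Q $$ (i, i) \<in> {0, 1}"
      using single[OF P(1) PD P(2)] single[OF Q(1) QD Q(2)] ne i n by auto
    moreover have "d i = a * P $$ (i, i) + b * Q $$ (i, i)"
      using arg_cong[OF A, of "\<lambda>M. M $$ (i, i)"] P Q i n by simp
    ultimately show False using * di by auto
  qed
  have k: "d i \<in> {a, b, ?s} \<or> (i \<noteq> 0 \<and> d i + d 0 = ?s) \<or> (i \<noteq> 1 \<and> d i + d 1 = ?s)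
     \<or> (i \<noteq> 2 \<and> d i + d 2 = ?s) \<or> (i \<noteq> 3 \<and> d i + d 3 = ?s)" if "i < 4" for i
    using key[OF that] by (auto simp: less_Suc_eq numeral_eq_Suc)
  have k0: "d 0 \<in> {a, b, ?s} \<or> d 0 + d 1 = ?s \<or> d 0 + d 2 = ?s \<or> d 0 + d 3 = ?s"
    and k1: "d 1 \<in> {a, b, ?s} \<or> d 1 + d 0 = ?s \<or> d 1 + d 2 = ?s \<or> d 1 + d 3 = ?s"
    and k2: "d 2 \<in> {a, b, ?s} \<or> d 2 + d 0 = ?s \<or> d 2 + d 1 = ?s \<or> d 2 + d 3 = ?s"
    and k3: "d 3 \<in> {a, b, ?s} \<or> d 3 + d 0 = ?s \<or> d 3 + d 1 = ?s \<or> d 3 + d 2 = ?s"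
    using k[of 0] k[of 1] k[of 2] k[of 3] by auto
  have p: "d 0 + d 1 \<noteq> ?s" "d 0 + d 2 \<noteq> ?s" "d 0 + d 3 \<noteq> ?s"
    "d 1 + d 2 \<noteq> ?s" "d 1 + d 3 \<noteq> ?s" "d 2 + d 3 \<noteq> ?s"
  proof -
    \<comment> \<open>The sums of complementary pairs were compared only once in
      \<open>sums\<close>; the comparison is symmetric.\<close>
    have s: "d 1 + d 2 \<notin> {d 0, d 3, d 0 + d 3}" "d 1 + d 3 \<notin> {d 0, d 2, d 0 + d 2}"
      "d 2 + d 3 \<notin> {d 0, d 1, d 0 + d 1}"
      using sums by (metis insert_iff empty_iff)+
    show "d 0 + d 1 \<noteq> ?s"
    proof (rule distinct_pair_sums_contradiction[of _ _ "d 2" "d 3"])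
      show "distinct [d 0, d 1, d 2, d 3]" using dist by auto
      show "d 0 + d 1 \<notin> {d 2, d 3, d 2 + d 3}" by (fact sums(1))
    qed (use k2 k3 in blast)+
    show "d 0 + d 2 \<noteq> ?s"
    proof (rule distinct_pair_sums_contradiction[of _ _ "d 1" "d 3"])
      show "distinct [d 0, d 2, d 1, d 3]" using dist by auto
      show "d 0 + d 2 \<notin> {d 1, d 3, d 1 + d 3}" by (fact sums(2))
    qed (use k1 k3 in blast)+
    show "d 0 + d 3 \<noteq> ?s"
    proof (rule distinct_pair_sums_contradiction[of _ _ "d 1" "d 2"])
      show "distinct [d 0, d 3, d 1, d 2]" using dist by auto
      show "d 0 + d 3 \<notin> {d 1, d 2, d 1 + d 2}" by (fact sums(3))
    qed (use k1 k2 in blast)+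
    show "d 1 + d 2 \<noteq> ?s"
    proof (rule distinct_pair_sums_contradiction[of _ _ "d 0" "d 3"])
      show "distinct [d 1, d 2, d 0, d 3]" using dist by auto
      show "d 1 + d 2 \<notin> {d 0, d 3, d 0 + d 3}" by (fact s(1))
    qed (use k0 k3 in blast)+
    show "d 1 + d 3 \<noteq> ?s"
    proof (rule distinct_pair_sums_contradiction[of _ _ "d 0" "d 2"])
      show "distinct [d 1, d 3, d 0, d 2]" using dist by auto
      show "d 1 + d 3 \<notin> {d 0, d 2, d 0 + d 2}" by (fact s(2))
    qed (use k0 k2 in blast)+
    show "d 2 + d 3 \<noteq> ?s"
    proof (rule distinct_pair_sums_contradiction[of _ _ "d 0" "d 1"])
      show "distinct [d 2, d 3, d 0, d 1]" using dist by auto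
      show "d 2 + d 3 \<notin> {d 0, d 1, d 0 + d 1}" by (fact s(3))
    qed (use k0 k1 in blast)+
  qed
  have p': "d 1 + d 0 \<noteq> ?s" "d 2 + d 0 \<noteq> ?s" "d 3 + d 0 \<noteq> ?s"
    "d 2 + d 1 \<noteq> ?s" "d 3 + d 1 \<noteq> ?s" "d 3 + d 2 \<noteq> ?s"
    using p by (metis add.commute)+
  have "{d 0, d 1, d 2, d 3} \<subseteq> {a, b, ?s}"
    using k0 k1 k2 k3 p p' by blast
  then have "card {d 0, d 1, d 2, d 3} \<le> card {a, b, ?s}" by (intro card_mono) auto
  also have "\<dots> \<le> 3" by (auto simp: card_insert_if)
  finally show False using dist by (simp add: card_insert_if)
qed

section \<open>Two idempotents in dimensions 2 and 3\<close>

lemma more_than_two_elementsD: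
  assumes "more_than_two_elements TYPE('a::field)"
  shows "\<exists>a :: 'a. a \<noteq> 0 \<and> a \<noteq> t"
proof (rule ccontr)
  assume "\<not> ?thesis"
  then have "(UNIV :: 'a set) \<subseteq> {0, t}" by auto
  moreover have "card {0, t} \<le> 2" by (simp add: card_insert_if)
  ultimately have "finite (UNIV :: 'a set)" "card (UNIV :: 'a set) \<le> 2"
    using finite_subset[of UNIV "{0, t}"] card_mono[of "{0, t}" UNIV] by auto
  then show False using assms by (simp add: more_than_two_elements_def)
qed

lemma two_elementsD:
  assumes "\<not> more_than_two_elements TYPE('a::field)"
  shows "x = 0 \<or> x = (1 :: 'a)"
proof (rule ccontr)
  assume "\<not> ?thesis"
  then have "card {0, 1, x} = 3" by (simp add: card_insert_if)
  moreover have "card {0, 1, x} \<le> card (UNIV :: 'a set)"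
    using assms by (intro card_mono) (auto simp: more_than_two_elements_def)
  ultimately show False using assms by (simp add: more_than_two_elements_def)
qed

lemma similar_comp_mat_2:
  fixes A :: "'a::field mat"
  assumes A: "A \<in> carrier_mat 2 2"
  shows "(\<exists>x. A = x \<cdot>\<^sub>m 1\<^sub>m 2) \<or> (\<exists>c. similar_mat A (comp_mat 2 c) \<and> c $ 1 = A $$ (0, 0) + A $$ (1, 1))"
  using scalar_or_krylov_indep[OF A]
proof
  assume "\<exists>v. krylov_indep A v 2"
  then obtain v where v: "krylov_indep A v 2" by blast
  have "\<not> krylov_indep A w (Suc 2)" for w using krylov_indep_le[OF A, of w "Suc 2"] by auto
  then obtain c D where D: "D \<in> carrier_mat (2 - 2) (2 - 2)"
    and sim: "similar_mat A (four_block_mat (comp_mat 2 c) (0\<^sub>m 2 (2 - 2)) (0\<^sub>m (2 - 2) 2) D)"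
    using cyclic_split[OF A v] by auto
  have "four_block_mat (comp_mat 2 c) (0\<^sub>m 2 (2 - 2)) (0\<^sub>m (2 - 2) 2) D = comp_mat 2 c"
    using D by (intro eq_matI) (auto simp: comp_mat_def)
  then have sim: "similar_mat A (comp_mat 2 c)" using sim by simp
  have "c $ 1 = A $$ (0, 0) + A $$ (1, 1)"
    using trace_similar[OF sim A] by (simp add: comp_mat_def numeral_2_eq_2)
  then show ?thesis using sim by blast
qed blast

lemma block_1_2_carrier:
  assumes "A \<in> carrier_mat 1 1" "D \<in> carrier_mat 2 2"
  shows "four_block_mat A B C D \<in> carrier_mat 3 3"
  using four_block_carrier_mat[OF assms, of B C] by (simp add: numeral_3_eq_3)

lemma idem_comb_scalar_Cons:
  fixes x :: "'a::field"
  shows "idem_comb n (x # cs) (x \<cdot>\<^sub>m 1\<^sub>m n)"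
proof -
  have "0 \<cdot>\<^sub>m 1\<^sub>m n = (0\<^sub>m n n :: 'a mat)" by (intro eq_matI) auto
  then show ?thesis using idem_comb_add_scalar[of n cs 0 x] idem_comb_zero[of n cs] by simp
qed

lemma two_idempotents_dim_2:
  fixes A :: "'a::field mat"
  assumes A: "A \<in> carrier_mat 2 2" and more: "more_than_two_elements TYPE('a)"
  shows "\<exists>cs. length cs = 2 \<and> idem_comb 2 cs A"
  using similar_comp_mat_2[OF A]
proof
  assume "\<exists>x. A = x \<cdot>\<^sub>m 1\<^sub>m 2"
  then obtain x where "A = x \<cdot>\<^sub>m 1\<^sub>m 2" by blast
  then have "idem_comb 2 [x, 1] A" using idem_comb_scalar_Cons by blast
  then show ?thesis by (intro exI[of _ "[x, 1]"]) auto
next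
  assume "\<exists>c. similar_mat A (comp_mat 2 c) \<and> c $ 1 = A $$ (0, 0) + A $$ (1, 1)"
  then obtain c where sim: "similar_mat A (comp_mat 2 c)" by blast
  \<comment> \<open>A third field element is what allows the trace to be split into two nonzero
    summands.\<close>
  obtain a where "a \<noteq> 0" "a \<noteq> c $ 1" using more_than_two_elementsD[OF more] by blast
  then have "idem_comb 2 [a, c $ 1 - a] (comp_mat 2 c)" by (intro comp_mat_2_idem_comb) auto
  then have "idem_comb 2 [a, c $ 1 - a] A" by (rule idem_comb_similar[OF sim])
  then show ?thesis by (intro exI[of _ "[a, c $ 1 - a]"]) auto
qed

section \<open>Matrices of size 3 with an eigenvector\<close>

lemma idem_comb_2_complement:
  fixes A :: "'a::field mat"
  assumes "idem_comb n [a, b] A"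
  shows "idem_comb n [a, b] ((a + b) \<cdot>\<^sub>m 1\<^sub>m n - A)"
proof -
  obtain P Q where P: "P \<in> carrier_mat n n" "P * P = P" and Q: "Q \<in> carrier_mat n n" "Q * Q = Q"
    and A: "A = a \<cdot>\<^sub>m P + b \<cdot>\<^sub>m Q"
    using idem_comb_2D[OF assms] by blast
  have id: "idempotent_mat n (1\<^sub>m n - R)" if R: "R \<in> carrier_mat n n" "R * R = R" for R :: "'a mat"
  proof -
    have "(1\<^sub>m n - R) * (1\<^sub>m n - R) = (1\<^sub>m n - R) - R * (1\<^sub>m n - R)"
      using minus_mult_distrib_mat[OF one_carrier_mat R(1), of "1\<^sub>m n - R" n] R
        minus_carrier_mat[OF R(1), of "1\<^sub>m n"] by simp
    also have "R * (1\<^sub>m n - R) = R - R"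
      using mult_minus_distrib_mat[OF R(1) one_carrier_mat R(1)] R by simp
    also have "(1\<^sub>m n - R) - (R - R) = 1\<^sub>m n - R" using R(1) by (intro eq_matI) auto
    finally show ?thesis using R by (simp add: idempotent_mat_def minus_carrier_mat)
  qed
  have "(a + b) \<cdot>\<^sub>m 1\<^sub>m n - A = (0\<^sub>m n n + b \<cdot>\<^sub>m (1\<^sub>m n - Q)) + a \<cdot>\<^sub>m (1\<^sub>m n - P)"
    unfolding A using P(1) Q(1) by (intro eq_matI) (auto simp: algebra_simps)
  then show ?thesis using id[OF P] id[OF Q] by (auto simp: idem_comb.simps)
qed

lemma eigenvector_block:
  fixes A :: "'a::field mat"
  assumes A: "A \<in> carrier_mat n n" and v: "v \<in> carrier_vec n" "v \<noteq> 0\<^sub>v n" "A *\<^sub>v v = x \<cdot>\<^sub>v v"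
  obtains R M where "R \<in> carrier_mat 1 (n - 1)" "M \<in> carrier_mat (n - 1) (n - 1)"
    "similar_mat A (four_block_mat (x \<cdot>\<^sub>m 1\<^sub>m 1) R (0\<^sub>m (n - 1) 1) M)"
proof -
  define X where "X = mat n 1 (\<lambda>(i, _). v $ i)"
  have X: "X \<in> carrier_mat n 1" by (simp add: X_def)
  have "trivial_kernel X"
    unfolding trivial_kernel_def
  proof (intro ballI impI)
    fix c assume "c \<in> carrier_vec (dim_col X)" "X *\<^sub>v c = 0\<^sub>v (dim_row X)"
    then have c: "c \<in> carrier_vec 1" and Xc: "X *\<^sub>v c = 0\<^sub>v n" using X by auto
    obtain i where i: "i < n" "v $ i \<noteq> 0"
      using v(1,2) by (metis carrier_vecD eq_vecI index_zero_vec)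
    have "(X *\<^sub>v c) $ i = v $ i * c $ 0" using i c by (simp add: X_def scalar_prod_def)
    then have "c $ 0 = 0" using Xc i by simp
    then show "c = 0\<^sub>v (dim_col X)" using c X by (intro eq_vecI) auto
  qed
  then obtain P where P: "P \<in> carrier_mat n n" "det P \<noteq> 0" "1 \<le> n" "P * X = col_id n 1"
    using trivial_kernel_reduce[OF X] by blast
  obtain P' where P': "P' \<in> carrier_mat n n" "P * P' = 1\<^sub>m n" "P' * P = 1\<^sub>m n"
    using inverse_matE[OF P(1,2)] by blast
  define B where "B = P * A * P'"
  have B: "B \<in> carrier_mat n n" using P P' A by (simp add: B_def)
  have BP: "B * P = P * A"
    unfolding B_def using P P' A by (simp add: assoc_mult_mat[of _ n n _ n _ n])
  have "P' * B * P = (P' * P) * A * (P' * P)"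
    unfolding B_def using P P'(1) A by (simp add: assoc_mult_mat[of _ n n _ n _ n])
  then have "A = P' * B * P" using P' A by simp
  then have sim: "similar_mat A B" using P P' A B by (intro similar_matI[of _ _ P' P n]) auto
  have AX: "A * X = x \<cdot>\<^sub>m X"
  proof (rule eq_matI)
    fix i j assume "i < dim_row (x \<cdot>\<^sub>m X)" "j < dim_col (x \<cdot>\<^sub>m X)"
    then have ij: "i < n" "j = 0" by (auto simp: X_def)
    have "col X 0 = v" using v(1) by (intro eq_vecI) (auto simp: X_def)
    then have "(A * X) $$ (i, j) = (A *\<^sub>v v) $ i" using ij A X by simp
    then show "(A * X) $$ (i, j) = (x \<cdot>\<^sub>m X) $$ (i, j)" using ij v by (simp add: X_def)
  qed (use A X in auto)
  have "B * col_id n 1 = B * P * X" using B P X by (simp flip: P(4))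
  also have "\<dots> = x \<cdot>\<^sub>m (P * X)"
    using P A X by (simp add: BP AX mult_smult_distrib[of _ n n _ 1])
  finally have BE: "B * col_id n 1 = x \<cdot>\<^sub>m col_id n 1" by (simp add: P(4))
  have col0: "B $$ (i, 0) = (if i = 0 then x else 0)" if "i < n" for i
    using mult_col_id[OF B P(3) that, of 0] BE that by (auto simp: col_id_def)
  define R where "R = mat 1 (n - 1) (\<lambda>(i, j). B $$ (0, j + 1))"
  define M where "M = mat (n - 1) (n - 1) (\<lambda>(i, j). B $$ (i + 1, j + 1))"
  have "B = four_block_mat (x \<cdot>\<^sub>m 1\<^sub>m 1) R (0\<^sub>m (n - 1) 1) M"
  proof (rule eq_matI)
    fix i j assume "i < dim_row (four_block_mat (x \<cdot>\<^sub>m 1\<^sub>m 1) R (0\<^sub>m (n - 1) 1) M)"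
      "j < dim_col (four_block_mat (x \<cdot>\<^sub>m 1\<^sub>m 1) R (0\<^sub>m (n - 1) 1) M)"
    then have "i < n" "j < n" using P(3) by (auto simp: R_def M_def)
    then show "B $$ (i, j) = four_block_mat (x \<cdot>\<^sub>m 1\<^sub>m 1) R (0\<^sub>m (n - 1) 1) M $$ (i, j)"
      using col0[of i] by (cases "j = 0") (auto simp: R_def M_def)
  qed (use B P(3) in \<open>auto simp: R_def M_def\<close>)
  then show ?thesis using that[of R M] sim by (simp add: R_def M_def)
qed

text \<open>With corner 0 the first column vanishes. After transposition the first row is zero, and
  the other two rows can be assigned to \<open>a\<close> and \<open>b\<close> separately.\<close>

lemma idem_comb_2_zero_block:
  fixes M :: "'a::field mat"
  assumes R: "R \<in> carrier_mat 1 2" and M: "M \<in> carrier_mat 2 2"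
    and sim: "similar_mat M (comp_mat 2 c)" and ab: "a \<noteq> 0" "b \<noteq> 0" "a + b = c $ 1"
  shows "idem_comb 3 [a, b] (four_block_mat (0 \<cdot>\<^sub>m 1\<^sub>m 1) R (0\<^sub>m 2 1) M)"
proof -
  obtain N where N: "N \<in> carrier_mat 2 2" "similar_mat (comp_mat 2 c) N" "N $$ (0, 0) = a" "N $$ (1, 1) = b"
    using comp_mat_2_similar[OF ab(3)] by blast
  let ?Z = "0 \<cdot>\<^sub>m 1\<^sub>m 1 :: 'a mat"
  have Z: "?Z \<in> carrier_mat 1 1" by simp
  obtain R' where R': "R' \<in> carrier_mat 1 2"
    and sim': "similar_mat (four_block_mat ?Z R (0\<^sub>m 2 1) M) (four_block_mat ?Z R' (0\<^sub>m 2 1) N)"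
    using similar_mat_four_block_0_ex[OF similar_mat_refl[OF Z] similar_mat_trans[OF sim N(2)] R Z M] by blast
  define G where "G = four_block_mat ?Z R' (0\<^sub>m 2 1) N"
  have G: "G \<in> carrier_mat 3 3" using block_1_2_carrier[OF Z N(1)] by (simp add: G_def)
  have col0: "G $$ (j, 0) = 0" if "j < 3" for j
    using that N(1) by (simp add: G_def)
  have G11: "G $$ (1, 1) = a" "G $$ (2, 2) = b"
    using N by (simp_all add: G_def)
  have "idem_comb 3 [a, b] (transpose_mat G)"
    by (rule idem_comb_2_rowsI[of _ _ _ _ "\<lambda>i. i = 1" "\<lambda>i. i = 2"])
      (use G ab col0 G11 in \<open>auto simp: less_Suc_eq numeral_3_eq_3 numeral_2_eq_2\<close>)
  then have "idem_comb 3 [a, b] G" using idem_comb_transpose[of 3 "[a, b]" "transpose_mat G"] by simp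
  then show ?thesis using idem_comb_similar[OF sim'] by (simp add: G_def)
qed

lemma two_idempotents_scalar_corner:
  fixes R :: "'a::field mat"
  assumes R: "R \<in> carrier_mat 1 2"
  shows "\<exists>cs. length cs = 2 \<and> idem_comb 3 cs (four_block_mat (x \<cdot>\<^sub>m 1\<^sub>m 1) R (0\<^sub>m 2 1) (y \<cdot>\<^sub>m 1\<^sub>m 2))"
    (is "\<exists>cs. _ \<and> idem_comb 3 cs ?G")
proof -
  have G: "?G \<in> carrier_mat 3 3"
    by (rule block_1_2_carrier) simp_all
  have Gij: "?G $$ (i, j) = (if i = 0 then if j = 0 then x else R $$ (0, j - 1) else if i = j then y else 0)"
    if "i < 3" "j < 3" for i j
    using that R by (auto simp: less_Suc_eq numeral_3_eq_3 numeral_2_eq_2)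
  consider "x \<noteq> 0" "y \<noteq> 0" | "x \<noteq> 0" "y = 0" | "x = 0" "y \<noteq> 0" | "x = 0" "y = 0" by blast
  then show ?thesis
  proof cases
    case 1
    have "idem_comb 3 [x, y] ?G"
      by (rule idem_comb_2_rowsI[of _ _ _ _ "\<lambda>i. i = 0" "\<lambda>i. i \<noteq> 0"])
        (use G 1 in \<open>auto simp: Gij\<close>)
    then show ?thesis by (intro exI[of _ "[x, y]"]) simp
  next
    case 2
    have "idem_comb 3 [x, 1] ?G"
      by (rule idem_comb_2_rowsI[of _ _ _ _ "\<lambda>i. i = 0" "\<lambda>i. False"])
        (use G 2 in \<open>auto simp: Gij\<close>)
    then show ?thesis by (intro exI[of _ "[x, 1]"]) simp
  next
    case 3
    define H where "H = ?G"
    have H: "H \<in> carrier_mat 3 3" using G by (simp add: H_def)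
    have Ht: "transpose_mat H $$ (i, j) = (if j = 0 then if i = 0 then 0 else R $$ (0, i - 1) else if i = j then y else 0)"
      if "i < 3" "j < 3" for i j
      using that H Gij[of j i, folded H_def] 3 by auto
    have "idem_comb 3 [y, 1] (transpose_mat H)"
      by (rule idem_comb_2_rowsI[of _ _ _ _ "\<lambda>i. i \<noteq> 0" "\<lambda>i. False"])
        (use H 3 in \<open>auto simp: Ht simp del: index_transpose_mat(1)\<close>)
    then have "idem_comb 3 [y, 1] ?G"
      using idem_comb_transpose[of 3 "[y, 1]" "transpose_mat H"] by (simp add: H_def)
    then show ?thesis by (intro exI[of _ "[y, 1]"]) simp
  next
    case 4
    \<comment> \<open>In this case the matrix has square zero; it is the difference of two
      idempotents that share the corner entry 1.\<close>
    define P where "P = mat 3 3 (\<lambda>(i, j). if i = 0 then if j = 0 then 1 else R $$ (0, j - 1) else 0)"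
    define Q where "Q = mat 3 3 (\<lambda>(i, j). if i = 0 \<and> j = 0 then 1 else (0 :: 'a))"
    have "idempotent_mat 3 P" by (rule idempotent_rowsI[of _ _ "\<lambda>i. i = 0"]) (auto simp: P_def)
    moreover have "idempotent_mat 3 Q" by (rule idempotent_rowsI[of _ _ "\<lambda>i. i = 0"]) (auto simp: Q_def)
    moreover have "?G = (0\<^sub>m 3 3 + - 1 \<cdot>\<^sub>m Q) + 1 \<cdot>\<^sub>m P"
    proof (rule eq_matI)
      fix i j assume "i < dim_row ((0\<^sub>m 3 3 + - 1 \<cdot>\<^sub>m Q) + 1 \<cdot>\<^sub>m P)" "j < dim_col ((0\<^sub>m 3 3 + - 1 \<cdot>\<^sub>m Q) + 1 \<cdot>\<^sub>m P)"
      then have "i < 3" "j < 3" by (auto simp: P_def)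
      then show "?G $$ (i, j) = ((0\<^sub>m 3 3 + - 1 \<cdot>\<^sub>m Q) + 1 \<cdot>\<^sub>m P) $$ (i, j)"
        unfolding Gij[OF \<open>i < 3\<close> \<open>j < 3\<close>] using 4 by (auto simp: P_def Q_def)
    qed (use G in \<open>auto simp: P_def\<close>)
    ultimately have "idem_comb 3 [1, - 1] ?G" unfolding idem_comb.simps by blast
    then show ?thesis by (intro exI[of _ "[1, - 1]"]) simp
  qed
qed

lemma two_idempotents_dim_3:
  fixes A :: "'a::field mat"
  assumes A: "A \<in> carrier_mat 3 3" and more: "more_than_two_elements TYPE('a)"
    and v: "v \<in> carrier_vec 3" "v \<noteq> 0\<^sub>v 3" "A *\<^sub>v v = x \<cdot>\<^sub>v v"
  shows "\<exists>cs. length cs = 2 \<and> idem_comb 3 cs A"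
proof -
  obtain R M where R: "R \<in> carrier_mat 1 2" and M: "M \<in> carrier_mat 2 2"
    and sim: "similar_mat A (four_block_mat (x \<cdot>\<^sub>m 1\<^sub>m 1) R (0\<^sub>m 2 1) M)"
    using eigenvector_block[OF A v] by auto
  let ?X = "x \<cdot>\<^sub>m 1\<^sub>m 1 :: 'a mat"
  let ?G = "four_block_mat ?X R (0\<^sub>m 2 1) M"
  have X: "?X \<in> carrier_mat 1 1" by simp
  have "\<exists>cs. length cs = 2 \<and> idem_comb 3 cs ?G"
  proof (cases "\<exists>y. M = y \<cdot>\<^sub>m 1\<^sub>m 2")
    case True
    then show ?thesis using two_idempotents_scalar_corner[OF R] by blast
  next
    case False
    then obtain c where simM: "similar_mat M (comp_mat 2 c)" and c: "c $ 1 = M $$ (0, 0) + M $$ (1, 1)"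
      using similar_comp_mat_2[OF M] by blast
    consider "x = 0" | "x \<noteq> 0" "c $ 1 \<noteq> x" | "x \<noteq> 0" "c $ 1 = x" by blast
    then show ?thesis
    proof cases
      case 1
      obtain a where "a \<noteq> 0" "a \<noteq> c $ 1" using more_than_two_elementsD[OF more] by blast
      then have "idem_comb 3 [a, c $ 1 - a] ?G"
        using idem_comb_2_zero_block[OF R M simM, of a "c $ 1 - a"] 1 by simp
      then show ?thesis by (intro exI[of _ "[a, c $ 1 - a]"]) simp
    next
      case 2
      \<comment> \<open>Now \<open>x\<close> and \<open>b\<close> are nonzero with sum
        \<open>c $ 1\<close>, and the diagonal can be made \<open>x, x, b\<close>. Rows 0 and 1 then
        share the coefficient \<open>x\<close>, so the entries between them must be removed.\<close>
      define b where "b = c $ 1 - x"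
      obtain N where N: "N \<in> carrier_mat 2 2" "similar_mat (comp_mat 2 c) N"
        and N1: "N $$ (0, 0) = x" "N $$ (1, 1) = b" "N $$ (1, 0) = 1"
        using comp_mat_2_similar[of x b c] by (auto simp: b_def)
      obtain R' where R': "R' \<in> carrier_mat 1 2"
        and sim': "similar_mat ?G (four_block_mat ?X R' (0\<^sub>m 2 1) N)"
        using similar_mat_four_block_0_ex[OF similar_mat_refl[OF X] similar_mat_trans[OF simM N(2)] R X M] by blast
      let ?G' = "four_block_mat ?X R' (0\<^sub>m 2 1) N"
      let ?r = "R' $$ (0, 0)" and ?s = "R' $$ (0, 1)"
      \<comment> \<open>Conjugation by this transvection subtracts \<open>?r\<close> times row 2
        from row 0. The entry 1 in position \<open>(2, 1)\<close> thus clears position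
        \<open>(0, 1)\<close>, and the matching column operation affects only position
        \<open>(0, 2)\<close>.\<close>
      define P where "P = mat 3 3 (\<lambda>(i, j). if i = j then 1 else if i = 0 \<and> j = 2 then ?r else 0)"
      define K where "K = mat 3 3 (\<lambda>(i, j). if i = 0 then if j = 0 then x else if j = 1 then 0 else ?s + ?r * x - b * ?r
        else if i = 1 then if j = 0 then 0 else if j = 1 then x else N $$ (0, 1)
        else if j = 0 then 0 else if j = 1 then 1 else b)"
      have G': "?G' \<in> carrier_mat 3 3" using block_1_2_carrier[OF X N(1)] .
      have "?G' * P = P * K"
      proof (rule eq_matI)
        fix i j assume "i < dim_row (P * K)" "j < dim_col (P * K)"
        then have "i = 0 \<or> i = 1 \<or> i = 2" "j = 0 \<or> j = 1 \<or> j = 2" by (auto simp: P_def K_def)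
        then show "(?G' * P) $$ (i, j) = (P * K) $$ (i, j)"
          using N(1) N1 R' by (auto simp: P_def K_def scalar_prod_def numeral_3_eq_3 numeral_2_eq_2 algebra_simps)
      qed (use G' in \<open>auto simp: P_def K_def\<close>)
      moreover have "det P \<noteq> 0"
      proof -
        have "det P = prod_list (diag_mat P)"
          by (rule det_upper_triangular[of _ 3]) (auto simp: P_def)
        also have "\<dots> = 1" by (simp add: diag_mat_def P_def numeral_3_eq_3)
        finally show ?thesis by simp
      qed
      ultimately have simK: "similar_mat ?G' K"
        using G' by (intro similar_matI_intertwine[of _ 3 _ P]) (auto simp: P_def K_def)
      have "idem_comb 3 [x, b] K"
        by (rule idem_comb_2_rowsI[of _ _ _ _ "\<lambda>i. i < 2" "\<lambda>i. i = 2"])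
          (use 2 in \<open>auto simp: K_def b_def less_Suc_eq numeral_2_eq_2\<close>)
      then have "idem_comb 3 [x, b] ?G" using idem_comb_similar[OF similar_mat_trans[OF sim' simK]] by blast
      then show ?thesis by (intro exI[of _ "[x, b]"]) simp
    next
      case 3
      \<comment> \<open>The previous choice would give the coefficient \<open>b = 0\<close>. Passing
        to \<open>x I\<close> minus the matrix makes the corner 0 and keeps the trace of the lower
        block equal to \<open>x\<close>; since the coefficients used there sum to \<open>x\<close>,
        complementing both idempotents leads back.\<close>
      define M' where "M' = x \<cdot>\<^sub>m 1\<^sub>m 2 - M"
      have M': "M' \<in> carrier_mat 2 2" using M by (simp add: M'_def minus_carrier_mat)
      have "M' \<noteq> y \<cdot>\<^sub>m 1\<^sub>m 2" for y
      proof
        assume y: "M' = y \<cdot>\<^sub>m 1\<^sub>m 2"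
        have "M = x \<cdot>\<^sub>m 1\<^sub>m 2 - M'" unfolding M'_def using M by (intro eq_matI) auto
        also have "\<dots> = (x - y) \<cdot>\<^sub>m 1\<^sub>m 2" unfolding y by (intro eq_matI) auto
        finally show False using False by blast
      qed
      then obtain c' where simM': "similar_mat M' (comp_mat 2 c')" and c': "c' $ 1 = M' $$ (0, 0) + M' $$ (1, 1)"
        using similar_comp_mat_2[OF M'] by blast
      have "M' $$ (0, 0) + M' $$ (1, 1) = x + x - (M $$ (0, 0) + M $$ (1, 1))"
        using M by (simp add: M'_def)
      then have c'x: "c' $ 1 = x" using c' c 3 by simp
      obtain a where a: "a \<noteq> 0" "a \<noteq> x" using more_than_two_elementsD[OF more] by blast
      have R': "- R \<in> carrier_mat 1 2" using R by simp
      have "idem_comb 3 [a, x - a] (four_block_mat (0 \<cdot>\<^sub>m 1\<^sub>m 1) (- R) (0\<^sub>m 2 1) M')" (is "idem_comb 3 _ ?K")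
        using idem_comb_2_zero_block[OF R' M' simM', of a "x - a"] a c'x by simp
      from idem_comb_2_complement[OF this] have "idem_comb 3 [a, x - a] (x \<cdot>\<^sub>m 1\<^sub>m 3 - ?K)" by simp
      also have "x \<cdot>\<^sub>m 1\<^sub>m 3 - ?K = ?G"
        using R M by (intro eq_matI) (auto simp: M'_def)
      finally show ?thesis by (intro exI[of _ "[a, x - a]"]) simp
    qed
  qed
  then show ?thesis using idem_comb_similar[OF sim] by blast
qed

section \<open>The values of \<open>\<ell>\<^sub>n\<close>\<close>

text \<open>The witness has no eigenvector, so \<open>P\<close> and \<open>Q\<close> have equal
  traces and the trace 1 of the witness is a multiple of \<open>a + b\<close>. With coefficients in
  \<open>{0, 1}\<close> exactly one of them is then 1, and the witness would itself be
  idempotent.\<close>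

lemma not_two_idempotents_two_elements:
  assumes "\<not> more_than_two_elements TYPE('a::field)"
  shows "\<exists>A \<in> carrier_mat 2 2. \<nexists>a b. idem_comb 2 [a, b] (A :: 'a mat)"
proof -
  have el: "x = 0 \<or> x = 1" for x :: 'a using two_elementsD[OF assms] .
  have two: "(1 :: 'a) + 1 = 0" using el[of "1 + 1"] by (metis add_cancel_left_left zero_neq_one)
  \<comment> \<open>The companion matrix of \<open>X^2 + X + 1\<close>, which is irreducible over
    the field with two elements.\<close>
  define A where "A = mat 2 2 (\<lambda>(i, j). if i = 0 \<and> j = 0 then 0 else (1 :: 'a))"
  have A: "A \<in> carrier_mat 2 2" by (simp add: A_def)
  have noeig: "v = 0\<^sub>v 2" if v: "v \<in> carrier_vec 2" and Av: "A *\<^sub>v v = y \<cdot>\<^sub>v v" for v y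
  proof -
    have e: "(A *\<^sub>v v) $ i = y * v $ i" if "i < 2" for i using that v Av by simp
    have 1: "v $ 1 = y * v $ 0" and 2: "v $ 0 + v $ 1 = y * v $ 1"
      using e[of 0] e[of 1] v by (simp_all add: A_def scalar_prod_def numeral_2_eq_2)
    have v0: "v $ 0 = 0"
    proof (cases "y = 0")
      case True
      then show ?thesis using 1 2 by simp
    next
      case False
      then have "y = 1" using el[of y] by simp
      then show ?thesis using 2 by simp
    qed
    then have "v $ 1 = 0" using 1 by simp
    with v0 show ?thesis using v by (intro eq_vecI) (auto simp: less_2_cases_iff)
  qed
  have "\<not> idem_comb 2 [a, b] A" for a b
  proof
    assume "idem_comb 2 [a, b] A"
    then obtain P Q where P: "P \<in> carrier_mat 2 2" "P * P = P" and Q: "Q \<in> carrier_mat 2 2" "Q * Q = Q"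
      and AE: "A = a \<cdot>\<^sub>m P + b \<cdot>\<^sub>m Q"
      using idem_comb_2D by blast
    have sq: "A * A \<noteq> A"
    proof
      assume "A * A = A"
      then have "(A * A) $$ (0, 0) = A $$ (0, 0)" by simp
      then show False by (simp add: A_def scalar_prod_def numeral_2_eq_2)
    qed
    have no: "x = 0\<^sub>v 2" if x: "x \<in> carrier_vec 2" "P *\<^sub>v x \<in> {0\<^sub>v 2, x}" "Q *\<^sub>v x \<in> {0\<^sub>v 2, x}" for x
    proof -
      obtain y where "A *\<^sub>v x = y \<cdot>\<^sub>v x"
        unfolding AE using common_eigenvector_lincomb[OF P(1) Q(1) x] by blast
      then show ?thesis by (rule noeig[OF x(1)])
    qed
    define t where "t = (\<Sum>i<2. P $$ (i, i))"
    have tQ: "(\<Sum>i<2. Q $$ (i, i)) = t"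
      using idempotents_no_common_eigenvector(1)[OF P Q no] by (simp add: t_def)
    have "1 = (\<Sum>i<2. A $$ (i, i))" by (simp add: A_def numeral_2_eq_2)
    also have "\<dots> = (\<Sum>i<2. a * P $$ (i, i) + b * Q $$ (i, i))"
      unfolding AE using P Q by (intro sum.cong) auto
    also have "\<dots> = (a + b) * t"
      unfolding sum.distrib sum_distrib_left[symmetric] tQ t_def[symmetric] by (simp add: algebra_simps)
    finally have "a + b \<noteq> 0" by auto
    then consider "a = 1" "b = 0" | "a = 0" "b = 1" using el[of a] el[of b] two by auto
    then show False
    proof cases
      case 1
      then have "A = P" unfolding AE using P Q by (intro eq_matI) auto
      then show False using sq P by simp
    next
      case 2
      then have "A = Q" unfolding AE using P Q by (intro eq_matI) auto
      then show False using sq Q by simp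
    qed
  qed
  then show ?thesis using A by blast
qed

lemma not_two_idempotents_rootless_cubic:
  assumes "\<not> every_cubic_has_root TYPE('a::field)" and n: "n \<ge> 3"
  shows "\<exists>A \<in> carrier_mat n n. \<nexists>a b. idem_comb n [a, b] (A :: 'a mat)"
proof -
  obtain p :: "'a poly" where "degree p = 3" "\<And>x. poly p x \<noteq> 0"
    using assms by (auto simp: every_cubic_has_root_def)
  then obtain B :: "'a mat" where B: "B \<in> carrier_mat 3 3"
    and no: "\<And>v y. v \<in> carrier_vec 3 \<Longrightarrow> B *\<^sub>v v = y \<cdot>\<^sub>v v \<Longrightarrow> v = 0\<^sub>v 3"
    by (rule rootless_cubic_matrix) blast
  have "four_block_mat B (0\<^sub>m 3 (n - 3)) (0\<^sub>m (n - 3) 3) (0\<^sub>m (n - 3) (n - 3)) \<in> carrier_mat n n"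
    using four_block_carrier_mat[OF B zero_carrier_mat[of "n - 3" "n - 3"]] n
    by (metis le_add_diff_inverse)
  moreover have "\<not> idem_comb n [a, b]
    (four_block_mat B (0\<^sub>m 3 (n - 3)) (0\<^sub>m (n - 3) 3) (0\<^sub>m (n - 3) (n - 3)))" for a b
    by (rule not_idem_comb_2_padded[OF B n]) (use no in blast)
  ultimately show ?thesis by blast
qed

lemma not_two_idempotents_infinite:
  assumes inf: "infinite (UNIV :: 'a::field set)" and n: "n \<ge> 4"
  shows "\<exists>A \<in> carrier_mat n n. \<nexists>a b. idem_comb n [a, b] (A :: 'a mat)"
proof -
  have ex: "\<exists>x :: 'a. x \<notin> S" if "finite S" for S
    using ex_new_if_finite[OF inf that] .
  obtain y :: 'a where y: "y \<notin> {0, 1}" using ex[of "{0, 1}"] by auto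
  obtain z :: 'a where z: "z \<notin> {0, 1, y, 1 + y, y - 1, 1 - y}"
    using ex[of "{0, 1, y, 1 + y, y - 1, 1 - y}"] by auto
  \<comment> \<open>Each excluded value is 0, one of the earlier diagonal entries, or the solution
    for \<open>w\<close> of an equation between sums forbidden by
    \<open>not_idem_comb_2_generic_diagonal\<close>; \<open>z\<close> was chosen in the same
    way.\<close>
  let ?W = "{0, 1, y, z, 1 + y, 1 + z, y + z, y - 1, z - 1, 1 - y, z - y, 1 - z, y - z,
    1 + y - z, 1 + z - y, y + z - 1}"
  obtain w :: 'a where w: "w \<notin> ?W" using ex[of ?W] by auto
  define d where "d = (\<lambda>i :: nat. if i = 0 then 1 else if i = 1 then y else if i = 2 then z
    else if i = 3 then w else 0)"
  have "\<not> idem_comb n [a, b] (mat n n (\<lambda>(i, j). if i = j then d i else 0))" for a b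
  proof (rule not_idem_comb_2_generic_diagonal[OF n])
    show "distinct [d 0, d 1, d 2, d 3]" using y z w by (auto simp: d_def)
    show "d 0 + d 1 \<notin> {d 2, d 3, d 2 + d 3}" "d 0 + d 2 \<notin> {d 1, d 3, d 1 + d 3}"
      "d 0 + d 3 \<notin> {d 1, d 2, d 1 + d 2}" "d 1 + d 2 \<notin> {d 0, d 3}" "d 1 + d 3 \<notin> {d 0, d 2}"
      "d 2 + d 3 \<notin> {d 0, d 1}"
      using z w by (auto simp: d_def algebra_simps)
  qed (use y z w in \<open>auto simp: d_def\<close>)
  then show ?thesis by (intro bexI[of _ "mat n n (\<lambda>(i, j). if i = j then d i else 0)"]) auto
qed

section \<open>Passing from witnesses to the least length\<close>

text \<open>A multiple \<open>A\<close> of an idempotent satisfies \<open>A * A = c A\<close>, so it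
  cannot be a nonzero matrix of square zero.\<close>

lemma not_one_idempotent:
  assumes "n \<ge> 2"
  shows "\<exists>A \<in> carrier_mat n n. \<nexists>c. idem_comb n [c] (A :: 'a::field mat)"
proof -
  define A where "A = mat n n (\<lambda>(i, j). if i = 0 \<and> j = 1 then 1 else (0 :: 'a))"
  have A: "A \<in> carrier_mat n n" by (simp add: A_def)
  have "\<not> idem_comb n [c] A" for c
  proof
    assume "idem_comb n [c] A"
    then obtain P where P: "P \<in> carrier_mat n n" "P * P = P" and AE: "A = 0\<^sub>m n n + c \<cdot>\<^sub>m P"
      by (auto simp: idem_comb.simps idempotent_mat_def)
    have AE: "A = c \<cdot>\<^sub>m P" unfolding AE using P by (intro eq_matI) auto
    have "A * A = c \<cdot>\<^sub>m A"
      using P mult_smult_distrib[OF A P(1), of c] mult_smult_assoc_mat[OF P(1) P(1), of c] by (simp add: AE)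
    moreover have "(A * A) $$ (0, 1) = 0"
      using assms by (auto simp: A_def scalar_prod_def intro!: sum.neutral)
    ultimately have "c * A $$ (0, 1) = 0" using assms A by simp
    then have "c = 0" using assms by (simp add: A_def)
    then have "A $$ (0, 1) = 0" unfolding AE using assms P by simp
    then show False using assms by (simp add: A_def)
  qed
  then show ?thesis using A by blast
qed

lemma is_lincomb_2_iff: "is_lincomb_of_idempotents n 2 A \<longleftrightarrow> (\<exists>a b. idem_comb n [a, b] A)"
  unfolding is_lincomb_iff by (metis (no_types, lifting) One_nat_def Suc_1 length_0_conv length_Suc_conv)

lemma is_lincomb_1_iff: "is_lincomb_of_idempotents n 1 A \<longleftrightarrow> (\<exists>a. idem_comb n [a] A)"
  unfolding is_lincomb_iff by (metis One_nat_def length_0_conv length_Suc_conv)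

lemma ell_1: "ell TYPE('a::field) 1 = 1"
proof -
  have "ell TYPE('a) 1 = Suc 0"
  proof (rule ell_eqI)
    fix A :: "'a mat" assume "A \<in> carrier_mat 1 1"
    then have "A = A $$ (0, 0) \<cdot>\<^sub>m 1\<^sub>m 1" by (intro eq_matI) auto
    then have "idem_comb 1 [A $$ (0, 0)] A" using idem_comb_scalar_Cons by metis
    then show "is_lincomb_of_idempotents 1 (Suc 0) A" using is_lincomb_1_iff[of 1 A] by auto
  next
    have "1\<^sub>m 1 \<noteq> (0\<^sub>m 1 1 :: 'a mat)"
      by (metis index_one_mat(1) index_zero_mat(1) less_one zero_neq_one)
    then show "\<not> is_lincomb_of_idempotents 1 0 (1\<^sub>m 1 :: 'a mat)" by (simp add: is_lincomb_0)
  qed simp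
  then show ?thesis by simp
qed

lemma ell_2:
  assumes "n \<ge> 2" "\<And>A :: 'a::field mat. A \<in> carrier_mat n n \<Longrightarrow> \<exists>cs. length cs = 2 \<and> idem_comb n cs A"
  shows "ell TYPE('a) n = 2"
proof -
  obtain B :: "'a mat" where B: "B \<in> carrier_mat n n" "\<not> is_lincomb_of_idempotents n 1 B"
    using not_one_idempotent[OF assms(1)] unfolding is_lincomb_1_iff by blast
  have "ell TYPE('a) n = Suc 1"
    by (rule ell_eqI[OF _ B]) (use assms(2) in \<open>simp add: is_lincomb_iff numeral_2_eq_2\<close>)
  then show ?thesis by simp
qed

lemma eigenvector_of_every_cubic_has_root:
  fixes A :: "'a::field mat"
  assumes A: "A \<in> carrier_mat 3 3" and "every_cubic_has_root TYPE('a)"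
  obtains v x where "v \<in> carrier_vec 3" "v \<noteq> 0\<^sub>v 3" "A *\<^sub>v v = x \<cdot>\<^sub>v v"
proof -
  obtain x where "poly (char_poly A) x = 0"
    using degree_monic_char_poly[OF A] assms(2) unfolding every_cubic_has_root_def by blast
  then have "eigenvalue A x" using eigenvalue_root_char_poly[OF A] by simp
  then show ?thesis using that A by (auto simp: eigenvalue_def eigenvector_def)
qed

theorem theorem1:
  fixes n :: nat
  assumes "n > 0"
  shows "(\<forall>A \<in> (carrier_mat n n :: 'a::field mat set). is_lincomb_of_idempotents n 3 A) \<and>
    (n = 1 \<longrightarrow> ell TYPE('a) n = 1) \<and>
    (n = 2 \<and> more_than_two_elements TYPE('a) \<longrightarrow> ell TYPE('a) n = 2) \<and>
    (n = 3 \<and> every_cubic_has_root TYPE('a) \<longrightarrow> ell TYPE('a) n = 2) \<and>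
    (\<not> (n = 1 \<or> (n = 2 \<and> more_than_two_elements TYPE('a)) \<or>
        (n = 3 \<and> every_cubic_has_root TYPE('a)))
      \<longrightarrow> ell TYPE('a) n = 3)"
proof (intro conjI impI ballI)
  show "is_lincomb_of_idempotents n 3 A" if "A \<in> carrier_mat n n" for A :: "'a mat"
    using three_idempotents[OF that] .
  show "ell TYPE('a) n = 1" if "n = 1" using that ell_1 by simp
  show "ell TYPE('a) n = 2" if "n = 2 \<and> more_than_two_elements TYPE('a)"
    using that two_idempotents_dim_2 ell_2[of 2] by blast
  show "ell TYPE('a) n = 2" if *: "n = 3 \<and> every_cubic_has_root TYPE('a)"
  proof (rule ell_2)
    show "2 \<le> n" using * by simp
    fix A :: "'a mat" assume "A \<in> carrier_mat n n"
    then have A: "A \<in> carrier_mat 3 3" using * by simp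
    have "more_than_two_elements TYPE('a)"
      using infinite_of_every_cubic_has_root * by (auto simp: more_than_two_elements_def)
    moreover obtain v x where "v \<in> carrier_vec 3" "v \<noteq> 0\<^sub>v 3" "A *\<^sub>v v = x \<cdot>\<^sub>v v"
      using eigenvector_of_every_cubic_has_root[OF A] * by blast
    ultimately show "\<exists>cs. length cs = 2 \<and> idem_comb n cs A"
      using two_idempotents_dim_3[OF A] * by simp
  qed
  show "ell TYPE('a) n = 3"
    if *: "\<not> (n = 1 \<or> (n = 2 \<and> more_than_two_elements TYPE('a)) \<or> (n = 3 \<and> every_cubic_has_root TYPE('a)))"
  proof -
    consider "n = 2" "\<not> more_than_two_elements TYPE('a)" | "n \<ge> 3" "\<not> every_cubic_has_root TYPE('a)"
      | "n \<ge> 4" "every_cubic_has_root TYPE('a)"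
      using * assms by linarith
    then have "\<exists>B \<in> carrier_mat n n. \<nexists>a b. idem_comb n [a, b] (B :: 'a mat)"
    proof cases
      case 1
      then show ?thesis using not_two_idempotents_two_elements by simp
    next
      case 2
      then show ?thesis using not_two_idempotents_rootless_cubic by blast
    next
      case 3
      then show ?thesis using not_two_idempotents_infinite infinite_of_every_cubic_has_root by blast
    qed
    then obtain B :: "'a mat" where B: "B \<in> carrier_mat n n" "\<not> is_lincomb_of_idempotents n 2 B"
      unfolding is_lincomb_2_iff by blast
    have "ell TYPE('a) n = Suc 2"
      by (rule ell_eqI[OF _ B]) (use three_idempotents in simp)
    then show ?thesis by simp
  qed
qed

end
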